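(* Let $d\ge2$, $1<p<\infty$, let $\Omega\subseteq\mathbb{R}^d$ be a domain and $V\in L^\infty_{\mathrm{loc}}(\Omega)$, and suppose that $Q_V(u)=\frac1p\int_\Omega(|\nabla u|^p+V|u|^p)\,dx$ is nonnegative on $C_0^\infty(\Omega)$. Let $\Omega_1\Subset\Omega$ be an open set, and let $u\in C(\Omega\setminus\Omega_1)$ be a positive solution of the equation $Q_V'(u)=0$ in $\Omega\setminus\overline{\Omega_1}$ satisfying $|\nabla u|\ne0$ in $\Omega\setminus\overline{\Omega_1}$. Then $u\in\mathcal{M}_{\Omega,\overline{\Omega_1}}$ if for every smooth open set $\Omega_2$ satisfying $\Omega_1\Subset\Omega_2\Subset\Omega$, and every nonempty open set $B\Subset(\Omega\setminus\overline{\Omega_2})$, there exists a sequence $\{u_k\}\subset C_0^\infty(\Omega)$, $u_k\ge0$, such that $\int_B|u_k|^p\,dx=1$ for all $k\in\mathbb{N}$, and $$\lim_{k\to\infty}\int_{\Omega\setminus\overline{\Omega_2}}L(u_k,u)\,dx=0,$$ where $$L(w,v):=\frac1p\left[|\nabla w|^p+(p-1)\frac{w^p}{v^p}|\nabla v|^p-p\frac{w^{p-1}}{v^{p-1}}\nabla w\cdot|\nabla v|^{p-2}\nabla v\right].$$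
   Context: $A\Subset B$ means that $\overline{A}$ is compact and contained in $B$. Equation: $Q_V'(u):=-\nabla\cdot(|\nabla u|^{p-2}\nabla u)+V|u|^{p-2}u$. For an open set $U\subseteq\Omega$, a function $v\in W^{1,p}_{\mathrm{loc}}(U)$ is a (weak) solution of $Q_V'(u)=0$ in $U$ if $\int_U(|\nabla v|^{p-2}\nabla v\cdot\nabla\varphi+V|v|^{p-2}v\varphi)\,dx=0$ for every $\varphi\in C_0^\infty(U)$ (weak solutions have H\"older continuous first derivatives locally). A real function $v\in C^1_{\mathrm{loc}}(U)$ is a supersolution in $U$ if this integral is $\ge0$ for every nonnegative $\varphi\in C_0^\infty(U)$. Minimal growth: let $K_0$ be a compact set in $\Omega$. A positive solution $u$ of $Q_V'(u)=0$ in $\Omega\setminus K_0$ belongs to $\mathcal{M}_{\Omega,K_0}$ (positive solutions of minimal growth in a neighborhood of infinity in $\Omega$) if for any compact set $K$ in $\Omega$ with smooth boundary such that $K_0\Subset\mathrm{int}(K)$, and any positive supersolution $v\in C((\Omega\setminus K)\cup\partial K)$ of $Q_V'(u)=0$ in $\Omega\setminus K$, the inequality $u\le v$ on $\partial K$ implies $u\le v$ in $\Omega\setminus K$. *)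

theory Defs
  imports "HOL-Analysis.Analysis"
begin

text \<open>
  \<open>\<real>\<^sup>d\<close> is an arbitrary \<^class>\<open>euclidean_space\<close> of dimension \<open>d\<close>. Functions on a subset of
  \<open>\<real>\<^sup>d\<close> are total functions whose values outside that subset are never inspected.
\<close>

definition compactly_in :: "'a::topological_space set \<Rightarrow> 'a set \<Rightarrow> bool" where
  "compactly_in A B \<longleftrightarrow> compact (closure A) \<and> closure A \<subseteq> B"

text \<open>The classical gradient; unspecified at points where \<open>f\<close> is not differentiable.\<close>

definition grad :: "('a::euclidean_space \<Rightarrow> real) \<Rightarrow> 'a \<Rightarrow> 'a" where
  "grad f x = (THE D. GDERIV f x :> D)"

primrec Ck_on :: "nat \<Rightarrow> 'a::euclidean_space set \<Rightarrow> ('a \<Rightarrow> real) \<Rightarrow> bool" where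
  "Ck_on 0 S f \<longleftrightarrow> continuous_on S f"
| "Ck_on (Suc k) S f \<longleftrightarrow>
     (\<forall>x\<in>S. f differentiable (at x)) \<and> (\<forall>b\<in>Basis. Ck_on k S (\<lambda>x. grad f x \<bullet> b))"

definition smooth_on :: "'a::euclidean_space set \<Rightarrow> ('a \<Rightarrow> real) \<Rightarrow> bool" where
  "smooth_on S f \<longleftrightarrow> (\<forall>k. Ck_on k S f)"

text \<open>\<open>C\<^sub>0\<^sup>\<infinity>(U)\<close>, each function being extended by zero outside \<open>U\<close>.\<close>

definition C0_inf :: "'a::euclidean_space set \<Rightarrow> ('a \<Rightarrow> real) set" where
  "C0_inf U = {\<phi>. smooth_on UNIV \<phi> \<and> compactly_in {x. \<phi> x \<noteq> 0} U}"

text \<open>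
  Local defining functions: near each boundary point the interior, the boundary and the exterior
  of \<open>S\<close> are where \<open>\<rho>\<close> is negative, zero and positive, respectively. This covers open and closed
  sets alike; \<open>S\<close> lies locally on one side of its boundary.
\<close>

definition smooth_boundary :: "'a::euclidean_space set \<Rightarrow> bool" where
  "smooth_boundary S \<longleftrightarrow>
     (\<forall>x\<in>frontier S. \<exists>W \<rho>. open W \<and> x \<in> W \<and> smooth_on W \<rho> \<and> (\<forall>y\<in>W. grad \<rho> y \<noteq> 0) \<and>
        interior S \<inter> W = {y\<in>W. \<rho> y < 0} \<and> frontier S \<inter> W = {y\<in>W. \<rho> y = 0})"

definition Lp_loc ::
  "real \<Rightarrow> 'a::euclidean_space set \<Rightarrow> ('a \<Rightarrow> 'b::euclidean_space) set" where
  "Lp_loc p U = {f. f \<in> borel_measurable (lebesgue_on U) \<and>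
     (\<forall>K. compact K \<and> K \<subseteq> U \<longrightarrow> set_integrable lebesgue K (\<lambda>x. norm (f x) powr p))}"

definition Linf_loc :: "'a::euclidean_space set \<Rightarrow> ('a \<Rightarrow> real) set" where
  "Linf_loc U = {f. f \<in> borel_measurable (lebesgue_on U) \<and>
     (\<forall>K. compact K \<and> K \<subseteq> U \<longrightarrow> (\<exists>C. AE x in lebesgue. x \<in> K \<longrightarrow> \<bar>f x\<bar> \<le> C))}"

definition weak_gradient ::
  "'a::euclidean_space set \<Rightarrow> ('a \<Rightarrow> real) \<Rightarrow> ('a \<Rightarrow> 'a) \<Rightarrow> bool" where
  "weak_gradient U v g \<longleftrightarrow> v \<in> Lp_loc 1 U \<and> g \<in> Lp_loc 1 U \<and>
     (\<forall>\<phi>\<in>C0_inf U.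
        (LINT x:U|lebesgue. v x *\<^sub>R grad \<phi> x) = - (LINT x:U|lebesgue. \<phi> x *\<^sub>R g x))"

definition W1p_loc :: "real \<Rightarrow> 'a::euclidean_space set \<Rightarrow> ('a \<Rightarrow> real) set" where
  "W1p_loc p U = {v \<in> Lp_loc p U. \<exists>g\<in>Lp_loc p U. weak_gradient U v g}"

definition Q_V :: "real \<Rightarrow> ('a::euclidean_space \<Rightarrow> real) \<Rightarrow> 'a set \<Rightarrow> ('a \<Rightarrow> real) \<Rightarrow> real" where
  "Q_V p V \<Omega> u =
     1 / p * (LINT x:\<Omega>|lebesgue. norm (grad u x) powr p + V x * \<bar>u x\<bar> powr p)"

text \<open>
  The weak form of \<open>Q\<^sub>V'(v)\<close> tested with \<open>\<phi>\<close>, where \<open>g\<close> is the (weak or classical) gradient of \<open>v\<close>.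
  As \<open>0 powr a = 0\<close>, the expressions \<open>|\<nabla>v|\<^sup>p\<^sup>-\<^sup>2\<nabla>v\<close> and \<open>|v|\<^sup>p\<^sup>-\<^sup>2v\<close> vanish where \<open>\<nabla>v\<close>, resp. \<open>v\<close>, does,
  also for \<open>p < 2\<close>.
\<close>

definition weak_form ::
  "real \<Rightarrow> ('a::euclidean_space \<Rightarrow> real) \<Rightarrow> 'a set \<Rightarrow> ('a \<Rightarrow> real) \<Rightarrow> ('a \<Rightarrow> 'a) \<Rightarrow> ('a \<Rightarrow> real) \<Rightarrow> real"
  where
  "weak_form p V U v g \<phi> =
     (LINT x:U|lebesgue. (norm (g x) powr (p - 2) *\<^sub>R g x) \<bullet> grad \<phi> x
        + V x * \<bar>v x\<bar> powr (p - 2) * v x * \<phi> x)"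

definition weak_solution ::
  "real \<Rightarrow> ('a::euclidean_space \<Rightarrow> real) \<Rightarrow> 'a set \<Rightarrow> ('a \<Rightarrow> real) \<Rightarrow> bool" where
  "weak_solution p V U v \<longleftrightarrow> v \<in> W1p_loc p U \<and>
     (\<exists>g. weak_gradient U v g \<and> (\<forall>\<phi>\<in>C0_inf U. weak_form p V U v g \<phi> = 0))"

text \<open>
  Weak solutions are only determined almost everywhere. By regularity theory each has a
  representative with Hoelder continuous first derivatives; continuity singles it out.
\<close>

definition positive_solution ::
  "real \<Rightarrow> ('a::euclidean_space \<Rightarrow> real) \<Rightarrow> 'a set \<Rightarrow> ('a \<Rightarrow> real) \<Rightarrow> bool" where
  "positive_solution p V U u \<longleftrightarrow>
     weak_solution p V U u \<and> continuous_on U u \<and> (\<forall>x\<in>U. 0 < u x)"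

definition supersolution ::
  "real \<Rightarrow> ('a::euclidean_space \<Rightarrow> real) \<Rightarrow> 'a set \<Rightarrow> ('a \<Rightarrow> real) \<Rightarrow> bool" where
  "supersolution p V U v \<longleftrightarrow> Ck_on 1 U v \<and>
     (\<forall>\<phi>\<in>C0_inf U. (\<forall>x. 0 \<le> \<phi> x) \<longrightarrow> 0 \<le> weak_form p V U v (grad v) \<phi>)"

text \<open>
  \<open>K \<noteq> {}\<close> matters only if \<open>K0 = {}\<close>: the comparison with \<open>K = {}\<close> would have no boundary
  condition, so that no \<open>u\<close> could satisfy it (take \<open>v = u / 2\<close>).
\<close>

definition minimal_growth ::
  "real \<Rightarrow> ('a::euclidean_space \<Rightarrow> real) \<Rightarrow> 'a set \<Rightarrow> 'a set \<Rightarrow> ('a \<Rightarrow> real) set" where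
  "minimal_growth p V \<Omega> K0 = {u. positive_solution p V (\<Omega> - K0) u \<and>
     (\<forall>K v. compact K \<and> K \<noteq> {} \<and> K \<subseteq> \<Omega> \<and> smooth_boundary K \<and> compactly_in K0 (interior K) \<and>
        continuous_on ((\<Omega> - K) \<union> frontier K) v \<and>
        supersolution p V (\<Omega> - K) v \<and> (\<forall>x\<in>\<Omega> - K. 0 < v x) \<and>
        (\<forall>x\<in>frontier K. u x \<le> v x)
      \<longrightarrow> (\<forall>x\<in>\<Omega> - K. u x \<le> v x))}"

definition L :: "real \<Rightarrow> ('a::euclidean_space \<Rightarrow> real) \<Rightarrow> ('a \<Rightarrow> real) \<Rightarrow> 'a \<Rightarrow> real" where
  "L p w v x = 1 / p *
     (norm (grad w x) powr p
      + (p - 1) * (w x powr p / v x powr p) * norm (grad v x) powr p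
      - p * (w x powr (p - 1) / v x powr (p - 1))
          * (grad w x \<bullet> (norm (grad v x) powr (p - 2) *\<^sub>R grad v x)))"

end

theory Submission
  imports Defs
begin

text \<open>
  Let \<open>v\<close> be a positive supersolution in \<open>\<Omega> - K\<close> with \<open>u \<le> v\<close> on the boundary of \<open>K\<close>, and suppose that
  \<open>u > v\<close> at some point. Choose \<open>c > 1\<close> such that still \<open>u > c v\<close> there. Put \<open>s = c v / u\<close>, \<open>a = \<nabla>u / u\<close>,
  \<open>b = \<nabla>v / v\<close> and \<open>A(x) = \<bar>x\<bar>\<^sup>p\<^sup>-\<^sup>2 x\<close>. On compact subsets of \<open>\<Omega>\<close> the set \<open>{u \<ge> c v}\<close> keeps away from \<open>K\<close>, so for
  \<open>0 \<le> w \<in> C\<^sub>0\<^sup>\<infinity>(\<Omega>)\<close> the function \<open>\<psi> = w\<^sup>p ((1 - s)\<^sup>+)\<^sup>2\<close> has compact support in \<open>\<Omega> - K\<close>. Test the equation for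
  \<open>u\<close> with \<open>\<psi> / u\<^sup>p\<^sup>-\<^sup>1\<close>, the inequality for \<open>v\<close> with \<open>\<psi> / v\<^sup>p\<^sup>-\<^sup>1\<close>, and subtract. The potential cancels. With
  the Picone remainder \<open>J(x,y) = \<bar>y\<bar>\<^sup>p + (p - 1) \<bar>x\<bar>\<^sup>p - p A(x) \<bullet> y \<ge> 0\<close>, for which \<open>p L(w,u) = J(w a, \<nabla>w)\<close>, and as
  \<open>\<nabla>s = s (b - a)\<close>, the result is (\<open>key_inequality\<close>)

  \<open>\<integral> ((1 - s)\<^sup>+)\<^sup>2 J(w b, \<nabla>w) + 2 \<integral> w\<^sup>p (1 - s)\<^sup>+ s (A(a) - A(b)) \<bullet> (a - b) \<le> \<integral> p L(w,u)\<close>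

  with the right-hand side over \<open>\<Omega> - K\<close>. Both terms on the left are nonnegative. For \<open>w = u\<^sub>k\<close>, belonging to
  \<open>\<Omega>2 = interior K\<close> and a ball \<open>B\<close> in \<open>{u > c v}\<close>, the right-hand side tends to zero.

  Vanishing of the first term makes \<open>u\<^sub>k / v\<close> nearly constant on \<open>B\<close>, by coercivity of \<open>J\<close> and the Poincare
  inequality. Since \<open>\<integral>\<^sub>B u\<^sub>k\<^sup>p = 1\<close>, the mass is therefore spread over \<open>B\<close>, and vanishing of the second term
  gives \<open>a = b\<close> almost everywhere on \<open>B\<close> (\<open>log_gradients_agree_AE\<close>). So \<open>\<nabla>s = 0\<close> almost everywhere, and
  \<open>s\<close> is locally constant on \<open>{s < 1}\<close>. A level set of \<open>s\<close> below \<open>1\<close> is then open and closed in the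
  connected set \<open>\<Omega>\<close> without meeting \<open>K\<close>, which is absurd (\<open>superlevel_empty\<close>).

  Only pointwise differentiability of \<open>u\<close> is at hand, no continuity of \<open>\<nabla>u\<close>, and three facts stand in for
  regularity theory. The weak gradient is the classical one almost everywhere
  (\<open>weak_gradient_eq_grad\<close>), which puts \<open>\<nabla>u\<close> locally in \<open>L\<^sup>p\<close>. Everywhere differentiable functions with compact
  support and gradient in \<open>L\<^sup>p\<close> are admissible for testing (\<open>test_function_extension\<close>). Finally, a
  differentiable function whose gradient vanishes almost everywhere on a ball is constant there
  (\<open>eq_const_if_grad_AE_0\<close>). The fundamental theorem of calculus for everywhere differentiable functions of one
  variable, integrated over translations, gives the last two facts and the Poincare inequality.
\<close>

section \<open>Gradients and test functions\<close>

lemma grad_eqI: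
  assumes "GDERIV f x :> D" shows "grad f x = D"
  unfolding grad_def
proof (rule the_equality)
  fix D' assume "GDERIV f x :> D'"
  then have "(\<lambda>h. h \<bullet> D) = (\<lambda>h. h \<bullet> D')"
    using assms unfolding gderiv_def by (rule has_derivative_unique[rotated])
  then have "h \<bullet> D' = h \<bullet> D" for h by metis
  then show "D' = D" by (metis vector_eq_rdot inner_commute)
qed fact

lemma GDERIV_grad:
  fixes f :: "'a::euclidean_space \<Rightarrow> real"
  assumes "f differentiable (at x)" shows "GDERIV f x :> grad f x"
proof -
  from assms obtain f' where f': "(f has_derivative f') (at x)"
    by (auto simp: differentiable_def)
  then interpret bounded_linear f' by (rule has_derivative_bounded_linear)
  define D where "D = (\<Sum>b\<in>Basis. f' b *\<^sub>R b)"
  have "f' h = h \<bullet> D" for h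
  proof -
    have "f' h = f' (\<Sum>b\<in>Basis. (h \<bullet> b) *\<^sub>R b)" by (simp add: euclidean_representation)
    also have "\<dots> = (\<Sum>b\<in>Basis. (h \<bullet> b) * f' b)" by (simp add: sum scale)
    finally show ?thesis by (simp add: D_def inner_sum_right mult.commute)
  qed
  then have "f' = (\<lambda>h. h \<bullet> D)" by auto
  with f' have "GDERIV f x :> D" by (simp add: gderiv_def)
  then show ?thesis using grad_eqI by metis
qed

lemma GDERIV_imp_differentiable: "GDERIV f x :> D \<Longrightarrow> f differentiable (at x)"
  by (auto simp: gderiv_def differentiable_def)

lemma continuous_on_if_differentiable:
  fixes f :: "'a::euclidean_space \<Rightarrow> real"
  assumes "\<And>x. x \<in> S \<Longrightarrow> f differentiable (at x)" shows "continuous_on S f"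
  using assms by (intro differentiable_imp_continuous_on) (simp add: differentiable_on_def differentiable_at_withinI)

lemma GDERIV_transform_open:
  assumes "GDERIV f x :> D" "open S" "x \<in> S" "\<And>y. y \<in> S \<Longrightarrow> f y = g y"
  shows "GDERIV g x :> D"
  using assms unfolding gderiv_def by (metis has_derivative_transform_within_open)

lemma GDERIV_eq_0_on_open:
  assumes "open S" "x \<in> S" "\<And>y. y \<in> S \<Longrightarrow> f y = 0"
  shows "GDERIV f x :> 0"
  by (rule GDERIV_transform_open[OF GDERIV_const[of 0], where S=S]) (use assms in auto)

lemma GDERIV_along_line:
  assumes "GDERIV f (x + t *\<^sub>R h) :> D"
  shows "((\<lambda>t. f (x + t *\<^sub>R h)) has_real_derivative h \<bullet> D) (at t)"
proof -
  have "((\<lambda>t. f (x + t *\<^sub>R h)) has_derivative (\<lambda>d. (d *\<^sub>R h) \<bullet> D)) (at t)"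
    using assms unfolding gderiv_def
    by (intro has_derivative_compose[where f="\<lambda>t. x + t *\<^sub>R h" and g=f]) (auto intro!: derivative_eq_intros)
  then show ?thesis by (simp add: has_field_derivative_def mult.commute[of _ "h \<bullet> D"] cong: if_cong)
qed

lemma GDERIV_affine:
  fixes f :: "'a::euclidean_space \<Rightarrow> real"
  assumes "GDERIV f (a + s *\<^sub>R x) :> D"
  shows "GDERIV (\<lambda>x. c * f (a + s *\<^sub>R x)) x :> (c * s) *\<^sub>R D"
proof -
  have "((\<lambda>x. f (a + s *\<^sub>R x)) has_derivative (\<lambda>h. (s *\<^sub>R h) \<bullet> D)) (at x)"
    using assms unfolding gderiv_def
    by (intro has_derivative_compose[where f="\<lambda>x. a + s *\<^sub>R x" and g=f]) (auto intro!: derivative_eq_intros)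
  then show ?thesis unfolding gderiv_def
    by (auto intro!: derivative_eq_intros simp: algebra_simps)
qed

text \<open>
  A coinduction principle: a set of functions that is closed under partial derivatives consists
  of smooth functions. All smoothness proofs below exhibit such a set.
\<close>

lemma smooth_on_UNIV_coinduct:
  assumes "f \<in> T"
    and diff: "\<And>g x. g \<in> T \<Longrightarrow> g differentiable (at x)"
    and closed: "\<And>g b. g \<in> T \<Longrightarrow> b \<in> Basis \<Longrightarrow> (\<lambda>x. grad g x \<bullet> b) \<in> T"
  shows "smooth_on UNIV f"
proof -
  have "g \<in> T \<Longrightarrow> Ck_on k UNIV g" for k g
  proof (induction k arbitrary: g)
    case 0
    then show ?case using diff by (auto intro!: differentiable_imp_continuous_on simp: differentiable_on_def)
  next
    case (Suc k) then show ?case using diff closed by auto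
  qed
  then show ?thesis using assms(1) by (auto simp: smooth_on_def)
qed

lemma smooth_on_UNIV_partial:
  assumes "smooth_on UNIV f"
  shows "f differentiable (at x)" and "b \<in> Basis \<Longrightarrow> smooth_on UNIV (\<lambda>x. grad f x \<bullet> b)"
proof -
  have "Ck_on (Suc k) UNIV f" for k using assms unfolding smooth_on_def by blast
  then show "f differentiable (at x)" "b \<in> Basis \<Longrightarrow> smooth_on UNIV (\<lambda>x. grad f x \<bullet> b)"
    unfolding smooth_on_def by auto
qed

lemma smooth_on_UNIV_affine:
  fixes f :: "'a::euclidean_space \<Rightarrow> real"
  assumes "smooth_on UNIV f"
  shows "smooth_on UNIV (\<lambda>x. c * f (a + s *\<^sub>R x))"
proof (rule smooth_on_UNIV_coinduct[where T="{\<lambda>x. c * f (a + s *\<^sub>R x) |c f. smooth_on UNIV f}"])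
  fix g :: "'a \<Rightarrow> real" assume "g \<in> {\<lambda>x. c * f (a + s *\<^sub>R x) |c f. smooth_on UNIV f}"
  then obtain c f where g: "g = (\<lambda>x. c * f (a + s *\<^sub>R x))" and f: "smooth_on UNIV f" by auto
  have G: "GDERIV g x :> (c * s) *\<^sub>R grad f (a + s *\<^sub>R x)" for x
    unfolding g by (intro GDERIV_affine GDERIV_grad smooth_on_UNIV_partial(1) f)
  show "g differentiable (at x)" for x using G by (rule GDERIV_imp_differentiable)
  show "(\<lambda>x. grad g x \<bullet> b) \<in> {\<lambda>x. c * f (a + s *\<^sub>R x) |c f. smooth_on UNIV f}" if "b \<in> Basis" for b
    using smooth_on_UNIV_partial(2)[OF f that] grad_eqI[OF G]
    by (intro CollectI exI[of _ "c * s"] exI[of _ "\<lambda>x. grad f x \<bullet> b"]) auto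
qed (use assms in auto)

lemma C0_inf_differentiable: "f \<in> C0_inf U \<Longrightarrow> f differentiable (at x)"
  by (auto simp: C0_inf_def intro: smooth_on_UNIV_partial)

lemma C0_inf_GDERIV: "f \<in> C0_inf U \<Longrightarrow> GDERIV f x :> grad f x"
  by (intro GDERIV_grad C0_inf_differentiable)

lemma C0_inf_continuous: "f \<in> C0_inf U \<Longrightarrow> continuous_on S f"
  by (meson C0_inf_differentiable differentiable_imp_continuous_on differentiable_on_def
      differentiable_at_withinI)

lemma C0_inf_compact: "f \<in> C0_inf U \<Longrightarrow> compact (closure {x. f x \<noteq> 0})"
  and C0_inf_subset: "f \<in> C0_inf U \<Longrightarrow> closure {x. f x \<noteq> 0} \<subseteq> U"
  by (auto simp: C0_inf_def compactly_in_def)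

lemma grad_eq_0_off_support:
  assumes "x \<notin> closure {x. f x \<noteq> 0}" shows "grad f x = 0"
  by (rule grad_eqI, rule GDERIV_eq_0_on_open[where S="- closure {x. f x \<noteq> 0}"])
     (use assms closure_subset[of "{x. f x \<noteq> 0}"] in auto)

lemma C0_infI:
  assumes "smooth_on UNIV f" "compact S" "S \<subseteq> U" "\<And>x. x \<notin> S \<Longrightarrow> f x = 0"
  shows "f \<in> C0_inf U"
proof -
  have "closure {x. f x \<noteq> 0} \<subseteq> S"
    using assms by (intro closure_minimal compact_imp_closed) auto
  moreover have "bounded {x. f x \<noteq> 0}"
    using assms by (auto intro: bounded_subset[OF compact_imp_bounded[of S]])
  ultimately show ?thesis using assms
    by (auto simp: C0_inf_def compactly_in_def compact_closure)
qed

lemma C0_inf_partial: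
  assumes "f \<in> C0_inf U" "b \<in> Basis" shows "(\<lambda>x. grad f x \<bullet> b) \<in> C0_inf U"
  using assms(1)[THEN C0_inf_compact] assms(1)[THEN C0_inf_subset]
  by (rule C0_infI[rotated])
    (use assms grad_eq_0_off_support[of _ f] in \<open>auto simp: C0_inf_def smooth_on_UNIV_partial\<close>)

lemma C0_inf_continuous_grad: "f \<in> C0_inf U \<Longrightarrow> continuous_on S (grad f)"
  by (subst continuous_on_componentwise) (auto intro: C0_inf_continuous[OF C0_inf_partial])

lemma C0_inf_affine:
  assumes "f \<in> C0_inf U" "s \<noteq> 0" "\<And>x. a + s *\<^sub>R x \<in> closure {x. f x \<noteq> 0} \<Longrightarrow> x \<in> W"
  shows "(\<lambda>x. c * f (a + s *\<^sub>R x)) \<in> C0_inf W"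
proof (rule C0_infI)
  let ?S = "(\<lambda>y. (1/s) *\<^sub>R (y - a)) ` closure {x. f x \<noteq> 0}"
  show "smooth_on UNIV (\<lambda>x. c * f (a + s *\<^sub>R x))"
    using assms by (intro smooth_on_UNIV_affine) (auto simp: C0_inf_def)
  show "compact ?S" using C0_inf_compact[OF assms(1)]
    by (intro compact_continuous_image continuous_intros)
  show "?S \<subseteq> W" using assms by auto
  fix x assume x: "x \<notin> ?S"
  have "a + s *\<^sub>R x \<notin> closure {x. f x \<noteq> 0}"
  proof
    assume *: "a + s *\<^sub>R x \<in> closure {x. f x \<noteq> 0}"
    have "x = (1/s) *\<^sub>R ((a + s *\<^sub>R x) - a)" using assms by simp
    with * x show False by (metis imageI)
  qed
  then show "c * f (a + s *\<^sub>R x) = 0"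
    using closure_subset[of "{x. f x \<noteq> 0}"] by auto
qed

lemma grad_affine:
  assumes "f \<in> C0_inf U" 
  shows "grad (\<lambda>x. c * f (a + s *\<^sub>R x)) x = (c * s) *\<^sub>R grad f (a + s *\<^sub>R x)"
  by (rule grad_eqI, rule GDERIV_affine, rule C0_inf_GDERIV[OF assms])

subsection \<open>A bump function\<close>

text \<open>
  The functions \<open>flat n\<close> are, up to integer combinations, closed under differentiation, which makes
  \<open>flat 0\<close>, that is \<open>t \<mapsto> exp (-1/t)\<close> extended by zero, smooth.
\<close>

definition flat :: "nat \<Rightarrow> real \<Rightarrow> real" where
  "flat n t = (if t > 0 then exp (- (1 / t)) / t ^ n else 0)"

text \<open>
  The bound says that \<open>flat n\<close> is flat at the origin; applied to \<open>flat (Suc n) t = flat n t / t\<close> it gives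
  the derivative there.
\<close>

lemma flat_bound: "\<bar>flat n t\<bar> \<le> fact (Suc n) * \<bar>t\<bar>"
proof (cases "t > 0")
  case True
  have "(1 / t) ^ Suc n / fact (Suc n) \<le> (\<Sum>k<Suc (Suc n). (1 / t) ^ k / fact k)"
    using True by (intro member_le_sum) auto
  also have "\<dots> \<le> exp (1 / t)"
  proof -
    have "(\<Sum>k<Suc (Suc n). (1 / t) ^ k /\<^sub>R fact k) \<le> exp (1 / t)"
      unfolding exp_def using True summable_exp_generic[of "1/t"] by (intro sum_le_suminf) auto
    then show ?thesis by (simp add: divide_inverse mult.commute)
  qed
  finally have "(1 / t) ^ Suc n \<le> fact (Suc n) * exp (1 / t)"
    by (simp add: divide_le_eq mult.commute del: power_Suc fact_Suc)
  then have "exp (- (1 / t)) / t ^ n \<le> fact (Suc n) * t"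
    using True by (simp add: exp_minus field_simps del: fact_Suc)
  then show ?thesis using True by (simp add: flat_def del: fact_Suc)
next
  case False
  then have "flat n t = 0" by (simp add: flat_def)
  then show ?thesis by (simp del: fact_Suc)
qed

lemma DERIV_flat: "(flat n has_real_derivative (- real n * flat (Suc n) t + flat (n + 2) t)) (at t)"
proof -
  consider "t > 0" | "t < 0" | "t = 0" by linarith
  then show ?thesis
  proof cases
    case 1
    have "((\<lambda>t. exp (- (1 / t)) / t ^ n) has_real_derivative
        (exp (- (1 / t)) / t\<^sup>2 * t ^ n - exp (- (1 / t)) * (real n * t ^ (n - 1))) / (t ^ n * t ^ n)) (at t)"
      using 1 by (auto intro!: derivative_eq_intros simp: power2_eq_square)
    also have "(exp (- (1 / t)) / t\<^sup>2 * t ^ n - exp (- (1 / t)) * (real n * t ^ (n - 1))) / (t ^ n * t ^ n)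
        = - real n * flat (Suc n) t + flat (n + 2) t"
      using 1 by (cases n) (auto simp: flat_def field_simps power2_eq_square)
    finally have "((\<lambda>t. exp (- (1 / t)) / t ^ n) has_real_derivative
        (- real n * flat (Suc n) t + flat (n + 2) t)) (at t)" .
    then show ?thesis
      by (rule has_field_derivative_transform_within_open[where S="{0<..}"]) (use 1 in \<open>auto simp: flat_def\<close>)
  next
    case 2
    have "((\<lambda>t. 0) has_real_derivative (- real n * flat (Suc n) t + flat (n + 2) t)) (at t)"
      using 2 by (auto simp: flat_def)
    then show ?thesis
      by (rule has_field_derivative_transform_within_open[where S="{..<0}"]) (use 2 in \<open>auto simp: flat_def\<close>)
  next
    case 3
    have eq: "flat n h / h = flat (Suc n) h" for h by (auto simp: flat_def)
    have "((\<lambda>h. fact (Suc (Suc n)) * \<bar>h\<bar>) \<longlongrightarrow> fact (Suc (Suc n)) * \<bar>0::real\<bar>) (at 0)"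
      by (intro tendsto_intros)
    then have "((\<lambda>h. fact (Suc (Suc n)) * \<bar>h\<bar>) \<longlongrightarrow> 0) (at (0::real))"
      by (simp del: fact_Suc)
    then have "(flat (Suc n) \<longlongrightarrow> 0) (at 0)"
      by (rule Lim_null_comparison[rotated])
         (intro always_eventually allI, simp only: real_norm_def flat_bound)
    then show ?thesis using 3
      by (simp add: has_field_derivative_iff flat_def[of _ 0] eq)
  qed
qed

text \<open>
  An algebra containing the bump \<open>flat 0 (1 - \<bar>x\<bar>\<^sup>2)\<close> and closed under partial derivatives. The coordinate
  functions are in it because the chain rule produces them.
\<close>

inductive_set bump_algebra :: "('a::euclidean_space \<Rightarrow> real) set" where
  flat: "(\<lambda>x. flat n (1 - x \<bullet> x)) \<in> bump_algebra"
| coord: "(\<lambda>x. x \<bullet> b) \<in> bump_algebra"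
| const: "(\<lambda>x. c) \<in> bump_algebra"
| add: "f \<in> bump_algebra \<Longrightarrow> g \<in> bump_algebra \<Longrightarrow> (\<lambda>x. f x + g x) \<in> bump_algebra"
| mult: "f \<in> bump_algebra \<Longrightarrow> g \<in> bump_algebra \<Longrightarrow> (\<lambda>x. f x * g x) \<in> bump_algebra"

lemma bump_algebra_partial:
  "f \<in> bump_algebra \<Longrightarrow> \<exists>D. (\<forall>x. GDERIV f x :> D x) \<and> (\<forall>b\<in>Basis. (\<lambda>x. D x \<bullet> b) \<in> bump_algebra)"
proof (induction rule: bump_algebra.induct)
  case (flat n)
  let ?d = "\<lambda>t. - real n * flat (Suc n) t + flat (n + 2) t"
  have 1: "GDERIV (\<lambda>x::'a. 1 - x \<bullet> x) x :> (-2) *\<^sub>R x" for x :: 'a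
    unfolding gderiv_def by (auto intro!: derivative_eq_intros simp: inner_commute)
  have "GDERIV (\<lambda>x::'a. flat n (1 - x \<bullet> x)) x :> ?d (1 - x \<bullet> x) *\<^sub>R (-2) *\<^sub>R x" for x
    by (rule GDERIV_DERIV_compose[OF 1 DERIV_flat])
  moreover have "(\<lambda>x. (?d (1 - x \<bullet> x) *\<^sub>R (-2) *\<^sub>R x) \<bullet> b) \<in> bump_algebra" for b :: 'a
  proof -
    have "(\<lambda>x. ((- real n) * flat (Suc n) (1 - x \<bullet> x) + flat (n + 2) (1 - x \<bullet> x)) * ((-2) * (x \<bullet> b))) \<in> bump_algebra"
      by (intro bump_algebra.intros)
    then show ?thesis by (simp add: algebra_simps)
  qed
  ultimately show ?case by (intro exI conjI allI ballI)
next
  case (coord b)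
  then show ?case
    by (intro exI[of _ "\<lambda>_. b"]) (auto simp: gderiv_def intro!: derivative_eq_intros bump_algebra.intros)
next
  case (const c)
  then show ?case by (intro exI[of _ "\<lambda>_. 0"]) (auto intro!: GDERIV_const bump_algebra.intros)
next
  case (add f g)
  then obtain D E where "\<And>x. GDERIV f x :> D x" "\<And>x. GDERIV g x :> E x"
    "\<And>b. b \<in> Basis \<Longrightarrow> (\<lambda>x. D x \<bullet> b) \<in> bump_algebra" "\<And>b. b \<in> Basis \<Longrightarrow> (\<lambda>x. E x \<bullet> b) \<in> bump_algebra"
    by metis
  then show ?case
    by (intro exI[of _ "\<lambda>x. D x + E x"]) (auto intro!: GDERIV_add bump_algebra.add simp: inner_add_left)
next
  case (mult f g)
  then obtain D E where "\<And>x. GDERIV f x :> D x" "\<And>x. GDERIV g x :> E x"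
    "\<And>b. b \<in> Basis \<Longrightarrow> (\<lambda>x. D x \<bullet> b) \<in> bump_algebra" "\<And>b. b \<in> Basis \<Longrightarrow> (\<lambda>x. E x \<bullet> b) \<in> bump_algebra"
    by metis
  with mult show ?case
    by (intro exI[of _ "\<lambda>x. f x *\<^sub>R E x + g x *\<^sub>R D x"])
       (auto intro!: GDERIV_mult bump_algebra.add bump_algebra.mult simp: inner_add_left)
qed

lemma bump_algebra_smooth: "f \<in> bump_algebra \<Longrightarrow> smooth_on UNIV f"
proof (rule smooth_on_UNIV_coinduct[where T=bump_algebra])
  fix g :: "'a \<Rightarrow> real" assume "g \<in> bump_algebra"
  then obtain D where D: "\<And>x. GDERIV g x :> D x" "\<And>b. b \<in> Basis \<Longrightarrow> (\<lambda>x. D x \<bullet> b) \<in> bump_algebra"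
    using bump_algebra_partial by metis
  show "g differentiable (at x)" for x using D(1) by (rule GDERIV_imp_differentiable)
  show "(\<lambda>x. grad g x \<bullet> b) \<in> bump_algebra" if "b \<in> Basis" for b
    using D(2)[OF that] by (simp add: grad_eqI[OF D(1)])
qed

lemma bump_exists:
  obtains \<eta> :: "'a::euclidean_space \<Rightarrow> real"
  where "\<eta> \<in> C0_inf UNIV" "\<And>x. 0 \<le> \<eta> x" "\<And>x. norm x \<ge> 1 \<Longrightarrow> \<eta> x = 0" "\<And>x. norm x < 1 \<Longrightarrow> 0 < \<eta> x"
proof
  let ?\<eta> = "\<lambda>x::'a. flat 0 (1 - x \<bullet> x)"
  have *: "x \<bullet> x < 1 \<longleftrightarrow> norm x < 1" for x :: 'a
    using power2_less_imp_less[of "norm x" 1] power_strict_mono[of "norm x" 1 2]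
    by (auto simp: power2_norm_eq_inner)
  show "\<And>x. 0 \<le> ?\<eta> x" "\<And>x. norm x \<ge> 1 \<Longrightarrow> ?\<eta> x = 0" "\<And>x. norm x < 1 \<Longrightarrow> 0 < ?\<eta> x"
    using * by (auto simp: flat_def)
  show "?\<eta> \<in> C0_inf UNIV"
  proof (rule C0_infI[of _ "cball 0 1"])
    show "smooth_on UNIV ?\<eta>" by (intro bump_algebra_smooth bump_algebra.flat)
  qed (auto simp: flat_def *)
qed

section \<open>Increments and gradients\<close>

text \<open>
  The tangent line of the convex function \<open>s\<^sup>p\<close> at \<open>t\<close>; strict convexity gives the case of equality.
  This form of Young's inequality avoids dual exponents and is used throughout, including as a
  replacement for Jensen's inequality.
\<close>

lemma young_tangent:
  fixes s t p :: real
  assumes "1 < p" "0 \<le> s" "0 \<le> t"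
  shows "p * s * t powr (p - 1) \<le> s powr p + (p - 1) * t powr p"
    and "p * s * t powr (p - 1) = s powr p + (p - 1) * t powr p \<Longrightarrow> s = t"
proof -
  define \<phi> where "\<phi> r = r powr p - p * r + (p - 1)" for r :: real
  have der: "(\<phi> has_real_derivative p * (r powr (p - 1) - 1)) (at r)" if "r > 0" for r
    unfolding \<phi>_def using that by (auto intro!: derivative_eq_intros simp: algebra_simps)
  have pos: "0 < \<phi> r" if r: "0 \<le> r" "r \<noteq> 1" for r
  proof -
    consider "r = 0" | "0 < r" "r < 1" | "1 < r" using r by linarith
    then show ?thesis
    proof cases
      case 1 then show ?thesis using assms by (simp add: \<phi>_def)
    next
      case 2
      then obtain \<xi> where \<xi>: "r < \<xi>" "\<xi> < 1" "\<phi> 1 - \<phi> r = (1 - r) * (p * (\<xi> powr (p - 1) - 1))"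
        using MVT2[of r 1 \<phi> "\<lambda>r. p * (r powr (p - 1) - 1)"] der by force
      have "\<xi> powr (p - 1) < 1" using \<xi> 2 assms powr_less_mono2[of "p - 1" \<xi> 1] by simp
      then have "(1 - r) * (p * (\<xi> powr (p - 1) - 1)) < 0"
        using 2 assms by (intro mult_pos_neg) auto
      with \<xi> show ?thesis by (simp add: \<phi>_def)
    next
      case 3
      then obtain \<xi> where \<xi>: "1 < \<xi>" "\<phi> r - \<phi> 1 = (r - 1) * (p * (\<xi> powr (p - 1) - 1))"
        using MVT2[of 1 r \<phi> "\<lambda>r. p * (r powr (p - 1) - 1)"] der by force
      have "1 < \<xi> powr (p - 1)" using \<xi> assms powr_less_mono2[of "p - 1" 1 \<xi>] by simp
      then have "0 < (r - 1) * (p * (\<xi> powr (p - 1) - 1))" using 3 assms by auto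
      with \<xi> show ?thesis by (simp add: \<phi>_def)
    qed
  qed
  have *: "p * s * t powr (p - 1) < s powr p + (p - 1) * t powr p" if "s \<noteq> t"
  proof (cases "t = 0")
    case False
    with assms have t: "t > 0" by simp
    have "0 < \<phi> (s / t) * t powr p" using pos[of "s / t"] t assms that by auto
    also have "\<phi> (s / t) * t powr p = s powr p + (p - 1) * t powr p - p * s * t powr (p - 1)"
      using t assms by (simp add: \<phi>_def powr_divide powr_diff field_simps)
    finally show ?thesis by simp
  qed (use assms that in auto)
  show "p * s * t powr (p - 1) \<le> s powr p + (p - 1) * t powr p"
  proof (cases "s = t")
    case True
    then show ?thesis using assms
      by (cases "t = 0") (auto simp: powr_diff field_simps)
  qed (use * in auto)
  show "p * s * t powr (p - 1) = s powr p + (p - 1) * t powr p \<Longrightarrow> s = t"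
    using * by fastforce
qed

lemma nn_integral_lborel_translate:
  fixes f :: "'a::euclidean_space \<Rightarrow> ennreal"
  assumes [measurable]: "f \<in> borel_measurable borel"
  shows "(\<integral>\<^sup>+y. f (c + y) \<partial>lborel) = (\<integral>\<^sup>+y. f y \<partial>lborel)"
  by (subst (2) lborel_distr_plus[of c, symmetric], subst nn_integral_distr) auto

lemma
  fixes f :: "'a::euclidean_space \<Rightarrow> real"
  assumes [measurable]: "f \<in> borel_measurable borel"
  shows lborel_integral_translate: "(LINT y|lborel. f (c + y)) = (LINT y|lborel. f y)"
    and lborel_integrable_translate: "integrable lborel (\<lambda>y. f (c + y)) \<longleftrightarrow> integrable lborel f"
proof -
  show "(LINT y|lborel. f (c + y)) = (LINT y|lborel. f y)"
    by (subst (2) lborel_distr_plus[of c, symmetric], subst integral_distr) auto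
  show "integrable lborel (\<lambda>y. f (c + y)) \<longleftrightarrow> integrable lborel f"
    by (subst (2) lborel_distr_plus[of c, symmetric], subst integrable_distr_eq) auto
qed

lemma lborel_distr_reflect: "distr lborel borel (\<lambda>y. c - y) = (lborel :: 'a::euclidean_space measure)"
  by (subst (2) lborel_affine[of "-1" c]) (auto simp: density_1)

lemma
  fixes f :: "'a::euclidean_space \<Rightarrow> real"
  assumes [measurable]: "f \<in> borel_measurable borel"
  shows lborel_integral_reflect: "(LINT y|lborel. f (c - y)) = (LINT y|lborel. f y)"
    and lborel_integrable_reflect: "integrable lborel (\<lambda>y. f (c - y)) \<longleftrightarrow> integrable lborel f"
proof -
  show "(LINT y|lborel. f (c - y)) = (LINT y|lborel. f y)"
    by (subst (2) lborel_distr_reflect[of c, symmetric], subst integral_distr) auto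
  show "integrable lborel (\<lambda>y. f (c - y)) \<longleftrightarrow> integrable lborel f"
    by (subst (2) lborel_distr_reflect[of c, symmetric], subst integrable_distr_eq) auto
qed

text \<open>The gradient is a pointwise limit of difference quotients, hence Borel measurable.\<close>

lemma borel_measurable_grad:
  fixes f :: "'a::euclidean_space \<Rightarrow> real"
  assumes U: "open U" and f: "\<And>x. x \<in> U \<Longrightarrow> f differentiable (at x)"
  shows "(\<lambda>x. indicator U x *\<^sub>R grad f x) \<in> borel_measurable borel"
proof -
  have [measurable]: "U \<in> sets borel" using U by simp
  have cf: "continuous_on U f"
    using f by (rule continuous_on_if_differentiable)
  then have fm: "(\<lambda>x. indicator U x *\<^sub>R f x) \<in> borel_measurable borel"
    by (rule borel_measurable_continuous_on_indicator[rotated]) simp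
  have "(\<lambda>x. (indicator U x *\<^sub>R grad f x) \<bullet> b) \<in> borel_measurable borel" for b
  proof (rule borel_measurable_LIMSEQ_real)
    let ?F = "\<lambda>n x. indicator U x * (real (Suc n) * (indicator U (x + (1 / real (Suc n)) *\<^sub>R b) *\<^sub>R f (x + (1 / real (Suc n)) *\<^sub>R b) - indicator U x *\<^sub>R f x))"
    note [measurable] = fm measurable_compose[OF _ fm]
    show "?F n \<in> borel_measurable borel" for n by measurable
    fix x show "(\<lambda>n. ?F n x) \<longlonglongrightarrow> (indicator U x *\<^sub>R grad f x) \<bullet> b"
    proof (cases "x \<in> U")
      case True
      have "((\<lambda>t. f (x + t *\<^sub>R b)) has_real_derivative b \<bullet> grad f x) (at 0)"
        using GDERIV_along_line[of f x 0 b "grad f x"] GDERIV_grad[OF f[OF True]] by simp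
      then have "((\<lambda>t. (f (x + t *\<^sub>R b) - f x) / t) \<longlongrightarrow> b \<bullet> grad f x) (at 0)"
        by (simp add: has_field_derivative_iff)
      moreover have lim: "filterlim (\<lambda>n. 1 / real (Suc n)) (at 0) sequentially"
        using LIMSEQ_inverse_real_of_nat
        by (auto simp: filterlim_at divide_inverse intro!: always_eventually)
      ultimately have "(\<lambda>n. (f (x + (1 / real (Suc n)) *\<^sub>R b) - f x) / (1 / real (Suc n))) \<longlonglongrightarrow> b \<bullet> grad f x"
        by (rule filterlim_compose)
      moreover have "\<forall>\<^sub>F n in sequentially. x + (1 / real (Suc n)) *\<^sub>R b \<in> U"
      proof -
        have "(\<lambda>n. x + (1 / real (Suc n)) *\<^sub>R b) \<longlonglongrightarrow> x + 0 *\<^sub>R b"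
          using lim by (intro tendsto_intros) (auto simp: filterlim_at)
        then show ?thesis using topological_tendstoD[of _ _ _ U] U True by auto
      qed
      ultimately show ?thesis using True
        by (auto simp: inner_commute field_simps elim!: Lim_transform_eventually elim: eventually_mono)
    qed simp
  qed
  then show ?thesis by (subst borel_measurable_euclidean_space) auto
qed

lemma increment_eq_integral:
  fixes q q' :: "real \<Rightarrow> real"
  assumes "\<And>t. t \<in> {0..1} \<Longrightarrow> (q has_real_derivative q' t) (at t)"
    and "set_integrable lborel {0..1} q'"
  shows "q 1 - q 0 = (LINT t:{0..1}|lborel. q' t)"
proof -
  have "(q' has_integral (q 1 - q 0)) {0..1}"
    using assms(1) by (intro fundamental_theorem_of_calculus)
      (auto simp: has_real_derivative_iff_has_vector_derivative[symmetric] has_field_derivative_at_within)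
  then show ?thesis
    using set_borel_integral_eq_integral(2)[OF assms(2)] by (simp add: integral_unique)
qed

text \<open>
  If the right-hand side is infinite there is nothing to prove; otherwise the everywhere existing
  derivative is integrable, the gauge integral form of the fundamental theorem of calculus applies
  and Jensen's inequality, in the form of the tangent inequality at the mean, gives the estimate.
\<close>

lemma increment_powr_le:
  fixes q q' :: "real \<Rightarrow> real"
  assumes p: "1 < p"
    and q: "\<And>t. t \<in> {0..1} \<Longrightarrow> (q has_real_derivative q' t) (at t)"
    and m: "set_borel_measurable borel {0..1} q'"
  shows "ennreal (\<bar>q 1 - q 0\<bar> powr p) \<le> (\<integral>\<^sup>+t. indicator {0..1} t * ennreal (\<bar>q' t\<bar> powr p) \<partial>lborel)" (is "_ \<le> ?I")
proof (cases "?I = \<infinity>")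
  case False
  define f where "f t = indicator {0..1} t * \<bar>q' t\<bar>" for t
  have f[measurable]: "f \<in> borel_measurable borel"
  proof -
    have "(\<lambda>t. \<bar>indicator {0..1} t *\<^sub>R q' t\<bar>) \<in> borel_measurable borel"
      using m unfolding set_borel_measurable_def by measurable
    also have "(\<lambda>t. \<bar>indicator {0..1} t *\<^sub>R q' t\<bar>) = f" by (auto simp: f_def indicator_def)
    finally show ?thesis .
  qed
  have f0: "0 \<le> f t" for t by (auto simp: f_def indicator_def)
  have I: "?I = (\<integral>\<^sup>+t. ennreal (f t powr p) \<partial>lborel)"
    by (intro nn_integral_cong) (auto simp: f_def indicator_def)
  have intp: "integrable lborel (\<lambda>t. f t powr p)"
    using False I by (intro integrableI_nonneg) (auto simp: less_top)
  have intf: "integrable lborel f"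
  proof (rule Bochner_Integration.integrable_bound)
    show "integrable lborel (\<lambda>t. indicator {0..1} t + f t powr p)"
      using intp by (intro Bochner_Integration.integrable_add) (auto simp: emeasure_lborel_Icc_eq)
    have "f t \<le> indicator {0..1} t + f t powr p" for t
    proof -
      consider "t \<notin> {0..1}" | "t \<in> {0..1}" "f t \<le> 1" | "t \<in> {0..1}" "1 < f t" by linarith
      then show ?thesis
      proof cases
        case 1 then show ?thesis by (simp add: f_def)
      next
        case 2 then show ?thesis by (simp add: add_increasing2)
      next
        case 3
        then have "f t powr 1 \<le> f t powr p" using p by (intro powr_mono) auto
        then show ?thesis using 3 by simp
      qed
    qed
    then show "AE t in lborel. norm (f t) \<le> norm (indicator {0..1} t + f t powr p)"
      using f0 by (auto intro!: AE_I2 order.trans[OF _ abs_ge_self])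
  qed simp
  have si: "set_integrable lborel {0..1} q'"
    unfolding set_integrable_def
    by (rule Bochner_Integration.integrable_bound[OF intf])
       (use m in \<open>auto simp: set_borel_measurable_def f_def indicator_def intro!: AE_I2\<close>)
  define M where "M = integral\<^sup>L lborel f"
  have M0: "0 \<le> M" unfolding M_def using f0 by simp
  have "\<bar>q 1 - q 0\<bar> = norm (LINT t:{0..1}|lborel. q' t)"
    by (simp only: increment_eq_integral[OF q si] real_norm_def)
  also have "\<dots> \<le> (LINT t:{0..1}|lborel. norm (q' t))"
    by (rule set_integral_norm_bound[OF si])
  also have "\<dots> = M" by (simp add: M_def f_def[abs_def] set_lebesgue_integral_def)
  finally have "\<bar>q 1 - q 0\<bar> powr p \<le> M powr p" using p by (intro powr_mono2) auto
  \<comment> \<open>Jensen: integrate the tangent inequality for the convex power at the mean \<open>M\<close>.\<close>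
  also have "M powr p \<le> (LINT t|lborel. f t powr p)"
  proof -
    have i: "integrable lborel (\<lambda>t. p * f t * M powr (p - 1) - indicator {0..1} t * ((p - 1) * M powr p))"
      using intf by (intro Bochner_Integration.integrable_diff integrable_mult_left integrable_mult_right) 
        (auto simp: emeasure_lborel_Icc_eq)
    have "(LINT t|lborel. p * f t * M powr (p - 1) - indicator {0..1} t * ((p - 1) * M powr p)) \<le> (LINT t|lborel. f t powr p)"
    proof (rule integral_mono[OF i intp])
      fix t show "p * f t * M powr (p - 1) - indicator {0..1} t * ((p - 1) * M powr p) \<le> f t powr p"
        using young_tangent(1)[OF p f0 M0, of t] by (cases "t \<in> {0..1}") (auto simp: f_def)
    qed
    also have "(LINT t|lborel. p * f t * M powr (p - 1) - indicator {0..1} t * ((p - 1) * M powr p))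
      = p * M * M powr (p - 1) - (p - 1) * M powr p"
      using intf by (subst Bochner_Integration.integral_diff) (auto simp: M_def emeasure_lborel_Icc_eq)
    also have "\<dots> = M powr p" using M0 p by (cases "M = 0") (auto simp: powr_diff field_simps)
    finally show ?thesis .
  qed
  finally have "ennreal (\<bar>q 1 - q 0\<bar> powr p) \<le> ennreal (LINT t|lborel. f t powr p)" by (rule ennreal_leI)
  also have "\<dots> = ?I" unfolding I using intp by (intro nn_integral_eq_integral[symmetric]) auto
  finally show ?thesis .
qed (simp only: top_greatest infinity_ennreal_def)

text \<open>
  A Poincare inequality in double integral form. After substituting \<open>y = x + h\<close> it only uses
  increments along a fixed vector \<open>h\<close>, and the segments \<open>x + t h\<close> stay in the convex set.
\<close>

lemma poincare_double_integral:
  fixes z :: "'a::euclidean_space \<Rightarrow> real"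
  assumes p: "1 < p" and B: "open B" "convex B" and R: "\<And>x y. x \<in> B \<Longrightarrow> y \<in> B \<Longrightarrow> norm (y - x) \<le> R"
    and z: "\<And>x. x \<in> B \<Longrightarrow> z differentiable (at x)"
  shows "(\<integral>\<^sup>+x. indicator B x * (\<integral>\<^sup>+y. indicator B y * ennreal (\<bar>z y - z x\<bar> powr p) \<partial>lborel) \<partial>lborel)
     \<le> ennreal (R powr p) * emeasure lborel (cball 0 R :: 'a set)
          * (\<integral>\<^sup>+x. indicator B x * ennreal (norm (grad z x) powr p) \<partial>lborel)"
proof -
  have [measurable]: "B \<in> sets borel" using B by simp
  define G where "G x = indicator B x *\<^sub>R grad z x" for x
  have G[measurable]: "G \<in> borel_measurable borel"
    unfolding G_def using borel_measurable_grad[OF B(1) z] by simp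
  have "continuous_on B z"
    using z by (rule continuous_on_if_differentiable)
  then have zm: "(\<lambda>x. indicator B x *\<^sub>R z x) \<in> borel_measurable borel"
    by (rule borel_measurable_continuous_on_indicator[rotated]) simp
  let ?N = "\<lambda>x. ennreal (norm (G x) powr p)"
  have [measurable]: "(cball 0 R :: 'a set) \<in> sets borel" by simp
  have step: "indicator B x * indicator B (x + h) * ennreal (\<bar>z (x + h) - z x\<bar> powr p)
      \<le> indicator (cball 0 R) h * ennreal (R powr p) * (\<integral>\<^sup>+t. indicator {0..1} t * ?N (x + t *\<^sub>R h) \<partial>lborel)" for x h
  proof (cases "x \<in> B \<and> x + h \<in> B")
    case True
    then have h: "norm h \<le> R" using R[of x "x + h"] by simp
    have seg: "x + t *\<^sub>R h \<in> B" if "t \<in> {0..1}" for t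
    proof -
      have "(1 - t) *\<^sub>R x + t *\<^sub>R (x + h) \<in> B"
        using that True B(2) by (intro convexD) auto
      then show ?thesis by (simp add: algebra_simps)
    qed
    let ?q' = "\<lambda>t. h \<bullet> grad z (x + t *\<^sub>R h)"
    have "(\<lambda>t. indicator {0..1} t * (h \<bullet> G (x + t *\<^sub>R h))) \<in> borel_measurable borel" by measurable
    also have "(\<lambda>t. indicator {0..1} t * (h \<bullet> G (x + t *\<^sub>R h))) = (\<lambda>t. indicator {0..1} t *\<^sub>R ?q' t)"
      using seg by (auto simp: G_def indicator_def)
    finally have "set_borel_measurable borel {0..1} ?q'" by (simp add: set_borel_measurable_def)
    then have "ennreal (\<bar>z (x + 1 *\<^sub>R h) - z (x + 0 *\<^sub>R h)\<bar> powr p)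
        \<le> (\<integral>\<^sup>+t. indicator {0..1} t * ennreal (\<bar>?q' t\<bar> powr p) \<partial>lborel)"
      using GDERIV_along_line[OF GDERIV_grad[OF z[OF seg]]] by (intro increment_powr_le p) auto
    also have "\<dots> \<le> (\<integral>\<^sup>+t. ennreal (R powr p) * (indicator {0..1} t * ?N (x + t *\<^sub>R h)) \<partial>lborel)"
    proof (rule nn_integral_mono)
      fix t :: real
      show "indicator {0..1} t * ennreal (\<bar>?q' t\<bar> powr p) \<le> ennreal (R powr p) * (indicator {0..1} t * ?N (x + t *\<^sub>R h))"
      proof (cases "t \<in> {0..1}")
        case True
        have "\<bar>?q' t\<bar> \<le> R * norm (grad z (x + t *\<^sub>R h))"
          using Cauchy_Schwarz_ineq2[of h "grad z (x + t *\<^sub>R h)"] h by (meson mult_right_mono norm_ge_zero order_trans)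
        then have "\<bar>?q' t\<bar> powr p \<le> (R * norm (grad z (x + t *\<^sub>R h))) powr p"
          using p by (intro powr_mono2) auto
        also have "\<dots> = R powr p * norm (grad z (x + t *\<^sub>R h)) powr p"
          using h norm_ge_zero[of h] by (intro powr_mult) 
        finally show ?thesis using True seg[OF True]
          by (simp add: G_def ennreal_mult[symmetric] ennreal_leI)
      qed simp
    qed
    also have "\<dots> = ennreal (R powr p) * (\<integral>\<^sup>+t. indicator {0..1} t * ?N (x + t *\<^sub>R h) \<partial>lborel)"
      by (intro nn_integral_cmult) measurable
    finally show ?thesis using True h by simp
  qed auto
  have "(\<integral>\<^sup>+x. indicator B x * (\<integral>\<^sup>+y. indicator B y * ennreal (\<bar>z y - z x\<bar> powr p) \<partial>lborel) \<partial>lborel)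
      = (\<integral>\<^sup>+x. (\<integral>\<^sup>+h. indicator B x * indicator B (x + h) * ennreal (\<bar>z (x + h) - z x\<bar> powr p) \<partial>lborel) \<partial>lborel)"
  proof (rule nn_integral_cong)
    fix x :: 'a
    have "(\<lambda>y. indicator B y * ennreal (\<bar>indicator B y *\<^sub>R z y - z x\<bar> powr p)) \<in> borel_measurable borel"
      using zm by measurable
    also have "(\<lambda>y. indicator B y * ennreal (\<bar>indicator B y *\<^sub>R z y - z x\<bar> powr p))
        = (\<lambda>y. indicator B y * ennreal (\<bar>z y - z x\<bar> powr p))" by (auto simp: indicator_def)
    finally have [measurable]: "(\<lambda>y. indicator B y * ennreal (\<bar>z y - z x\<bar> powr p)) \<in> borel_measurable borel" .
    have "indicator B x * (\<integral>\<^sup>+y. indicator B y * ennreal (\<bar>z y - z x\<bar> powr p) \<partial>lborel)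
       = indicator B x * (\<integral>\<^sup>+h. indicator B (x + h) * ennreal (\<bar>z (x + h) - z x\<bar> powr p) \<partial>lborel)"
      by (subst nn_integral_lborel_translate[where c=x, symmetric]) simp_all
    also have "\<dots> = (\<integral>\<^sup>+h. indicator B x * (indicator B (x + h) * ennreal (\<bar>z (x + h) - z x\<bar> powr p)) \<partial>lborel)"
      using measurable_compose[of "\<lambda>h. x + h" borel borel, OF _ \<open>(\<lambda>y. indicator B y * ennreal (\<bar>z y - z x\<bar> powr p)) \<in> borel_measurable borel\<close>]
      by (intro nn_integral_cmult[symmetric]) simp
    finally show "indicator B x * (\<integral>\<^sup>+y. indicator B y * ennreal (\<bar>z y - z x\<bar> powr p) \<partial>lborel) =
       (\<integral>\<^sup>+h. indicator B x * indicator B (x + h) * ennreal (\<bar>z (x + h) - z x\<bar> powr p) \<partial>lborel)"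
      by (simp add: mult.assoc)
  qed
  also have "\<dots> \<le> (\<integral>\<^sup>+x. (\<integral>\<^sup>+h. indicator (cball 0 R) h * ennreal (R powr p) * (\<integral>\<^sup>+t. indicator {0..1} t * ?N (x + t *\<^sub>R h) \<partial>lborel) \<partial>lborel) \<partial>lborel)"
    by (intro nn_integral_mono step)
  also have "\<dots> = (\<integral>\<^sup>+h. (\<integral>\<^sup>+x. indicator (cball 0 R) h * ennreal (R powr p) * (\<integral>\<^sup>+t. indicator {0..1} t * ?N (x + t *\<^sub>R h) \<partial>lborel) \<partial>lborel) \<partial>lborel)"
    by (rule lborel_pair.Fubini') measurable
  also have "\<dots> = (\<integral>\<^sup>+h. indicator (cball 0 R) h * ennreal (R powr p) * (\<integral>\<^sup>+t. (\<integral>\<^sup>+x. indicator {0..1} t * ?N (x + t *\<^sub>R h) \<partial>lborel) \<partial>lborel) \<partial>lborel)"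
    by (intro nn_integral_cong, subst nn_integral_cmult, measurable, subst lborel_pair.Fubini', measurable)
  also have "\<dots> = (\<integral>\<^sup>+h. indicator (cball 0 R :: 'a set) h * ennreal (R powr p) * (\<integral>\<^sup>+t. indicator {0..1::real} t * (\<integral>\<^sup>+x. ?N x \<partial>lborel) \<partial>lborel) \<partial>lborel)"
  proof (intro nn_integral_cong arg_cong2[where f="(*)"] refl)
    fix h :: 'a and t :: real
    have "(\<integral>\<^sup>+x. indicator {0..1} t * ?N (x + t *\<^sub>R h) \<partial>lborel) = indicator {0..1} t * (\<integral>\<^sup>+x. ?N (t *\<^sub>R h + x) \<partial>lborel)"
      by (subst nn_integral_cmult) (simp_all add: add.commute)
    also have "(\<integral>\<^sup>+x. ?N (t *\<^sub>R h + x) \<partial>lborel) = (\<integral>\<^sup>+x. ?N x \<partial>lborel)"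
      by (rule nn_integral_lborel_translate[where f="?N"]) measurable
    finally show "(\<integral>\<^sup>+x. indicator {0..1} t * ?N (x + t *\<^sub>R h) \<partial>lborel) = indicator {0..1} t * (\<integral>\<^sup>+x. ?N x \<partial>lborel)" .
  qed
  also have "\<dots> = ennreal (R powr p) * emeasure lborel (cball 0 R :: 'a set) * (\<integral>\<^sup>+x. ?N x \<partial>lborel)"
  proof -
    have "(\<integral>\<^sup>+t. indicator {0..1::real} t * c \<partial>lborel) = c" for c :: ennreal
      by (subst nn_integral_multc) (simp_all add: emeasure_lborel_Icc_eq)
    moreover have "(\<integral>\<^sup>+h. indicator (cball 0 R :: 'a set) h * c * d \<partial>lborel) = c * emeasure lborel (cball 0 R :: 'a set) * d" for c d
      by (subst nn_integral_multc, simp, subst nn_integral_multc) (simp_all add: mult.commute)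
    ultimately show ?thesis by simp
  qed
  also have "(\<integral>\<^sup>+x. ?N x \<partial>lborel) = (\<integral>\<^sup>+x. indicator B x * ennreal (norm (grad z x) powr p) \<partial>lborel)"
    by (intro nn_integral_cong) (auto simp: G_def indicator_def)
  finally show ?thesis .
qed

text \<open>
  The Poincare inequality makes \<open>z x = z y\<close> for almost all pairs, and continuity removes the exceptions.
\<close>

lemma eq_const_if_grad_AE_0:
  fixes z :: "'a::euclidean_space \<Rightarrow> real"
  assumes B: "open B" "convex B" "bounded B" and z: "\<And>x. x \<in> B \<Longrightarrow> z differentiable (at x)"
    and g: "AE x in lborel. x \<in> B \<longrightarrow> grad z x = 0" and xy: "x \<in> B" "y \<in> B"
  shows "z x = z y"
proof -
  have [measurable]: "B \<in> sets borel" using B by simp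
  obtain R where R0: "\<And>x. x \<in> B \<Longrightarrow> norm x \<le> R" using B(3) by (auto simp: bounded_iff)
  then have R: "norm (y - x) \<le> 2 * R" if "x \<in> B" "y \<in> B" for x y
    using norm_triangle_ineq4[of y x] R0[OF that(1)] R0[OF that(2)] by linarith
  have cz: "continuous_on B z"
    using z by (rule continuous_on_if_differentiable)
  then have zm: "(\<lambda>x. indicator B x *\<^sub>R z x) \<in> borel_measurable borel"
    by (rule borel_measurable_continuous_on_indicator[rotated]) simp
  define Z where "Z x = indicator B x *\<^sub>R z x" for x
  have Z[measurable]: "Z \<in> borel_measurable borel" using zm unfolding Z_def .
  have ZB: "Z x = z x" if "x \<in> B" for x using that by (simp add: Z_def)
  define I where "I x = (\<integral>\<^sup>+y. indicator B y * ennreal (\<bar>Z y - Z x\<bar> powr 2) \<partial>lborel)" for x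
  have I[measurable]: "I \<in> borel_measurable borel" unfolding I_def by measurable
  have Ieq: "indicator B x * I x = indicator B x * (\<integral>\<^sup>+y. indicator B y * ennreal (\<bar>z y - z x\<bar> powr 2) \<partial>lborel)" for x
    unfolding I_def by (cases "x \<in> B") (auto intro!: nn_integral_cong simp: indicator_def ZB)
  have "AE x in lborel. indicator B x * ennreal (norm (grad z x) powr 2) = 0"
    using g by eventually_elim (auto simp: indicator_def)
  then have "(\<integral>\<^sup>+x. indicator B x * ennreal (norm (grad z x) powr 2) \<partial>lborel) = nn_integral lborel (\<lambda>x::'a. 0)"
    by (rule nn_integral_cong_AE)
  then have "(\<integral>\<^sup>+x. indicator B x * I x \<partial>lborel) \<le> 0"
    unfolding Ieq using poincare_double_integral[of 2 B "2 * R" z, OF _ B(1,2) R z] by simp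
  then have AE1: "AE x in lborel. indicator B x * I x = 0"
    by (subst nn_integral_0_iff_AE[symmetric]) auto
  \<comment> \<open>A property that holds almost everywhere holds on a dense set.\<close>
  have dense: "x \<in> closure {x \<in> B. P x}" if P: "AE x in lborel. x \<in> B \<longrightarrow> P x" and "x \<in> B" for P and x :: 'a
  proof (rule mem_closed_if_AE_lebesgue_open[OF B(1) closed_closure])
    have "AE x in lebesgue. x \<in> B \<longrightarrow> P x" using P by (rule AE_completion)
    then show "AE x in lebesgue. x \<in> B \<longrightarrow> x \<in> closure {x \<in> B. P x}"
      by eventually_elim (use closure_subset[of "{x \<in> B. P x}"] in auto)
  qed fact
  have key: "z y = z x" if x: "x \<in> B" "indicator B x * I x = 0" and y: "y \<in> B" for x y
  proof -
    have "I x = 0" using x by simp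
    then have "AE y in lborel. indicator B y * ennreal (\<bar>Z y - Z x\<bar> powr 2) = 0"
      unfolding I_def by (subst (asm) nn_integral_0_iff_AE) auto
    then have "AE y in lborel. y \<in> B \<longrightarrow> z y = z x"
      by eventually_elim (auto simp: ZB x)
    then have "y \<in> closure {y \<in> B. z y = z x}" using y by (rule dense)
    moreover obtain C where C: "closed C" "{y \<in> B. z y = z x} = B \<inter> C"
      using continuous_closedin_preimage_constant[OF cz, of "z x"] unfolding closedin_closed by blast
    ultimately have "y \<in> C" using closure_minimal[of "{y \<in> B. z y = z x}" C] by blast
    then have "y \<in> {y \<in> B. z y = z x}" using y C(2) by blast
    then show ?thesis by blast
  qed
  have "AE x in lborel. x \<in> B \<longrightarrow> indicator B x * I x = 0" using AE1 by eventually_elim blast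
  from dense[OF this xy(1)] have "closure {x \<in> B. indicator B x * I x = 0} \<noteq> {}" by (rule ex_in_conv[THEN iffD1, OF exI])
  then have "{x \<in> B. indicator B x * I x = 0} \<noteq> {}" by (simp only: closure_eq_empty not_False_eq_True)
  then obtain x0 where "x0 \<in> B" "indicator B x0 * I x0 = 0" by blast
  from key[OF this xy(1)] key[OF this xy(2)] show ?thesis by simp
qed

text \<open>
  Integrate \<open>\<psi>(x + b) - \<psi>(x) = \<integral>\<^sub>0\<^sup>1 \<nabla>\<psi>(x + t b) \<bullet> b dt\<close>, valid for almost every \<open>x\<close>, over \<open>x\<close>. This is the
  only integration by parts below; products with a smooth function reduce to it.
\<close>

lemma integral_partial_eq_0:
  fixes \<psi> :: "'a::euclidean_space \<Rightarrow> real"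
  assumes diff: "\<And>x. \<psi> differentiable (at x)" and i\<psi>: "integrable lborel \<psi>"
    and ig: "integrable lborel (\<lambda>x. grad \<psi> x \<bullet> b)"
  shows "(LINT x|lborel. grad \<psi> x \<bullet> b) = 0"
proof -
  define g where "g x = grad \<psi> x \<bullet> b" for x
  have g[measurable]: "g \<in> borel_measurable borel" and ig: "integrable lborel g"
    using borel_measurable_integrable[OF ig] ig by (simp_all add: g_def[abs_def])
  have \<psi>[measurable]: "\<psi> \<in> borel_measurable borel" using borel_measurable_integrable[OF i\<psi>] by simp
  define f where "f = (\<lambda>(x::'a, t::real). indicator {0..1} t * g (t *\<^sub>R b + x))"
  have fm[measurable]: "f \<in> borel_measurable (lborel \<Otimes>\<^sub>M lborel)" unfolding f_def by measurable
  have slice: "(\<integral>\<^sup>+x. ennreal (norm (f (x, t))) \<partial>lborel) = indicator {0..1} t * (\<integral>\<^sup>+x. ennreal (norm (g x)) \<partial>lborel)" for t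
    using nn_integral_lborel_translate[of "\<lambda>x. ennreal (norm (g x))" "t *\<^sub>R b"]
    by (cases "t \<in> {0..1}") (auto simp: f_def)
  have "(\<integral>\<^sup>+z. ennreal (norm (f z)) \<partial>(lborel \<Otimes>\<^sub>M lborel)) = (\<integral>\<^sup>+t. (\<integral>\<^sup>+x. ennreal (norm (f (x, t))) \<partial>lborel) \<partial>lborel)"
    by (intro lborel_pair.nn_integral_snd[symmetric]) measurable
  also have "\<dots> = (\<integral>\<^sup>+x. ennreal (norm (g x)) \<partial>lborel)"
    unfolding slice by (subst nn_integral_multc) (simp_all add: emeasure_lborel_Icc_eq)
  also have "\<dots> < \<infinity>" using ig by (simp add: integrable_iff_bounded)
  finally have fi: "integrable (lborel \<Otimes>\<^sub>M lborel) f"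
    by (intro integrableI_bounded) auto
  have "AE x in lborel. integrable lborel (\<lambda>t. f (x, t))"
    by (rule lborel_pair.AE_integrable_fst'[OF fi])
  then have AE: "AE x in lborel. \<psi> (b + x) - \<psi> x = (LINT t|lborel. f (x, t))"
  proof eventually_elim
    case (elim x)
    have 1: "((\<lambda>t. \<psi> (x + t *\<^sub>R b)) has_real_derivative g (t *\<^sub>R b + x)) (at t)" for t
      using GDERIV_along_line[of \<psi> x t b, OF GDERIV_grad[OF diff]] by (simp add: g_def inner_commute add.commute)
    have "\<psi> (x + 1 *\<^sub>R b) - \<psi> (x + 0 *\<^sub>R b) = (LINT t:{0..1}|lborel. g (t *\<^sub>R b + x))"
      using elim by (intro increment_eq_integral 1) (simp add: f_def set_integrable_def)
    then show ?case by (simp add: f_def set_lebesgue_integral_def add.commute)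
  qed
  have "0 = (LINT x|lborel. \<psi> (b + x) - \<psi> x)"
    using i\<psi> lborel_integrable_translate[OF \<psi>, of b] lborel_integral_translate[OF \<psi>, of b] by simp
  also have "\<dots> = (LINT x|lborel. (LINT t|lborel. f (x, t)))"
    by (intro integral_cong_AE AE) measurable
  also have "\<dots> = (LINT t|lborel. (LINT x|lborel. f (x, t)))"
    using lborel_pair.Fubini_integral[of "\<lambda>x t. f (x, t)"] fi by simp
  also have "\<dots> = (LINT t|lborel. indicator {0..1::real} t * (LINT x|lborel. g x))"
  proof -
    have "(LINT x|lborel. f (x, t)) = indicator {0..1} t * (LINT x|lborel. g x)" for t
      using lborel_integral_translate[OF g, of "t *\<^sub>R b"] by (simp add: f_def)
    then show ?thesis by simp
  qed
  also have "\<dots> = (LINT x|lborel. g x)" by (simp add: content_real)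
  finally show ?thesis by (simp add: g_def)
qed

section \<open>Mollification\<close>

lemma powr_add_le:
  fixes a b p :: real
  assumes "1 \<le> p" "0 \<le> a" "0 \<le> b"
  shows "(a + b) powr p \<le> 2 powr p * (a powr p + b powr p)"
proof -
  have "(a + b) powr p \<le> (2 * max a b) powr p" using assms by (intro powr_mono2) auto
  also have "\<dots> = 2 powr p * max a b powr p" using assms by (intro powr_mult)
  also have "max a b powr p \<le> a powr p + b powr p" by (auto simp: max_def)
  finally show ?thesis by simp
qed

text \<open>
  Density of the continuous functions of compact support in \<open>L\<^sup>p\<close>: truncate, then use that a
  measurable function is almost everywhere a limit of continuous ones.
\<close>

lemma Lp_approx_continuous:
  fixes f :: "'a::euclidean_space \<Rightarrow> real"
  assumes p: "1 \<le> p" and f[measurable]: "f \<in> borel_measurable borel"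
    and fin: "(\<integral>\<^sup>+x. ennreal (\<bar>f x\<bar> powr p) \<partial>lborel) < \<infinity>" and e: "0 < e"
  obtains g r where "continuous_on UNIV g" "\<And>x. norm x \<ge> r \<Longrightarrow> g x = 0" "0 < r"
    "(\<integral>\<^sup>+x. ennreal (\<bar>f x - g x\<bar> powr p) \<partial>lborel) \<le> ennreal e"
proof -
  define cl where "cl M t = max (- M) (min M t)" for M t :: real
  have cl_bound: "\<bar>cl M t\<bar> \<le> M" if "0 \<le> M" for M t using that by (auto simp: cl_def)
  have cl_cont: "continuous_on A (cl M)" for A M unfolding cl_def by (intro continuous_intros)
  have cl_m[measurable]: "cl M \<in> borel_measurable borel" for M
    unfolding cl_def by measurable
  define F where "F n x = indicator (cball 0 (real n)) x * cl (real n) (f x)" for n x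
  have [measurable]: "(cball 0 (real n) :: 'a set) \<in> sets borel" for n by simp
  have F[measurable]: "F n \<in> borel_measurable borel" for n unfolding F_def by measurable
  have "(\<lambda>n. \<integral>\<^sup>+x. ennreal (\<bar>f x - F n x\<bar> powr p) \<partial>lborel) \<longlonglongrightarrow> (\<integral>\<^sup>+x. 0 \<partial>(lborel :: 'a measure))"
  proof (rule nn_integral_dominated_convergence[where w="\<lambda>x. ennreal (\<bar>f x\<bar> powr p)"])
    show "AE x in lborel. ennreal (\<bar>f x - F n x\<bar> powr p) \<le> ennreal (\<bar>f x\<bar> powr p)" for n
      using p by (intro AE_I2 ennreal_leI powr_mono2) (auto simp: F_def cl_def indicator_def)
    show "AE x in lborel. (\<lambda>n. ennreal (\<bar>f x - F n x\<bar> powr p)) \<longlonglongrightarrow> 0"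
    proof (rule AE_I2)
      fix x
      have "\<forall>\<^sub>F n in sequentially. max (norm x) \<bar>f x\<bar> \<le> real n"
        using filterlim_real_sequentially unfolding filterlim_at_top by blast
      then have "\<forall>\<^sub>F n in sequentially. ennreal (\<bar>f x - F n x\<bar> powr p) = 0"
        by eventually_elim (auto simp: F_def cl_def)
      then show "(\<lambda>n. ennreal (\<bar>f x - F n x\<bar> powr p)) \<longlonglongrightarrow> 0" by (rule tendsto_eventually)
    qed
  qed (use fin in auto)
  then have lim1: "(\<lambda>n. \<integral>\<^sup>+x. ennreal (\<bar>f x - F n x\<bar> powr p) \<partial>lborel) \<longlonglongrightarrow> 0" by simp
  define e' where "e' = e / (2 * 2 powr p)"
  have e': "0 < e'" using e by (simp add: e'_def)
  obtain n where n: "(\<integral>\<^sup>+x. ennreal (\<bar>f x - F n x\<bar> powr p) \<partial>lborel) < ennreal e'"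
    using order_tendstoD(2)[OF lim1, of "ennreal e'"] e' by (auto simp: eventually_sequentially)
  have "F n measurable_on UNIV"
    using lebesgue_measurable_imp_measurable_on[of "F n" UNIV] by (simp add: measurable_completion)
  then obtain N G where N: "negligible N" and G: "\<And>k. continuous_on UNIV (G k)"
    "\<And>x. x \<notin> N \<Longrightarrow> (\<lambda>k. G k x) \<longlonglongrightarrow> F n x"
    by (auto simp: measurable_on_def)
  \<comment> \<open>A continuous cutoff that equals one where the truncation \<open>F n\<close> may be nonzero.\<close>
  define \<kappa> where "\<kappa> x = max 0 (min 1 (real n + 1 - norm x))" for x :: 'a
  define H where "H k x = \<kappa> x * cl (real n) (G k x)" for k x
  have H_cont: "continuous_on UNIV (H k)" for k
    unfolding H_def \<kappa>_def by (intro continuous_intros continuous_on_compose2[OF cl_cont G(1)]) auto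
  then have H[measurable]: "H k \<in> borel_measurable borel" for k by (rule borel_measurable_continuous_onI)
  have H_lim: "(\<lambda>k. H k x) \<longlonglongrightarrow> F n x" if "x \<notin> N" for x
  proof -
    have "(\<lambda>k. cl (real n) (G k x)) \<longlonglongrightarrow> cl (real n) (F n x)"
      unfolding cl_def by (intro tendsto_intros G that)
    then have "(\<lambda>k. H k x) \<longlonglongrightarrow> \<kappa> x * cl (real n) (F n x)" unfolding H_def by (intro tendsto_intros)
    moreover have "\<kappa> x * cl (real n) (F n x) = F n x"
      by (auto simp: F_def \<kappa>_def cl_def indicator_def)
    ultimately show ?thesis by simp
  qed
  have Cm: "(cball 0 (real n + 1) :: 'a set) \<in> sets borel" by simp
  have Hb: "\<bar>H k x\<bar> \<le> indicator (cball 0 (real n + 1)) x * real n" for k x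
  proof (cases "x \<in> cball 0 (real n + 1)")
    case True
    have "\<kappa> x * \<bar>cl (real n) (G k x)\<bar> \<le> 1 * real n"
      by (intro mult_mono cl_bound) (auto simp: \<kappa>_def)
    then show ?thesis using True by (simp add: H_def abs_mult \<kappa>_def)
  next
    case False
    then have "\<kappa> x = 0" by (simp add: \<kappa>_def)
    then show ?thesis using False by (simp add: H_def)
  qed
  have Fb: "\<bar>F n x\<bar> \<le> indicator (cball 0 (real n + 1)) x * real n" for x
    using cl_bound[of "real n" "f x"] by (auto simp: F_def indicator_def)
  have "(\<lambda>k. \<integral>\<^sup>+x. ennreal (\<bar>F n x - H k x\<bar> powr p) \<partial>lborel) \<longlonglongrightarrow> (\<integral>\<^sup>+x. 0 \<partial>(lborel :: 'a measure))"
  proof (rule nn_integral_dominated_convergence[where w="\<lambda>x. ennreal ((2 * real n) powr p) * indicator (cball 0 (real n + 1)) x"])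
    show "AE x in lborel. ennreal (\<bar>F n x - H k x\<bar> powr p) \<le> ennreal ((2 * real n) powr p) * indicator (cball 0 (real n + 1)) x" for k
    proof (rule AE_I2)
      fix x :: 'a
      have "\<bar>F n x - H k x\<bar> \<le> indicator (cball 0 (real n + 1)) x * (2 * real n)"
        using Hb[of k x] Fb[of x] by (auto simp: indicator_def)
      then have "\<bar>F n x - H k x\<bar> powr p \<le> (indicator (cball 0 (real n + 1)) x * (2 * real n)) powr p"
        using p by (intro powr_mono2) auto
      then show "ennreal (\<bar>F n x - H k x\<bar> powr p) \<le> ennreal ((2 * real n) powr p) * indicator (cball 0 (real n + 1)) x"
        by (auto simp: indicator_def intro!: ennreal_leI split: if_splits)
    qed
    have "emeasure lborel (cball 0 (real n + 1) :: 'a set) < \<infinity>" by (intro emeasure_bounded_finite) simp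
    then show "(\<integral>\<^sup>+x. ennreal ((2 * real n) powr p) * indicator (cball 0 (real n + 1)) x \<partial>(lborel :: 'a measure)) < \<infinity>"
      by (subst nn_integral_cmult_indicator) (auto simp: ennreal_mult_less_top)
    have "AE x in lebesgue. x \<notin> N" using N by (simp add: negligible_iff_null_sets AE_not_in)
    then have "AE x in lebesgue. (\<lambda>k. ennreal (\<bar>F n x - H k x\<bar> powr p)) \<longlonglongrightarrow> 0"
    proof eventually_elim
      case (elim x)
      have "(\<lambda>k. \<bar>F n x - H k x\<bar>) \<longlonglongrightarrow> \<bar>F n x - F n x\<bar>"
        by (intro tendsto_intros H_lim elim)
      then have "(\<lambda>k. \<bar>F n x - H k x\<bar> powr p) \<longlonglongrightarrow> \<bar>F n x - F n x\<bar> powr p"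
        by (rule tendsto_powr2[OF _ tendsto_const]) (use p in auto)
      then have "(\<lambda>k. ennreal (\<bar>F n x - H k x\<bar> powr p)) \<longlonglongrightarrow> ennreal (\<bar>F n x - F n x\<bar> powr p)"
        by (rule tendsto_ennrealI)
      moreover have "ennreal (\<bar>F n x - F n x\<bar> powr p) = 0" using p by simp
      ultimately show ?case by (simp only:)
    qed
    then show "AE x in lborel. (\<lambda>k. ennreal (\<bar>F n x - H k x\<bar> powr p)) \<longlonglongrightarrow> 0"
      by (simp add: AE_completion_iff)
    show "(\<lambda>x. ennreal (\<bar>F n x - H k x\<bar> powr p)) \<in> borel_measurable lborel" for k
      by measurable
    show "(\<lambda>x. ennreal ((2 * real n) powr p) * indicator (cball 0 (real n + 1)) x) \<in> borel_measurable (lborel :: 'a measure)"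
      using Cm by measurable
  qed simp
  then have lim2: "(\<lambda>k. \<integral>\<^sup>+x. ennreal (\<bar>F n x - H k x\<bar> powr p) \<partial>lborel) \<longlonglongrightarrow> 0" by simp
  obtain k where k: "(\<integral>\<^sup>+x. ennreal (\<bar>F n x - H k x\<bar> powr p) \<partial>lborel) < ennreal e'"
    using order_tendstoD(2)[OF lim2, of "ennreal e'"] e' by (auto simp: eventually_sequentially)
  show thesis
  proof (rule that[of "H k" "real n + 1"])
    show "H k x = 0" if "real n + 1 \<le> norm x" for x using that by (simp add: H_def \<kappa>_def)
    have "(\<integral>\<^sup>+x. ennreal (\<bar>f x - H k x\<bar> powr p) \<partial>lborel)
       \<le> (\<integral>\<^sup>+x. ennreal (2 powr p) * (ennreal (\<bar>f x - F n x\<bar> powr p) + ennreal (\<bar>F n x - H k x\<bar> powr p)) \<partial>lborel)"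
    proof (rule nn_integral_mono)
      fix x
      have "\<bar>f x - H k x\<bar> powr p \<le> (\<bar>f x - F n x\<bar> + \<bar>F n x - H k x\<bar>) powr p"
        using p by (intro powr_mono2) auto
      also have "\<dots> \<le> 2 powr p * (\<bar>f x - F n x\<bar> powr p + \<bar>F n x - H k x\<bar> powr p)"
        using p by (intro powr_add_le) auto
      finally show "ennreal (\<bar>f x - H k x\<bar> powr p) \<le> ennreal (2 powr p) * (ennreal (\<bar>f x - F n x\<bar> powr p) + ennreal (\<bar>F n x - H k x\<bar> powr p))"
        by (simp add: ennreal_mult[symmetric] ennreal_plus[symmetric] ennreal_leI del: ennreal_plus)
    qed
    also have "\<dots> = ennreal (2 powr p) * ((\<integral>\<^sup>+x. ennreal (\<bar>f x - F n x\<bar> powr p) \<partial>lborel) + (\<integral>\<^sup>+x. ennreal (\<bar>F n x - H k x\<bar> powr p) \<partial>lborel))"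
      by (subst nn_integral_cmult) (simp_all add: nn_integral_add)
    also have "\<dots> \<le> ennreal (2 powr p) * (ennreal e' + ennreal e')"
      using n k by (intro mult_left_mono add_mono) auto
    also have "\<dots> = ennreal (2 powr p * (e' + e'))"
      using e' by (subst ennreal_mult'', simp, subst ennreal_plus) simp_all
    also have "\<dots> = ennreal e" by (simp add: e'_def)
    finally show "(\<integral>\<^sup>+x. ennreal (\<bar>f x - H k x\<bar> powr p) \<partial>lborel) \<le> ennreal e" .
  qed (simp_all add: H_cont)
qed

lemma compact_support_uniformly_continuous:
  fixes g :: "'a::euclidean_space \<Rightarrow> 'b::euclidean_space"
  assumes g: "continuous_on UNIV g" and r: "\<And>x. norm x \<ge> r \<Longrightarrow> g x = 0" and e: "0 < e"
  obtains d where "0 < d" "d \<le> 1" "\<And>x y. norm (x - y) < d \<Longrightarrow> norm (g x - g y) < e"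
proof -
  have "uniformly_continuous_on (cball 0 (\<bar>r\<bar> + 1)) g"
    using g by (intro compact_uniformly_continuous) (auto intro: continuous_on_subset)
  then obtain d where d: "d > 0" "\<And>x y. norm x \<le> \<bar>r\<bar> + 1 \<Longrightarrow> norm y \<le> \<bar>r\<bar> + 1 \<Longrightarrow> norm (x - y) < d \<Longrightarrow> norm (g x - g y) < e"
    using e unfolding uniformly_continuous_on_def
    by (force simp: dist_norm norm_minus_commute)
  show thesis
  proof (rule that[of "min d 1"])
    fix x y :: 'a assume xy: "norm (x - y) < min d 1"
    have *: "norm x \<le> norm y + 1" "norm y \<le> norm x + 1"
      using xy norm_triangle_ineq2[of x y] norm_triangle_ineq3[of x y] by linarith+
    show "norm (g x - g y) < e"
    proof (cases "norm x \<le> \<bar>r\<bar> + 1 \<and> norm y \<le> \<bar>r\<bar> + 1")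
      case False
      with * have "norm x \<ge> r" "norm y \<ge> r" by auto
      then show ?thesis using r e by simp
    qed (use d xy in auto)
  qed (use d in auto)
qed

text \<open>
  Clear for continuous functions of compact support; the general case follows by density, since
  translations are isometries.
\<close>

lemma Lp_translation_continuous:
  fixes f :: "'a::euclidean_space \<Rightarrow> real"
  assumes p: "1 \<le> p" and f[measurable]: "f \<in> borel_measurable borel"
    and fin: "(\<integral>\<^sup>+x. ennreal (\<bar>f x\<bar> powr p) \<partial>lborel) < \<infinity>" and e: "0 < e"
  obtains d where "0 < d"
    "\<And>h. norm h < d \<Longrightarrow> (\<integral>\<^sup>+x. ennreal (\<bar>f (x + h) - f x\<bar> powr p) \<partial>lborel) \<le> ennreal e"
proof -
  define c where "c = 2 powr p * (2 powr p * 2)"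
  have c: "c > 0" by (simp add: c_def)
  define e1 where "e1 = e / (2 * c)"
  have e1: "0 < e1" using e c by (simp add: e1_def)
  obtain g r where g: "continuous_on UNIV g" "\<And>x. norm x \<ge> r \<Longrightarrow> g x = 0" "0 < r"
    and fg: "(\<integral>\<^sup>+x. ennreal (\<bar>f x - g x\<bar> powr p) \<partial>lborel) \<le> ennreal e1"
    using Lp_approx_continuous[OF p f fin e1] by metis
  have gm[measurable]: "g \<in> borel_measurable borel" using g(1) by (rule borel_measurable_continuous_onI)
  define m where "m = measure lborel (cball 0 (r + 1) :: 'a set)"
  have m0: "0 \<le> m" by (simp add: m_def)
  define e2 where "e2 = (e / (2 * 2 powr p * (m + 1))) powr (1 / p)"
  have e2: "0 < e2" "e2 powr p = e / (2 * 2 powr p * (m + 1))"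
    using e m0 p by (auto simp: e2_def powr_powr zero_less_mult_iff add_pos_nonneg)
  obtain d where d: "0 < d" "d \<le> 1" "\<And>x y. norm (x - y) < d \<Longrightarrow> norm (g x - g y) < e2"
    using compact_support_uniformly_continuous[OF g(1,2) e2(1)] by blast
  show thesis
  proof (rule that[OF d(1)])
    fix h :: 'a assume h: "norm h < d"
    let ?I = "\<lambda>u. \<integral>\<^sup>+x. ennreal (\<bar>u x\<bar> powr p) \<partial>(lborel :: 'a measure)"
    have 1: "?I (\<lambda>x. f (h + x) - g (h + x)) \<le> ennreal e1"
      using fg nn_integral_lborel_translate[of "\<lambda>x. ennreal (\<bar>f x - g x\<bar> powr p)" h] by simp
    have 2: "?I (\<lambda>x. g (h + x) - g x) \<le> ennreal (e2 powr p * m)"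
    proof -
      have "?I (\<lambda>x. g (h + x) - g x) \<le> (\<integral>\<^sup>+x. ennreal (e2 powr p) * indicator (cball 0 (r + 1)) x \<partial>(lborel :: 'a measure))"
      proof (rule nn_integral_mono)
        fix x :: 'a
        show "ennreal (\<bar>g (h + x) - g x\<bar> powr p) \<le> ennreal (e2 powr p) * indicator (cball 0 (r + 1)) x"
        proof (cases "x \<in> cball 0 (r + 1)")
          case True
          have "\<bar>g (h + x) - g x\<bar> powr p \<le> e2 powr p"
            using d(3)[of "h + x" x] h p by (intro powr_mono2) auto
          then show ?thesis using True by (simp add: ennreal_leI)
        next
          case False
          then have "norm x \<ge> r" "norm (h + x) \<ge> r"
            using h d(2) norm_triangle_ineq2[of x "- h"] by (auto simp: add.commute)
          then show ?thesis using g(2) p by simp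
        qed
      qed
      also have "\<dots> = ennreal (e2 powr p) * emeasure lborel (cball 0 (r + 1) :: 'a set)"
        by (subst nn_integral_cmult_indicator) auto
      also have "emeasure lborel (cball 0 (r + 1) :: 'a set) = ennreal m"
        unfolding m_def by (intro emeasure_eq_ennreal_measure) (use emeasure_bounded_finite[of "cball 0 (r + 1) :: 'a set"] in auto)
      finally show ?thesis using m0 by (simp add: ennreal_mult)
    qed
    have "?I (\<lambda>x. f (x + h) - f x) \<le> (\<integral>\<^sup>+x. ennreal (2 powr p * 2 powr p) * ennreal (\<bar>f (h + x) - g (h + x)\<bar> powr p)
        + (ennreal (2 powr p) * ennreal (\<bar>g (h + x) - g x\<bar> powr p) + ennreal (2 powr p * 2 powr p) * ennreal (\<bar>f x - g x\<bar> powr p)) \<partial>lborel)"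
    proof (rule nn_integral_mono)
      fix x
      let ?a = "\<bar>f (h + x) - g (h + x)\<bar>" and ?b = "\<bar>g (h + x) - g x\<bar>" and ?c = "\<bar>f x - g x\<bar>"
      have "\<bar>f (x + h) - f x\<bar> powr p \<le> ((?a + ?c) + ?b) powr p"
        using p by (intro powr_mono2) (auto simp: add.commute)
      also have "\<dots> \<le> 2 powr p * ((?a + ?c) powr p + ?b powr p)"
        using p by (intro powr_add_le) auto
      also have "\<dots> \<le> 2 powr p * (2 powr p * (?a powr p + ?c powr p) + ?b powr p)"
        using p by (intro mult_left_mono add_mono powr_add_le) auto
      also have "\<dots> = (2 powr p * 2 powr p) * ?a powr p + (2 powr p * ?b powr p + (2 powr p * 2 powr p) * ?c powr p)"
        by (simp add: algebra_simps)
      finally show "ennreal (\<bar>f (x + h) - f x\<bar> powr p) \<le> ennreal (2 powr p * 2 powr p) * ennreal (?a powr p)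
        + (ennreal (2 powr p) * ennreal (?b powr p) + ennreal (2 powr p * 2 powr p) * ennreal (?c powr p))"
        by (simp add: ennreal_mult''[symmetric] ennreal_plus[symmetric] ennreal_leI del: ennreal_plus)
    qed
    also have "\<dots> = ennreal (2 powr p * 2 powr p) * ?I (\<lambda>x. f (h + x) - g (h + x))
        + (ennreal (2 powr p) * ?I (\<lambda>x. g (h + x) - g x) + ennreal (2 powr p * 2 powr p) * ?I (\<lambda>x. f x - g x))"
      by (simp add: nn_integral_add nn_integral_cmult)
    also have "\<dots> \<le> ennreal (2 powr p * 2 powr p) * ennreal e1
        + (ennreal (2 powr p) * ennreal (e2 powr p * m) + ennreal (2 powr p * 2 powr p) * ennreal e1)"
      by (intro add_mono mult_left_mono 1 2 fg) auto
    also have "\<dots> = ennreal ((2 powr p * 2 powr p) * e1 + (2 powr p * (e2 powr p * m) + (2 powr p * 2 powr p) * e1))"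
      using e1 m0 by (simp add: ennreal_mult''[symmetric] ennreal_plus[symmetric] del: ennreal_plus)
    also have "\<dots> \<le> ennreal e"
    proof (rule ennreal_leI)
      have "2 powr p * (e2 powr p * m) = e / 2 * (m / (m + 1))"
      proof -
        have "c * (e / (2 * c * (m + 1)) * m) = e / 2 * (m / (m + 1))" if "c \<noteq> 0" for c :: real
          using that m0 by simp
        then show ?thesis unfolding e2(2) by simp
      qed
      also have "\<dots> \<le> e / 2 * 1" using m0 e by (intro mult_left_mono) auto
      finally have a: "2 powr p * (e2 powr p * m) \<le> e / 2" by simp
      have "(2 powr p * 2 powr p) * e1 = e / 4" by (simp add: e1_def c_def)
      with a show "(2 powr p * 2 powr p) * e1 + (2 powr p * (e2 powr p * m) + (2 powr p * 2 powr p) * e1) \<le> e"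
        by linarith
    qed
    finally show "?I (\<lambda>x. f (x + h) - f x) \<le> ennreal e" .
  qed
qed

text \<open>
  Young's inequality turns continuity of translations in \<open>L\<^sup>p\<close> into continuity of the pairing with
  a function of the dual space; here \<open>\<bar>F\<bar> \<le> \<alpha>\<^sup>p\<^sup>-\<^sup>1\<close> with \<open>\<alpha>\<close> in \<open>L\<^sup>p\<close> replaces a dual exponent.
\<close>

lemma pairing_translation_continuous:
  fixes f F \<alpha> :: "'a::euclidean_space \<Rightarrow> real"
  assumes p: "1 < p" and f[measurable]: "f \<in> borel_measurable borel"
    and fin: "(\<integral>\<^sup>+x. ennreal (\<bar>f x\<bar> powr p) \<partial>lborel) < \<infinity>"
    and [measurable]: "\<alpha> \<in> borel_measurable borel" and \<alpha>: "\<And>x. 0 \<le> \<alpha> x" "integrable lborel (\<lambda>x. \<alpha> x powr p)"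
    and F: "\<And>x. \<bar>F x\<bar> \<le> \<alpha> x powr (p - 1)" and e: "0 < e"
  obtains d where "0 < d"
    "\<And>h. norm h < d \<Longrightarrow> (\<integral>\<^sup>+x. ennreal \<bar>F x\<bar> * ennreal \<bar>f (x + h) - f x\<bar> \<partial>lborel) \<le> ennreal e"
proof -
  define I where "I = (LINT x|lborel. \<alpha> x powr p)"
  have I: "0 \<le> I" "(\<integral>\<^sup>+x. ennreal (\<alpha> x powr p) \<partial>lborel) = ennreal I"
    using \<alpha>(2) by (auto simp: I_def nn_integral_eq_integral)
  \<comment> \<open>The weight \<open>\<mu>\<close> in Young's inequality makes the \<open>\<alpha>\<close> part at most \<open>e / 2\<close>; then \<open>e'\<close> does it for the rest.\<close>
  define \<mu> where "\<mu> = e / (2 * (I + 1))"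
  have \<mu>: "0 < \<mu>" using e I by (simp add: \<mu>_def)
  have \<mu>I: "\<mu> * I \<le> e / 2" using I e by (simp add: \<mu>_def field_simps)
  define e' where "e' = e / 2 * \<mu> powr (p - 1)"
  have e': "0 < e'" using e \<mu> by (simp add: e'_def)
  obtain d where d: "0 < d"
    "\<And>h. norm h < d \<Longrightarrow> (\<integral>\<^sup>+x. ennreal (\<bar>f (x + h) - f x\<bar> powr p) \<partial>lborel) \<le> ennreal e'"
    using Lp_translation_continuous[OF less_imp_le[OF p] f fin e'] by blast
  have young: "a powr (p - 1) * s \<le> inverse (\<mu> powr (p - 1)) * s powr p + \<mu> * a powr p" if "0 \<le> a" "0 \<le> s" for a s
  proof -
    have "p * s * (\<mu> * a) powr (p - 1) \<le> s powr p + (p - 1) * (\<mu> * a) powr p"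
      using that \<mu> p by (intro young_tangent) auto
    then have "p * s * (\<mu> powr (p - 1) * a powr (p - 1)) \<le> s powr p + (p - 1) * (\<mu> * \<mu> powr (p - 1) * a powr p)"
      using that \<mu> by (simp add: powr_mult powr_diff)
    also have "\<dots> \<le> p * s powr p + p * (\<mu> * \<mu> powr (p - 1) * a powr p)"
      using p \<mu> by (intro add_mono mult_right_mono) (auto simp: mult_le_cancel_right1)
    finally have "p * (\<mu> powr (p - 1) * (a powr (p - 1) * s)) \<le> p * (s powr p + \<mu> powr (p - 1) * (\<mu> * a powr p))"
      by (simp add: algebra_simps)
    then have "\<mu> powr (p - 1) * (a powr (p - 1) * s) \<le> s powr p + \<mu> powr (p - 1) * (\<mu> * a powr p)"
      using p by simp
    then show ?thesis using \<mu> by (simp add: field_simps)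
  qed
  show thesis
  proof (rule that[OF d(1)])
    fix h :: 'a assume h: "norm h < d"
    have "(\<integral>\<^sup>+x. ennreal \<bar>F x\<bar> * ennreal \<bar>f (x + h) - f x\<bar> \<partial>lborel)
      \<le> (\<integral>\<^sup>+x. ennreal (inverse (\<mu> powr (p - 1))) * ennreal (\<bar>f (x + h) - f x\<bar> powr p) + ennreal \<mu> * ennreal (\<alpha> x powr p) \<partial>lborel)"
    proof (rule nn_integral_mono)
      fix x
      have "\<bar>F x\<bar> * \<bar>f (x + h) - f x\<bar> \<le> \<alpha> x powr (p - 1) * \<bar>f (x + h) - f x\<bar>"
        by (intro mult_right_mono F) auto
      also have "\<dots> \<le> inverse (\<mu> powr (p - 1)) * \<bar>f (x + h) - f x\<bar> powr p + \<mu> * \<alpha> x powr p"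
        by (intro young \<alpha>) auto
      finally show "ennreal \<bar>F x\<bar> * ennreal \<bar>f (x + h) - f x\<bar> \<le>
        ennreal (inverse (\<mu> powr (p - 1))) * ennreal (\<bar>f (x + h) - f x\<bar> powr p) + ennreal \<mu> * ennreal (\<alpha> x powr p)"
        using \<mu> by (simp add: ennreal_mult''[symmetric] ennreal_plus[symmetric] ennreal_leI del: ennreal_plus)
    qed
    also have "\<dots> = ennreal (inverse (\<mu> powr (p - 1))) * (\<integral>\<^sup>+x. ennreal (\<bar>f (x + h) - f x\<bar> powr p) \<partial>lborel) + ennreal \<mu> * ennreal I"
      by (simp add: nn_integral_add nn_integral_cmult I)
    also have "\<dots> \<le> ennreal (inverse (\<mu> powr (p - 1))) * ennreal e' + ennreal \<mu> * ennreal I"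
      by (intro add_mono mult_left_mono d h) auto
    also have "\<dots> = ennreal (inverse (\<mu> powr (p - 1)) * e' + \<mu> * I)"
      using \<mu> e' I by (simp add: ennreal_mult''[symmetric] ennreal_plus[symmetric] del: ennreal_plus)
    also have "\<dots> \<le> ennreal e"
      using \<mu> \<mu>I by (intro ennreal_leI) (auto simp: e'_def field_simps)
    finally show "(\<integral>\<^sup>+x. ennreal \<bar>F x\<bar> * ennreal \<bar>f (x + h) - f x\<bar> \<partial>lborel) \<le> ennreal e" .
  qed
qed

definition conv :: "('a::euclidean_space \<Rightarrow> real) \<Rightarrow> ('a \<Rightarrow> real) \<Rightarrow> 'a \<Rightarrow> real" where
  "conv \<eta> f x = (LINT y|lborel. \<eta> (x - y) * f y)"

lemma lebesgue_integral_norm_le: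
  fixes f :: "'a \<Rightarrow> 'b::{banach, second_countable_topology}"
  assumes g: "integrable M g" and le: "\<And>x. norm (f x) \<le> g x"
  shows "norm (integral\<^sup>L M f) \<le> integral\<^sup>L M g"
proof -
  have "norm (integral\<^sup>L M f) \<le> (LINT x|M. norm (f x))" by (rule integral_norm_bound)
  also have "\<dots> \<le> integral\<^sup>L M g"
    using le order_trans[OF norm_ge_zero le] by (intro integral_mono' g) auto
  finally show ?thesis .
qed

lemma C0_inf_bounded:
  assumes "\<eta> \<in> C0_inf U"
  obtains M r where "0 < r" "0 \<le> M" "\<And>x. \<bar>\<eta> x\<bar> \<le> M" "\<And>x. norm x \<ge> r \<Longrightarrow> \<eta> x = 0"
proof -
  let ?S = "closure {x. \<eta> x \<noteq> 0}"
  have S: "compact ?S" using assms by (rule C0_inf_compact)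
  have "compact (\<eta> ` ?S)" using C0_inf_continuous[OF assms] S by (rule compact_continuous_image)
  then obtain M where M: "\<And>x. x \<in> ?S \<Longrightarrow> \<bar>\<eta> x\<bar> \<le> M" using compact_imp_bounded by (force simp: bounded_iff)
  obtain r where r: "\<And>x. x \<in> ?S \<Longrightarrow> norm x \<le> r" using compact_imp_bounded[OF S] by (auto simp: bounded_iff)
  have z: "\<eta> x = 0" if "x \<notin> ?S" for x using that closure_subset[of "{x. \<eta> x \<noteq> 0}"] by auto
  show thesis
  proof (rule that[of "\<bar>r\<bar> + 1" "\<bar>M\<bar>"])
    show "\<bar>\<eta> x\<bar> \<le> \<bar>M\<bar>" for x using M[of x] z[of x] by (cases "x \<in> ?S") auto
    show "\<eta> x = 0" if "\<bar>r\<bar> + 1 \<le> norm x" for x using z[of x] r[of x] that by (cases "x \<in> ?S") auto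
  qed auto
qed

lemma C0_inf_measurable: "\<eta> \<in> C0_inf U \<Longrightarrow> \<eta> \<in> borel_measurable borel"
  by (intro borel_measurable_continuous_onI C0_inf_continuous)

lemma C0_inf_grad_measurable: "\<eta> \<in> C0_inf U \<Longrightarrow> grad \<eta> \<in> borel_measurable borel"
  by (intro borel_measurable_continuous_onI C0_inf_continuous_grad)

lemma integrable_compact_support:
  fixes f :: "'a::euclidean_space \<Rightarrow> 'b::{banach, second_countable_topology}"
  assumes "compact S" "continuous_on S f" "\<And>x. x \<notin> S \<Longrightarrow> f x = 0"
  shows "integrable lborel f"
proof -
  have "integrable lborel (\<lambda>x. indicator S x *\<^sub>R f x)" using assms by (intro borel_integrable_compact)
  moreover have "(\<lambda>x. indicator S x *\<^sub>R f x) = f" using assms(3) by (auto simp: indicator_def)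
  ultimately show ?thesis by simp
qed

lemma C0_inf_integrable:
  assumes "\<eta> \<in> C0_inf U" shows "integrable lborel \<eta>"
  by (rule integrable_compact_support[OF C0_inf_compact[OF assms] C0_inf_continuous[OF assms]])
     (use closure_subset[of "{x. \<eta> x \<noteq> 0}"] in auto)

lemma integrable_bounded_mult:
  fixes f g :: "'a::euclidean_space \<Rightarrow> real"
  assumes "integrable M f" "g \<in> borel_measurable M" "\<And>x. \<bar>g x\<bar> \<le> C"
  shows "integrable M (\<lambda>x. g x * f x)"
proof (rule Bochner_Integration.integrable_bound)
  show "integrable M (\<lambda>x. C * f x)" using assms by simp
  show "(\<lambda>x. g x * f x) \<in> borel_measurable M"
    using assms(2) borel_measurable_integrable[OF assms(1)] by measurable
  show "AE x in M. norm (g x * f x) \<le> norm (C * f x)"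
  proof (rule AE_I2)
    fix x
    have "\<bar>g x\<bar> \<le> \<bar>C\<bar>" using assms(3)[of x] by linarith
    then show "norm (g x * f x) \<le> norm (C * f x)" by (simp add: abs_mult mult_right_mono)
  qed
qed

lemma conv_integrand:
  assumes \<eta>: "\<eta> \<in> C0_inf U" and f: "integrable lborel f"
  shows "integrable lborel (\<lambda>y. \<eta> (x - y) * f y)" and "integrable lborel (\<lambda>y. \<eta> y * f (x - y))"
proof -
  have m[measurable]: "\<eta> \<in> borel_measurable borel" using \<eta> by (rule C0_inf_measurable)
  have fm[measurable]: "f \<in> borel_measurable borel" using borel_measurable_integrable[OF f] by simp
  obtain M where M: "\<And>x. \<bar>\<eta> x\<bar> \<le> M" using C0_inf_bounded[OF \<eta>] by metis
  show "integrable lborel (\<lambda>y. \<eta> (x - y) * f y)"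
    by (rule integrable_bounded_mult[OF f _ M]) measurable
  show "integrable lborel (\<lambda>y. \<eta> y * f (x - y))"
    using f lborel_integrable_reflect[OF fm, of x] by (intro integrable_bounded_mult[OF _ _ M]) auto
qed

lemma conv_eq:
  assumes \<eta>: "\<eta> \<in> C0_inf U" and f: "integrable lborel f"
  shows "conv \<eta> f x = (LINT y|lborel. \<eta> y * f (x - y))"
proof -
  have m[measurable]: "\<eta> \<in> borel_measurable borel" using \<eta> by (rule C0_inf_measurable)
  have fm[measurable]: "f \<in> borel_measurable borel" using borel_measurable_integrable[OF f] by simp
  have "(\<lambda>y. \<eta> y * f (x - y)) \<in> borel_measurable borel" by measurable
  from lborel_integral_reflect[OF this, of x] show ?thesis by (simp add: conv_def)
qed

text \<open>
  The derivative falls on the smooth factor: uniform continuity of \<open>grad \<eta>\<close> makes the first order Taylor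
  error of \<open>\<eta>\<close> small relative to the increment, uniformly in the integration variable.
\<close>

lemma conv_GDERIV:
  assumes \<eta>: "\<eta> \<in> C0_inf U" and f: "integrable lborel f"
  shows "GDERIV (conv \<eta> f) x :> (LINT y|lborel. f y *\<^sub>R grad \<eta> (x - y))" (is "GDERIV _ _ :> ?D")
proof -
  have [measurable]: "\<eta> \<in> borel_measurable borel" "grad \<eta> \<in> borel_measurable borel" "f \<in> borel_measurable borel"
    using \<eta> borel_measurable_integrable[OF f] by (auto intro: C0_inf_measurable C0_inf_grad_measurable)
  obtain r where r: "\<And>x. norm x \<ge> r \<Longrightarrow> \<eta> x = 0" using C0_inf_bounded[OF \<eta>] by metis
  have gr: "grad \<eta> x = 0" if "norm x \<ge> r + 1" for x
  proof (rule grad_eqI, rule GDERIV_eq_0_on_open[where S="{x. r < norm x}"])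
    show "open {x::'a. r < norm x}" by (intro open_Collect_less continuous_intros)
  qed (use that r in auto)
  have gi: "integrable lborel (\<lambda>y. f y *\<^sub>R grad \<eta> (x - y))"
  proof -
    have "integrable lborel (\<lambda>y. (f y *\<^sub>R grad \<eta> (x - y)) \<bullet> b)" if "b \<in> Basis" for b
      using conv_integrand(1)[OF C0_inf_partial[OF \<eta> that] f, of x] by (simp add: mult.commute)
    then have "integrable lborel (\<lambda>y. \<Sum>b\<in>Basis. ((f y *\<^sub>R grad \<eta> (x - y)) \<bullet> b) *\<^sub>R b)"
      by (intro Bochner_Integration.integrable_sum integrable_scaleR_left)
    then show ?thesis by (simp only: euclidean_representation)
  qed
  define N where "N = (LINT y|lborel. \<bar>f y\<bar>)"
  have N: "0 \<le> N" by (simp add: N_def)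
  have "\<exists>d>0. \<forall>y. norm (y - x) < d \<longrightarrow> norm (conv \<eta> f y - conv \<eta> f x - (y - x) \<bullet> ?D) \<le> e * norm (y - x)" if e: "0 < e" for e
  proof -
    define e' where "e' = e / (N + 1)"
    have e': "0 < e'" "e' * N \<le> e" using e N by (auto simp: e'_def field_simps)
    obtain d where d: "0 < d" "\<And>x y. norm (x - y) < d \<Longrightarrow> norm (grad \<eta> x - grad \<eta> y) < e'"
      using compact_support_uniformly_continuous[OF C0_inf_continuous_grad[OF \<eta>] gr e'(1)] by metis
    have lin: "\<bar>\<eta> (a + h) - \<eta> a - h \<bullet> grad \<eta> a\<bar> \<le> e' * norm h" if h: "norm h < d" for a h
    proof -
      obtain t where t: "0 < t" "t < 1" "\<eta> (a + 1 *\<^sub>R h) - \<eta> (a + 0 *\<^sub>R h) = (1 - 0) * (h \<bullet> grad \<eta> (a + t *\<^sub>R h))"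
        using MVT2[of 0 1 "\<lambda>t. \<eta> (a + t *\<^sub>R h)" "\<lambda>t. h \<bullet> grad \<eta> (a + t *\<^sub>R h)"]
          GDERIV_along_line[OF C0_inf_GDERIV[OF \<eta>]] by auto
      then have "\<bar>\<eta> (a + h) - \<eta> a - h \<bullet> grad \<eta> a\<bar> = \<bar>h \<bullet> (grad \<eta> (a + t *\<^sub>R h) - grad \<eta> a)\<bar>"
        by (simp add: inner_diff_right)
      also have "\<dots> \<le> norm h * norm (grad \<eta> (a + t *\<^sub>R h) - grad \<eta> a)" by (rule Cauchy_Schwarz_ineq2)
      also have "\<dots> \<le> norm h * e'"
      proof (rule mult_left_mono[OF less_imp_le], rule d(2))
        have "norm (t *\<^sub>R h) \<le> 1 * norm h" using t mult_right_mono[of t 1 "norm h"] by simp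
        then show "norm (a + t *\<^sub>R h - a) < d" using h by simp
      qed simp
      finally show ?thesis by (simp add: mult.commute)
    qed
    show ?thesis
    proof (intro exI conjI allI impI)
      fix y assume y: "norm (y - x) < d"
      let ?R = "\<lambda>z. f z * (\<eta> (y - z) - \<eta> (x - z) - (y - x) \<bullet> grad \<eta> (x - z))"
      have i: "integrable lborel (\<lambda>z. \<eta> (y - z) * f z)" "integrable lborel (\<lambda>z. \<eta> (x - z) * f z)"
        by (rule conv_integrand[OF \<eta> f])+
      have i3: "integrable lborel (\<lambda>z. (y - x) \<bullet> (f z *\<^sub>R grad \<eta> (x - z)))"
        using gi by (rule integrable_inner_right)
      have eq: "conv \<eta> f y - conv \<eta> f x - (y - x) \<bullet> ?D = (LINT z|lborel. \<eta> (y - z) * f z - \<eta> (x - z) * f z - (y - x) \<bullet> (f z *\<^sub>R grad \<eta> (x - z)))"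
        using i i3 by (simp only: conv_def Bochner_Integration.integral_diff Bochner_Integration.integrable_diff
            integral_inner_right[OF gi])
      have "norm (LINT z|lborel. \<eta> (y - z) * f z - \<eta> (x - z) * f z - (y - x) \<bullet> (f z *\<^sub>R grad \<eta> (x - z)))
         \<le> (LINT z|lborel. e' * norm (y - x) * \<bar>f z\<bar>)"
      proof (rule lebesgue_integral_norm_le)
        show "integrable lborel (\<lambda>z. e' * norm (y - x) * \<bar>f z\<bar>)" using f by simp
        fix z
        have "norm (\<eta> (y - z) * f z - \<eta> (x - z) * f z - (y - x) \<bullet> (f z *\<^sub>R grad \<eta> (x - z))) =
          \<bar>\<eta> ((x - z) + (y - x)) - \<eta> (x - z) - (y - x) \<bullet> grad \<eta> (x - z)\<bar> * \<bar>f z\<bar>"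
          unfolding abs_mult[symmetric] by (simp add: algebra_simps)
        also have "\<dots> \<le> (e' * norm (y - x)) * \<bar>f z\<bar>" by (intro mult_right_mono lin y) simp
        finally show "norm (\<eta> (y - z) * f z - \<eta> (x - z) * f z - (y - x) \<bullet> (f z *\<^sub>R grad \<eta> (x - z))) \<le> e' * norm (y - x) * \<bar>f z\<bar>" .
      qed
      also have "\<dots> = (e' * N) * norm (y - x)" by (simp add: N_def)
      also have "\<dots> \<le> e * norm (y - x)" using e' by (intro mult_right_mono) auto
      finally show "norm (conv \<eta> f y - conv \<eta> f x - (y - x) \<bullet> ?D) \<le> e * norm (y - x)" by (simp only: eq)
    qed (rule d(1))
  qed
  then show ?thesis
    unfolding gderiv_def has_derivative_at_alt by (auto intro: bounded_linear_inner_left)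
qed

lemma grad_conv:
  assumes \<eta>: "\<eta> \<in> C0_inf U" and f: "integrable lborel f" and b: "b \<in> Basis"
  shows "grad (conv \<eta> f) x \<bullet> b = conv (\<lambda>x. grad \<eta> x \<bullet> b) f x"
proof -
  have "(LINT y|lborel. f y *\<^sub>R grad \<eta> (x - y)) \<bullet> b = (LINT y|lborel. (f y *\<^sub>R grad \<eta> (x - y)) \<bullet> b)"
  proof (rule integral_inner_left[symmetric])
    have "integrable lborel (\<lambda>y. (f y *\<^sub>R grad \<eta> (x - y)) \<bullet> b)" if "b \<in> Basis" for b
      using conv_integrand(1)[OF C0_inf_partial[OF \<eta> that] f, of x] by (simp add: mult.commute)
    then have "integrable lborel (\<lambda>y. \<Sum>b\<in>Basis. ((f y *\<^sub>R grad \<eta> (x - y)) \<bullet> b) *\<^sub>R b)"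
      by (intro Bochner_Integration.integrable_sum integrable_scaleR_left)
    then show "integrable lborel (\<lambda>y. f y *\<^sub>R grad \<eta> (x - y))" by (simp only: euclidean_representation)
  qed
  then show ?thesis by (simp add: grad_eqI[OF conv_GDERIV[OF \<eta> f]] conv_def mult.commute)
qed

lemma conv_C0_inf:
  assumes \<eta>: "\<eta> \<in> C0_inf UNIV" "\<And>x. norm x \<ge> \<epsilon> \<Longrightarrow> \<eta> x = 0" and f: "integrable lborel f"
    and S: "compact S" "\<And>x. x \<notin> S \<Longrightarrow> f x = 0" and U: "\<And>x y. x \<in> S \<Longrightarrow> norm y \<le> \<epsilon> \<Longrightarrow> x + y \<in> U"
  shows "conv \<eta> f \<in> C0_inf U"
proof (rule C0_infI)
  show "smooth_on UNIV (conv \<eta> f)"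
  proof (rule smooth_on_UNIV_coinduct[where T="{conv \<eta> f |\<eta>. \<eta> \<in> C0_inf UNIV}"])
    fix g assume "g \<in> {conv \<eta> f |\<eta>. \<eta> \<in> C0_inf UNIV}"
    then obtain \<eta>' where g: "g = conv \<eta>' f" "\<eta>' \<in> C0_inf UNIV" by auto
    show "g differentiable (at x)" for x
      unfolding g(1) by (rule GDERIV_imp_differentiable, rule conv_GDERIV[OF g(2) f])
    show "(\<lambda>x. grad g x \<bullet> b) \<in> {conv \<eta> f |\<eta>. \<eta> \<in> C0_inf UNIV}" if "b \<in> Basis" for b
      unfolding g(1) grad_conv[OF g(2) f that] using C0_inf_partial[OF g(2) that] by blast
  qed (use \<eta> in auto)
  show "compact {x + y |x y. x \<in> S \<and> y \<in> cball 0 \<epsilon>}" using S(1) by (intro compact_sums) auto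
  show "{x + y |x y. x \<in> S \<and> y \<in> cball 0 \<epsilon>} \<subseteq> U" using U by auto
  fix x assume x: "x \<notin> {x + y |x y. x \<in> S \<and> y \<in> cball 0 \<epsilon>}"
  have "\<eta> (x - y) * f y = 0" for y
  proof (cases "y \<in> S")
    case True
    have "x = y + (x - y)" by simp
    with x True have "x - y \<notin> cball 0 \<epsilon>" by blast
    then show ?thesis using \<eta>(2) by simp
  qed (use S in simp)
  note * = this
  show "conv \<eta> f x = 0" by (simp only: conv_def * Bochner_Integration.integral_zero)
qed

text \<open>
  The derivative may also be moved to the other factor, by integrating the gradient of
  \<open>y \<mapsto> \<eta> (x - y) f(y)\<close>.
\<close>

lemma conv_partial:
  fixes f :: "'a::euclidean_space \<Rightarrow> real"
  assumes \<eta>: "\<eta> \<in> C0_inf UNIV" and b: "b \<in> Basis"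
    and f: "\<And>x. f differentiable (at x)" "integrable lborel f" "integrable lborel (\<lambda>x. grad f x \<bullet> b)"
  shows "conv (\<lambda>x. grad \<eta> x \<bullet> b) f x = conv \<eta> (\<lambda>x. grad f x \<bullet> b) x"
proof -
  define \<psi> where "\<psi> y = \<eta> (x - y) * f y" for y
  have 1: "GDERIV (\<lambda>y. \<eta> (x - y)) y :> - grad \<eta> (x - y)" for y
    using GDERIV_affine[of \<eta> x "-1" y _ 1, OF C0_inf_GDERIV[OF \<eta>]] by simp
  have G: "GDERIV \<psi> y :> \<eta> (x - y) *\<^sub>R grad f y + f y *\<^sub>R (- grad \<eta> (x - y))" for y
    unfolding \<psi>_def by (intro GDERIV_mult 1 GDERIV_grad f)
  have gr: "grad \<psi> y \<bullet> b = \<eta> (x - y) * (grad f y \<bullet> b) - (grad \<eta> (x - y) \<bullet> b) * f y" for y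
    by (simp add: grad_eqI[OF G] inner_diff_left inner_add_left)
  have i: "integrable lborel (\<lambda>y. \<eta> (x - y) * (grad f y \<bullet> b))" "integrable lborel (\<lambda>y. (grad \<eta> (x - y) \<bullet> b) * f y)"
    using conv_integrand(1)[OF \<eta> f(3)] conv_integrand(1)[OF C0_inf_partial[OF \<eta> b] f(2)] by auto
  have "(LINT y|lborel. grad \<psi> y \<bullet> b) = 0"
  proof (rule integral_partial_eq_0)
    show "\<psi> differentiable (at y)" for y using G by (rule GDERIV_imp_differentiable)
    show "integrable lborel \<psi>" unfolding \<psi>_def by (rule conv_integrand(1)[OF \<eta> f(2)])
    show "integrable lborel (\<lambda>y. grad \<psi> y \<bullet> b)" unfolding gr using i by (rule Bochner_Integration.integrable_diff)
  qed
  then show ?thesis using i by (simp add: gr conv_def)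
qed

text \<open>
  A mollification is an average of small translations, so by Tonelli it inherits every bound for
  translations. The weight \<open>F\<close> covers both convergence in \<open>L\<^sup>1\<close> and convergence of pairings.
\<close>

lemma conv_close:
  fixes f F :: "'a::euclidean_space \<Rightarrow> real"
  assumes \<eta>: "\<eta> \<in> C0_inf UNIV" "\<And>x. 0 \<le> \<eta> x" "(LINT x|lborel. \<eta> x) = 1" "\<And>x. norm x \<ge> d \<Longrightarrow> \<eta> x = 0"
    and f: "integrable lborel f" and F[measurable]: "F \<in> borel_measurable borel"
    and close: "\<And>h. norm h < d \<Longrightarrow> (\<integral>\<^sup>+x. ennreal \<bar>F x\<bar> * ennreal \<bar>f (x + h) - f x\<bar> \<partial>lborel) \<le> ennreal e"
  shows "(\<integral>\<^sup>+x. ennreal \<bar>F x\<bar> * ennreal \<bar>conv \<eta> f x - f x\<bar> \<partial>lborel) \<le> ennreal e"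
proof -
  have [measurable]: "\<eta> \<in> borel_measurable borel" "f \<in> borel_measurable borel"
    using \<eta> borel_measurable_integrable[OF f] by (auto intro: C0_inf_measurable)
  have i\<eta>: "integrable lborel \<eta>" using \<eta>(1) by (rule C0_inf_integrable)
  have pt: "ennreal \<bar>conv \<eta> f x - f x\<bar> \<le> (\<integral>\<^sup>+y. ennreal (\<eta> y) * ennreal \<bar>f (x - y) - f x\<bar> \<partial>lborel)" for x
  proof -
    have i: "integrable lborel (\<lambda>y. \<eta> y * f (x - y))" by (rule conv_integrand[OF \<eta>(1) f])
    have "conv \<eta> f x - f x = (LINT y|lborel. \<eta> y * f (x - y) - \<eta> y * f x)"
      using i i\<eta> \<eta>(3) by (simp add: conv_eq[OF \<eta>(1) f])
    also have "ennreal (norm \<dots>) \<le> (\<integral>\<^sup>+y. norm (\<eta> y * f (x - y) - \<eta> y * f x) \<partial>lborel)"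
      using i i\<eta> by (intro integral_norm_bound_ennreal) auto
    also have "\<dots> = (\<integral>\<^sup>+y. ennreal (\<eta> y) * ennreal \<bar>f (x - y) - f x\<bar> \<partial>lborel)"
    proof (rule nn_integral_cong)
      fix y
      have "norm (\<eta> y * f (x - y) - \<eta> y * f x) = \<eta> y * \<bar>f (x - y) - f x\<bar>"
        using \<eta>(2)[of y] by (simp add: right_diff_distrib[symmetric] abs_mult)
      then show "ennreal (norm (\<eta> y * f (x - y) - \<eta> y * f x)) = ennreal (\<eta> y) * ennreal \<bar>f (x - y) - f x\<bar>"
        by (simp only: ennreal_mult''[OF abs_ge_zero])
    qed
    finally show ?thesis by simp
  qed
  have "(\<integral>\<^sup>+x. ennreal \<bar>F x\<bar> * ennreal \<bar>conv \<eta> f x - f x\<bar> \<partial>lborel)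
      \<le> (\<integral>\<^sup>+x. ennreal \<bar>F x\<bar> * (\<integral>\<^sup>+y. ennreal (\<eta> y) * ennreal \<bar>f (x - y) - f x\<bar> \<partial>lborel) \<partial>lborel)"
    by (intro nn_integral_mono mult_left_mono pt) auto
  also have "\<dots> = (\<integral>\<^sup>+x. (\<integral>\<^sup>+y. ennreal \<bar>F x\<bar> * (ennreal (\<eta> y) * ennreal \<bar>f (x - y) - f x\<bar>) \<partial>lborel) \<partial>lborel)"
    by (intro nn_integral_cong nn_integral_cmult[symmetric]) measurable
  also have "\<dots> = (\<integral>\<^sup>+y. (\<integral>\<^sup>+x. ennreal \<bar>F x\<bar> * (ennreal (\<eta> y) * ennreal \<bar>f (x - y) - f x\<bar>) \<partial>lborel) \<partial>lborel)"
    by (rule lborel_pair.Fubini') measurable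
  also have "\<dots> \<le> (\<integral>\<^sup>+y. ennreal (\<eta> y) * ennreal e \<partial>lborel)"
  proof (rule nn_integral_mono)
    fix y :: 'a
    have "(\<integral>\<^sup>+x. ennreal \<bar>F x\<bar> * (ennreal (\<eta> y) * ennreal \<bar>f (x - y) - f x\<bar>) \<partial>lborel)
      = (\<integral>\<^sup>+x. ennreal (\<eta> y) * (ennreal \<bar>F x\<bar> * ennreal \<bar>f (x + (- y)) - f x\<bar>) \<partial>lborel)"
      by (intro nn_integral_cong) (simp add: mult.left_commute)
    also have "\<dots> = ennreal (\<eta> y) * (\<integral>\<^sup>+x. ennreal \<bar>F x\<bar> * ennreal \<bar>f (x + (- y)) - f x\<bar> \<partial>lborel)"
      by (intro nn_integral_cmult) measurable
    also have "\<dots> \<le> ennreal (\<eta> y) * ennreal e"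
    proof (cases "norm y < d")
      case True then show ?thesis by (intro mult_left_mono close) auto
    qed (simp add: \<eta>(4))
    finally show "(\<integral>\<^sup>+x. ennreal \<bar>F x\<bar> * (ennreal (\<eta> y) * ennreal \<bar>f (x - y) - f x\<bar>) \<partial>lborel) \<le> ennreal (\<eta> y) * ennreal e" .
  qed
  also have "\<dots> = (\<integral>\<^sup>+y. ennreal (\<eta> y) \<partial>lborel) * ennreal e" by (intro nn_integral_multc) measurable
  also have "(\<integral>\<^sup>+y. ennreal (\<eta> y) \<partial>lborel) = 1"
    using nn_integral_eq_integral[OF i\<eta>] \<eta> by simp
  finally show ?thesis by simp
qed

lemma conv_uniformly_close:
  fixes f :: "'a::euclidean_space \<Rightarrow> real"
  assumes \<eta>: "\<eta> \<in> C0_inf UNIV" "\<And>x. 0 \<le> \<eta> x" "(LINT x|lborel. \<eta> x) = 1" "\<And>x. norm x \<ge> d \<Longrightarrow> \<eta> x = 0"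
    and f: "integrable lborel f" and close: "\<And>x h. norm h < d \<Longrightarrow> \<bar>f (x + h) - f x\<bar> \<le> e"
  shows "\<bar>conv \<eta> f x - f x\<bar> \<le> e"
proof -
  have i\<eta>: "integrable lborel \<eta>" using \<eta>(1) by (rule C0_inf_integrable)
  have i: "integrable lborel (\<lambda>y. \<eta> y * f (x - y))" by (rule conv_integrand[OF \<eta>(1) f])
  have "\<bar>conv \<eta> f x - f x\<bar> = norm (LINT y|lborel. \<eta> y * f (x - y) - \<eta> y * f x)"
    using i i\<eta> \<eta>(3) by (simp add: conv_eq[OF \<eta>(1) f])
  also have "\<dots> \<le> (LINT y|lborel. \<eta> y * e)"
  proof (rule lebesgue_integral_norm_le)
    fix y
    have "norm (\<eta> y * f (x - y) - \<eta> y * f x) = \<eta> y * \<bar>f (x + (- y)) - f x\<bar>"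
      using \<eta>(2)[of y] by (simp add: right_diff_distrib[symmetric] abs_mult)
    also have "\<dots> \<le> \<eta> y * e"
    proof (cases "norm y < d")
      case True then show ?thesis by (intro mult_left_mono close \<eta>) auto
    qed (simp add: \<eta>(4))
    finally show "norm (\<eta> y * f (x - y) - \<eta> y * f x) \<le> \<eta> y * e" .
  qed (use i i\<eta> in auto)
  also have "\<dots> = e" using \<eta>(3) by simp
  finally show ?thesis .
qed

lemma lborel_integral_scale:
  fixes f :: "'a::euclidean_space \<Rightarrow> real"
  assumes [measurable]: "f \<in> borel_measurable borel" and s: "0 < s"
  shows "(LINT x|lborel. f (s *\<^sub>R x)) = (LINT x|lborel. f x) / s ^ DIM('a)"
proof -
  have "(LINT x|lborel. f x) = (LINT x|density (distr lborel borel (\<lambda>x. 0 + s *\<^sub>R x)) (\<lambda>_. \<bar>s\<bar>^DIM('a)). f x)"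
    using s by (subst lborel_affine[of s 0]) auto
  also have "\<dots> = s ^ DIM('a) * (LINT x|lborel. f (s *\<^sub>R x))"
    using s by (subst integral_density) (auto simp: integral_distr)
  finally show ?thesis using s by simp
qed

text \<open>
  Mollifiers of small support. The last property is the scaling of the first derivatives that is
  needed to differentiate a merely pointwise differentiable function by mollification.
\<close>

lemma mollifiers_exist:
  obtains C :: real where
    "\<And>\<epsilon>. 0 < \<epsilon> \<Longrightarrow> \<exists>\<eta> :: 'a::euclidean_space \<Rightarrow> real. \<eta> \<in> C0_inf UNIV \<and> (\<forall>x. 0 \<le> \<eta> x) \<and> (\<forall>x. norm x \<ge> \<epsilon> \<longrightarrow> \<eta> x = 0)
        \<and> (LINT x|lborel. \<eta> x) = 1 \<and> (\<forall>b\<in>Basis. \<epsilon> * (LINT x|lborel. \<bar>grad \<eta> x \<bullet> b\<bar>) \<le> C)"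
proof -
  obtain \<eta>0 :: "'a \<Rightarrow> real" where \<eta>0: "\<eta>0 \<in> C0_inf UNIV" "\<And>x. 0 \<le> \<eta>0 x" "\<And>x. norm x \<ge> 1 \<Longrightarrow> \<eta>0 x = 0" "\<And>x. norm x < 1 \<Longrightarrow> 0 < \<eta>0 x"
    using bump_exists by metis
  have [measurable]: "\<eta>0 \<in> borel_measurable borel" "grad \<eta>0 \<in> borel_measurable borel"
    using \<eta>0(1) by (auto intro: C0_inf_measurable C0_inf_grad_measurable)
  define m where "m = (LINT x|lborel. \<eta>0 x)"
  have m: "0 < m"
  proof -
    have "m \<noteq> 0"
    proof
      assume "m = 0"
      then have "AE x in lborel. \<eta>0 x = 0"
        using integral_nonneg_eq_0_iff_AE[OF C0_inf_integrable[OF \<eta>0(1)]] \<eta>0(2) by (simp add: m_def)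
      then have "AE x in lebesgue. \<eta>0 x = 0" by (rule AE_completion)
      then have "AE x in lebesgue. x \<in> ball (0::'a) 1 \<longrightarrow> x \<in> {}"
        by eventually_elim (use \<eta>0(4) in fastforce)
      then have "(0::'a) \<in> {}" by (rule mem_closed_if_AE_lebesgue_open[rotated 2]) auto
      then show False by simp
    qed
    moreover have "0 \<le> m" unfolding m_def using \<eta>0(2) by simp
    ultimately show ?thesis by simp
  qed
  define C where "C = (\<Sum>b\<in>Basis. LINT x|lborel. \<bar>grad \<eta>0 x \<bullet> b\<bar>) / m"
  show thesis
  proof (rule that[of C])
    fix \<epsilon> :: real assume \<epsilon>: "0 < \<epsilon>"
    define c where "c = 1 / (m * \<epsilon> ^ DIM('a))"
    have c: "0 < c" using m \<epsilon> by (simp add: c_def)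
    define \<eta> where "\<eta> x = c * \<eta>0 (0 + (1 / \<epsilon>) *\<^sub>R x)" for x
    have 1: "\<eta> \<in> C0_inf UNIV" unfolding \<eta>_def using \<epsilon> by (intro C0_inf_affine[OF \<eta>0(1)]) auto
    have 2: "0 \<le> \<eta> x" for x using c \<eta>0(2) by (simp add: \<eta>_def)
    have 3: "\<eta> x = 0" if "norm x \<ge> \<epsilon>" for x using that \<epsilon> \<eta>0(3)[of "(1 / \<epsilon>) *\<^sub>R x"] by (simp add: \<eta>_def)
    have 4: "(LINT x|lborel. \<eta> x) = 1"
      using lborel_integral_scale[of \<eta>0 "1 / \<epsilon>"] \<epsilon> m by (simp add: \<eta>_def c_def m_def[symmetric] power_one_over)
    have 5: "\<epsilon> * (LINT x|lborel. \<bar>grad \<eta> x \<bullet> b\<bar>) \<le> C" if "b \<in> Basis" for b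
    proof -
      have "\<bar>grad \<eta> x \<bullet> b\<bar> = (c / \<epsilon>) * \<bar>grad \<eta>0 ((1 / \<epsilon>) *\<^sub>R x) \<bullet> b\<bar>" for x
        unfolding \<eta>_def grad_affine[OF \<eta>0(1)] using c \<epsilon> by (simp add: abs_mult)
      then have "(LINT x|lborel. \<bar>grad \<eta> x \<bullet> b\<bar>) = (c / \<epsilon>) * (LINT x|lborel. \<bar>grad \<eta>0 ((1 / \<epsilon>) *\<^sub>R x) \<bullet> b\<bar>)" by simp
      also have "\<dots> = (c / \<epsilon>) * ((LINT x|lborel. \<bar>grad \<eta>0 x \<bullet> b\<bar>) / (1 / \<epsilon>) ^ DIM('a))"
        using \<epsilon> lborel_integral_scale[of "\<lambda>x. \<bar>grad \<eta>0 x \<bullet> b\<bar>" "1 / \<epsilon>"] by simp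
      finally have "\<epsilon> * (LINT x|lborel. \<bar>grad \<eta> x \<bullet> b\<bar>) = (LINT x|lborel. \<bar>grad \<eta>0 x \<bullet> b\<bar>) / m"
        using \<epsilon> m by (simp add: c_def power_one_over)
      also have "\<dots> \<le> C" unfolding C_def using that m
        by (intro divide_right_mono member_le_sum) auto
      finally show ?thesis .
    qed
    show "\<exists>\<eta> :: 'a \<Rightarrow> real. \<eta> \<in> C0_inf UNIV \<and> (\<forall>x. 0 \<le> \<eta> x) \<and> (\<forall>x. norm x \<ge> \<epsilon> \<longrightarrow> \<eta> x = 0)
        \<and> (LINT x|lborel. \<eta> x) = 1 \<and> (\<forall>b\<in>Basis. \<epsilon> * (LINT x|lborel. \<bar>grad \<eta> x \<bullet> b\<bar>) \<le> C)"
      using 1 2 3 4 5 by blast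
  qed
qed

lemma compact_thickening:
  fixes K U :: "'a::euclidean_space set"
  assumes "compact K" "open U" "K \<subseteq> U"
  obtains \<delta> K' where "0 < \<delta>" "compact K'" "K' \<subseteq> U" "\<And>x y. x \<in> K \<Longrightarrow> norm y \<le> \<delta> \<Longrightarrow> x + y \<in> K'"
proof -
  obtain \<delta> where \<delta>: "\<delta> > 0" "(\<Union>x\<in>K. cball x \<delta>) \<subseteq> U"
    using compact_subset_open_imp_cball_epsilon_subset[OF assms] by blast
  show thesis
  proof (rule that[of \<delta> "{x + y |x y. x \<in> K \<and> y \<in> cball 0 \<delta>}"])
    show "compact {x + y |x y. x \<in> K \<and> y \<in> cball 0 \<delta>}" using assms by (intro compact_sums) auto
    show "{x + y |x y. x \<in> K \<and> y \<in> cball 0 \<delta>} \<subseteq> U"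
    proof clarify
      fix x y assume "x \<in> K" "y \<in> cball (0::'a) \<delta>"
      then have "x + y \<in> cball x \<delta>" by (simp add: dist_norm)
      with \<delta> \<open>x \<in> K\<close> show "x + y \<in> U" by blast
    qed
  qed (use \<delta> in auto)
qed

section \<open>Weak and classical gradients\<close>

lemma partial_moments:
  fixes \<eta> :: "'a::euclidean_space \<Rightarrow> real"
  assumes \<eta>: "\<eta> \<in> C0_inf U" and b: "b \<in> Basis"
  shows "(LINT x|lborel. grad \<eta> x \<bullet> b) = 0"
    and "integrable lborel (\<lambda>x. (grad \<eta> x \<bullet> b) * (x \<bullet> D))"
    and "(LINT x|lborel. (grad \<eta> x \<bullet> b) * (x \<bullet> D)) = - (D \<bullet> b) * (LINT x|lborel. \<eta> x)"
proof -
  let ?S = "closure {x. \<eta> x \<noteq> 0}"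
  have S: "compact ?S" using \<eta> by (rule C0_inf_compact)
  have off: "\<eta> x = 0" "grad \<eta> x = 0" if "x \<notin> ?S" for x
    using that closure_subset[of "{x. \<eta> x \<noteq> 0}"] grad_eq_0_off_support[OF that] by auto
  show "(LINT x|lborel. grad \<eta> x \<bullet> b) = 0"
    using C0_inf_integrable[OF \<eta>] C0_inf_integrable[OF C0_inf_partial[OF \<eta> b]] C0_inf_differentiable[OF \<eta>]
    by (intro integral_partial_eq_0) auto
  show i: "integrable lborel (\<lambda>x. (grad \<eta> x \<bullet> b) * (x \<bullet> D))"
  proof (rule integrable_compact_support[OF S])
    show "continuous_on ?S (\<lambda>x. (grad \<eta> x \<bullet> b) * (x \<bullet> D))"
      by (intro continuous_intros C0_inf_continuous_grad[OF \<eta>])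
    show "(grad \<eta> x \<bullet> b) * (x \<bullet> D) = 0" if "x \<notin> ?S" for x
      unfolding off(2)[OF that] by simp
  qed
  have G: "GDERIV (\<lambda>x. \<eta> x * (x \<bullet> D)) x :> \<eta> x *\<^sub>R D + (x \<bullet> D) *\<^sub>R grad \<eta> x" for x
    by (intro GDERIV_mult C0_inf_GDERIV[OF \<eta>]) (auto simp: gderiv_def intro!: derivative_eq_intros)
  have gr: "grad (\<lambda>x. \<eta> x * (x \<bullet> D)) x \<bullet> b = \<eta> x * (D \<bullet> b) + (grad \<eta> x \<bullet> b) * (x \<bullet> D)" for x
    by (simp add: grad_eqI[OF G] inner_add_left)
  have "(LINT x|lborel. grad (\<lambda>x. \<eta> x * (x \<bullet> D)) x \<bullet> b) = 0"
  proof (rule integral_partial_eq_0)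
    show "(\<lambda>x. \<eta> x * (x \<bullet> D)) differentiable (at x)" for x using G by (rule GDERIV_imp_differentiable)
    show "integrable lborel (\<lambda>x. \<eta> x * (x \<bullet> D))"
    proof (rule integrable_compact_support[OF S])
      show "continuous_on ?S (\<lambda>x. \<eta> x * (x \<bullet> D))"
        by (intro continuous_intros C0_inf_continuous[OF \<eta>])
      show "\<eta> x * (x \<bullet> D) = 0" if "x \<notin> ?S" for x
        unfolding off(1)[OF that] by simp
    qed
    show "integrable lborel (\<lambda>x. grad (\<lambda>x. \<eta> x * (x \<bullet> D)) x \<bullet> b)"
      unfolding gr using i C0_inf_integrable[OF \<eta>] by simp
  qed
  then show "(LINT x|lborel. (grad \<eta> x \<bullet> b) * (x \<bullet> D)) = - (D \<bullet> b) * (LINT x|lborel. \<eta> x)"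
    unfolding gr using i C0_inf_integrable[OF \<eta>] by (simp add: eq_neg_iff_add_eq_0 algebra_simps)
qed

text \<open>
  Differentiating mollifications recovers the derivative at every point of classical
  differentiability: the first two moments of \<open>\<partial>\<^sub>b\<eta>\<close> are those of \<open>-\<partial>\<^sub>b\<delta>\<^sub>0\<close> and the error
  \<open>o(\<epsilon>)\<close> of the linear approximation is met by \<open>\<integral>\<bar>\<partial>\<^sub>b\<eta>\<bar> = O(1/\<epsilon>)\<close>.
\<close>

lemma conv_partial_limit:
  fixes f :: "'a::euclidean_space \<Rightarrow> real"
  assumes f: "integrable lborel f" and D: "GDERIV f x :> D" and b: "b \<in> Basis" and e: "0 < e"
  obtains d where "0 < d"
    "\<And>\<epsilon> \<eta>. 0 < \<epsilon> \<Longrightarrow> \<epsilon> < d \<Longrightarrow> \<eta> \<in> C0_inf UNIV \<Longrightarrow> (LINT y|lborel. \<eta> y) = 1 \<Longrightarrow> (\<And>y. norm y \<ge> \<epsilon> \<Longrightarrow> \<eta> y = 0)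
       \<Longrightarrow> \<epsilon> * (LINT y|lborel. \<bar>grad \<eta> y \<bullet> b\<bar>) \<le> C \<Longrightarrow> \<bar>conv (\<lambda>x. grad \<eta> x \<bullet> b) f x - D \<bullet> b\<bar> \<le> e"
proof -
  define e' where "e' = e / (\<bar>C\<bar> + 1)"
  have e': "0 < e'" "e' * C \<le> e"
  proof -
    show "0 < e'" using e by (simp add: e'_def add_nonneg_pos)
    have "e' * C \<le> e' * (\<bar>C\<bar> + 1)" using \<open>0 < e'\<close> by (intro mult_left_mono) auto
    also have "\<dots> = e" by (simp add: e'_def add_nonneg_eq_0_iff)
    finally show "e' * C \<le> e" .
  qed
  obtain d where d: "0 < d" "\<And>y. norm (y - x) < d \<Longrightarrow> norm (f y - f x - (y - x) \<bullet> D) \<le> e' * norm (y - x)"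
    using D e'(1) unfolding gderiv_def has_derivative_at_alt by blast
  show thesis
  proof (rule that[OF d(1)])
    fix \<epsilon> :: real and \<eta> :: "'a \<Rightarrow> real"
    assume \<epsilon>: "0 < \<epsilon>" "\<epsilon> < d" and \<eta>: "\<eta> \<in> C0_inf UNIV" "(LINT y|lborel. \<eta> y) = 1" "\<And>y. norm y \<ge> \<epsilon> \<Longrightarrow> \<eta> y = 0"
      and C: "\<epsilon> * (LINT y|lborel. \<bar>grad \<eta> y \<bullet> b\<bar>) \<le> C"
    define \<zeta> where "\<zeta> y = grad \<eta> y \<bullet> b" for y
    have \<zeta>: "\<zeta> \<in> C0_inf UNIV" unfolding \<zeta>_def by (rule C0_inf_partial[OF \<eta>(1) b])
    have \<zeta>0: "\<zeta> y = 0" if "norm y > \<epsilon>" for y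
    proof -
      have "grad \<eta> y = 0"
      proof (rule grad_eqI, rule GDERIV_eq_0_on_open[where S="{y. \<epsilon> < norm y}"])
        show "open {y::'a. \<epsilon> < norm y}" by (intro open_Collect_less continuous_intros)
      qed (use that \<eta>(3) in auto)
      then show ?thesis by (simp add: \<zeta>_def)
    qed
    have i\<zeta>: "integrable lborel \<zeta>" using \<zeta> by (rule C0_inf_integrable)
    have i1: "integrable lborel (\<lambda>y. \<zeta> y * f (x - y))" by (rule conv_integrand[OF \<zeta> f])
    have i2: "integrable lborel (\<lambda>y. \<zeta> y * (y \<bullet> D))" unfolding \<zeta>_def by (rule partial_moments[OF \<eta>(1) b])
    have "conv \<zeta> f x - D \<bullet> b = (LINT y|lborel. \<zeta> y * f (x - y)) - f x * (LINT y|lborel. \<zeta> y) + (LINT y|lborel. \<zeta> y * (y \<bullet> D))"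
      using partial_moments[OF \<eta>(1) b] \<eta>(2) by (simp add: conv_eq[OF \<zeta> f] \<zeta>_def)
    also have "\<dots> = (LINT y|lborel. \<zeta> y * f (x - y) - f x * \<zeta> y + \<zeta> y * (y \<bullet> D))"
      using i\<zeta> i1 i2 by simp
    also have "\<bar>\<dots>\<bar> \<le> (LINT y|lborel. e' * \<epsilon> * \<bar>\<zeta> y\<bar>)"
      unfolding real_norm_def[symmetric]
    proof (rule lebesgue_integral_norm_le)
      show "integrable lborel (\<lambda>y. e' * \<epsilon> * norm (\<zeta> y))" using i\<zeta> by simp
      fix y
      have "norm (\<zeta> y * f (x - y) - f x * \<zeta> y + \<zeta> y * (y \<bullet> D)) = \<bar>\<zeta> y\<bar> * \<bar>f (x - y) - f x - (x - y - x) \<bullet> D\<bar>"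
        unfolding abs_mult[symmetric] real_norm_def by (simp add: algebra_simps)
      also have "\<dots> \<le> \<bar>\<zeta> y\<bar> * (e' * \<epsilon>)"
      proof (cases "norm y > \<epsilon>")
        case False
        have "\<bar>f (x - y) - f x - (x - y - x) \<bullet> D\<bar> \<le> e' * norm y"
          using d(2)[of "x - y"] False \<epsilon> by simp
        also have "\<dots> \<le> e' * \<epsilon>" using False e' by (intro mult_left_mono) auto
        finally show ?thesis by (intro mult_left_mono) auto
      qed (simp add: \<zeta>0)
      finally show "norm (\<zeta> y * f (x - y) - f x * \<zeta> y + \<zeta> y * (y \<bullet> D)) \<le> e' * \<epsilon> * norm (\<zeta> y)"
        by (simp add: mult.commute)
    qed
    also have "\<dots> = e' * (\<epsilon> * (LINT y|lborel. \<bar>\<zeta> y\<bar>))" by simp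
    also have "\<dots> \<le> e' * C" using C e' by (intro mult_left_mono) (auto simp: \<zeta>_def)
    also have "\<dots> \<le> e" by (rule e')
    finally show "\<bar>conv (\<lambda>x. grad \<eta> x \<bullet> b) f x - D \<bullet> b\<bar> \<le> e" unfolding \<zeta>_def[abs_def] .
  qed
qed

text \<open>
  Mollify \<open>u\<close>. Its mollified derivatives tend to the classical gradient at every point, by
  \<open>conv_partial_limit\<close>; testing the weak gradient \<open>g\<close> with translated mollifiers shows that they are also the
  mollifications of \<open>g\<close>, which tend to \<open>g\<close> in \<open>L\<^sup>1\<close> and thus almost everywhere along a subsequence.
\<close>

lemma weak_gradient_eq_grad_local:
  fixes u :: "'a::euclidean_space \<Rightarrow> real"
  assumes U: "open U" and u: "\<And>x. x \<in> U \<Longrightarrow> u differentiable (at x)" and wg: "weak_gradient U u g"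
    and K: "compact K" "K \<subseteq> U" and b: "b \<in> Basis"
  shows "AE x in lborel. x \<in> K \<longrightarrow> g x \<bullet> b = grad u x \<bullet> b"
proof -
  obtain \<delta> K' where \<delta>: "0 < \<delta>" and K': "compact K'" "K' \<subseteq> U" "\<And>x y. x \<in> K \<Longrightarrow> norm y \<le> \<delta> \<Longrightarrow> x + y \<in> K'"
    using compact_thickening[OF K(1) U K(2)] by metis
  have [measurable]: "K' \<in> sets borel" "U \<in> sets borel" using K' U by (auto intro: borel_compact)
  have K'l: "K' \<in> sets lebesgue" by simp
  define G where "G x = indicator K' x *\<^sub>R g x" for x
  have Gm: "G \<in> borel_measurable lebesgue"
  proof -
    have "g \<in> borel_measurable (lebesgue_on U)" using wg by (auto simp: weak_gradient_def Lp_loc_def)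
    then have "(\<lambda>x. indicator U x *\<^sub>R g x) \<in> borel_measurable lebesgue"
      by (subst (asm) borel_measurable_restrict_space_iff) auto
    then have "(\<lambda>x. indicator K' x *\<^sub>R (indicator U x *\<^sub>R g x)) \<in> borel_measurable lebesgue"
      by (rule borel_measurable_scaleR[OF borel_measurable_indicator[OF K'l]])
    also have "(\<lambda>x. indicator K' x *\<^sub>R (indicator U x *\<^sub>R g x)) = G"
      using K'(2) by (auto simp: G_def indicator_def fun_eq_iff)
    finally show ?thesis .
  qed
  have iG: "integrable lebesgue G"
  proof (rule Bochner_Integration.integrable_bound[OF _ Gm])
    have "g \<in> Lp_loc 1 U" using wg by (simp add: weak_gradient_def)
    then show "integrable lebesgue (\<lambda>x. indicator K' x *\<^sub>R norm (g x) powr 1)"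
      using K' by (simp add: Lp_loc_def set_integrable_def)
  qed (auto simp: G_def)
  \<comment> \<open>Tonelli's theorem asks for a Borel measurable version \<open>h\<close> of the component of \<open>g\<close>.\<close>
  obtain h where h[measurable]: "h \<in> borel_measurable borel" and Gh: "AE x in lborel. G x \<bullet> b = h x"
  proof -
    have "(\<lambda>x. G x \<bullet> b) \<in> borel_measurable lebesgue" using Gm by (intro borel_measurable_inner) auto
    from completion_ex_borel_measurable_real[OF this] that show thesis by auto
  qed
  have Gh': "AE x in lebesgue. G x \<bullet> b = h x" using Gh by (rule AE_completion)
  have hl: "h \<in> borel_measurable lebesgue" using h by (simp add: measurable_completion)
  have ih: "integrable lborel h"
  proof -
    have "integrable lebesgue (\<lambda>x. G x \<bullet> b)" using iG by (rule integrable_inner_left)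
    then have "integrable lebesgue h"
      by (rule integrable_cong_AE_imp[OF _ hl]) (use Gh' in \<open>auto elim: AE_mp\<close>)
    then show ?thesis by (simp add: integrable_completion)
  qed
  define v where "v x = indicator K' x *\<^sub>R u x" for x
  have "continuous_on K' u"
    using u K'(2) by (meson differentiable_imp_continuous_on differentiable_on_def differentiable_at_withinI subsetD)
  then have iv: "integrable lborel v"
    unfolding v_def by (rule borel_integrable_compact[OF K'(1)])
  have Dv: "GDERIV v x :> grad u x" if "x \<in> K" for x
  proof (rule GDERIV_transform_open[where S="ball x \<delta>"])
    show "GDERIV u x :> grad u x" using K that by (intro GDERIV_grad u) auto
    fix y assume "y \<in> ball x \<delta>"
    then have "y \<in> K'" using K'(3)[OF that, of "y - x"] by (simp add: dist_norm norm_minus_commute)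
    then show "u y = v y" by (simp add: v_def)
  qed (use \<delta> in auto)
  \<comment> \<open>Testing with the translated mollifier turns the weak gradient into a convolution.\<close>
  have weak: "conv (\<lambda>x. grad \<eta> x \<bullet> b) v x = conv \<eta> h x"
    if x: "x \<in> K" and \<eta>: "\<eta> \<in> C0_inf UNIV" "\<And>y. norm y \<ge> \<delta> \<Longrightarrow> \<eta> y = 0" for x \<eta>
  proof -
    have supp: "closure {y. \<eta> y \<noteq> 0} \<subseteq> cball 0 \<delta>"
      by (rule closure_minimal) (use \<eta>(2) in \<open>force simp: not_le[symmetric]\<close>)+
    have inK: "y \<in> K'" if "x - y \<in> closure {y. \<eta> y \<noteq> 0}" for y
    proof -
      have "norm (y - x) \<le> \<delta>" using that supp by (auto simp: norm_minus_commute)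
      then show ?thesis using K'(3)[OF x, of "y - x"] by simp
    qed
    have off: "\<eta> (x - y) = 0" "grad \<eta> (x - y) = 0" if "y \<notin> K'" for y
      using that inK[of y] closure_subset[of "{y. \<eta> y \<noteq> 0}"] grad_eq_0_off_support[of "x - y" \<eta>] by auto
    define \<chi>' where "\<chi>' y = 1 * \<eta> (x + (-1) *\<^sub>R y)" for y
    have "\<chi>' \<in> C0_inf U" unfolding \<chi>'_def
      using inK K'(2) by (intro C0_inf_affine[OF \<eta>(1)]) auto
    then have W: "(LINT y:U|lebesgue. u y *\<^sub>R grad \<chi>' y) = - (LINT y:U|lebesgue. \<chi>' y *\<^sub>R g y)"
      using wg by (simp add: weak_gradient_def)
    have grad': "grad \<chi>' y = - grad \<eta> (x - y)" for y
      unfolding \<chi>'_def grad_affine[OF \<eta>(1)] by simp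
    have [measurable]: "v \<in> borel_measurable borel" "grad \<eta> \<in> borel_measurable borel" "\<eta> \<in> borel_measurable borel"
      using borel_measurable_integrable[OF iv] C0_inf_grad_measurable[OF \<eta>(1)] C0_inf_measurable[OF \<eta>(1)] by auto
    have "(LINT y:U|lebesgue. u y *\<^sub>R grad \<chi>' y) = (LINT y|lebesgue. - (v y *\<^sub>R grad \<eta> (x - y)))"
      unfolding set_lebesgue_integral_def grad'
      by (rule Bochner_Integration.integral_cong) (use off K'(2) in \<open>auto simp: v_def indicator_def\<close>)
    also have "\<dots> = (LINT y|lborel. - (v y *\<^sub>R grad \<eta> (x - y)))"
      by (rule integral_completion) measurable
    also have "\<dots> = - grad (conv \<eta> v) x"
      by (simp add: grad_eqI[OF conv_GDERIV[OF \<eta>(1) iv]])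
    finally have L: "(LINT y:U|lebesgue. u y *\<^sub>R grad \<chi>' y) \<bullet> b = - conv (\<lambda>x. grad \<eta> x \<bullet> b) v x"
      by (simp add: grad_conv[OF \<eta>(1) iv b])
    obtain M where M: "\<And>y. \<bar>\<eta> y\<bar> \<le> M" using C0_inf_bounded[OF \<eta>(1)] by metis
    have \<eta>l: "(\<lambda>y. \<eta> (x - y)) \<in> borel_measurable lebesgue"
      by (rule measurable_completion) measurable
    have iG': "integrable lebesgue (\<lambda>y. \<eta> (x - y) *\<^sub>R G y)"
    proof (rule Bochner_Integration.integrable_bound)
      show "integrable lebesgue (\<lambda>y. M *\<^sub>R G y)" using iG by simp
      show "(\<lambda>y. \<eta> (x - y) *\<^sub>R G y) \<in> borel_measurable lebesgue"
        using \<eta>l Gm by (rule borel_measurable_scaleR)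
      show "AE y in lebesgue. norm (\<eta> (x - y) *\<^sub>R G y) \<le> norm (M *\<^sub>R G y)"
        using M by (intro AE_I2) (simp add: mult_right_mono order_trans[OF _ abs_ge_self])
    qed
    have "(LINT y:U|lebesgue. \<chi>' y *\<^sub>R g y) = (LINT y|lebesgue. \<eta> (x - y) *\<^sub>R G y)"
      unfolding set_lebesgue_integral_def
      by (rule Bochner_Integration.integral_cong) (use off K'(2) in \<open>auto simp: G_def indicator_def \<chi>'_def\<close>)
    then have "(LINT y:U|lebesgue. \<chi>' y *\<^sub>R g y) \<bullet> b = (LINT y|lebesgue. (\<eta> (x - y) *\<^sub>R G y) \<bullet> b)"
      using iG' by (simp only: integral_inner_left)
    also have "\<dots> = (LINT y|lebesgue. \<eta> (x - y) * h y)"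
    proof (rule integral_cong_AE)
      show "(\<lambda>y. (\<eta> (x - y) *\<^sub>R G y) \<bullet> b) \<in> borel_measurable lebesgue"
        using borel_measurable_integrable[OF iG'] by (intro borel_measurable_inner) auto
      show "(\<lambda>y. \<eta> (x - y) * h y) \<in> borel_measurable lebesgue"
        using \<eta>l hl by (rule borel_measurable_times)
      show "AE y in lebesgue. (\<eta> (x - y) *\<^sub>R G y) \<bullet> b = \<eta> (x - y) * h y"
        using Gh' by eventually_elim simp
    qed
    also have "\<dots> = conv \<eta> h x" unfolding conv_def by (rule integral_completion) measurable
    finally show ?thesis using L W by simp
  qed
  obtain C where C: "\<And>\<epsilon>. 0 < \<epsilon> \<Longrightarrow> \<exists>\<eta> :: 'a \<Rightarrow> real. \<eta> \<in> C0_inf UNIV \<and> (\<forall>x. 0 \<le> \<eta> x) \<and> (\<forall>x. norm x \<ge> \<epsilon> \<longrightarrow> \<eta> x = 0)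
        \<and> (LINT x|lborel. \<eta> x) = 1 \<and> (\<forall>b\<in>Basis. \<epsilon> * (LINT x|lborel. \<bar>grad \<eta> x \<bullet> b\<bar>) \<le> C)"
    using mollifiers_exist by metis
  define P where "P n \<epsilon> \<eta> \<longleftrightarrow> 0 < \<epsilon> \<and> \<epsilon> \<le> \<delta> / real (Suc n) \<and> \<eta> \<in> C0_inf UNIV \<and> (\<forall>x. norm x \<ge> \<epsilon> \<longrightarrow> \<eta> x = 0)
        \<and> (LINT x|lborel. \<eta> x) = 1 \<and> \<epsilon> * (LINT x|lborel. \<bar>grad \<eta> x \<bullet> b\<bar>) \<le> C
        \<and> (\<integral>\<^sup>+x. ennreal \<bar>conv \<eta> h x - h x\<bar> \<partial>lborel) \<le> ennreal (1 / real (Suc n))" for n \<epsilon> \<eta>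
  have ex: "\<exists>\<epsilon> \<eta>. P n \<epsilon> \<eta>" for n
  proof -
    have "(\<integral>\<^sup>+x. ennreal (\<bar>h x\<bar> powr 1) \<partial>lborel) < \<infinity>" using ih by (simp add: integrable_iff_bounded)
    then obtain d where d: "0 < d"
      "\<And>y. norm y < d \<Longrightarrow> (\<integral>\<^sup>+x. ennreal (\<bar>h (x + y) - h x\<bar> powr 1) \<partial>lborel) \<le> ennreal (1 / real (Suc n))"
      using Lp_translation_continuous[of 1 h "1 / real (Suc n)"] h by auto
    define \<epsilon> where "\<epsilon> = min d (\<delta> / real (Suc n))"
    have \<epsilon>: "0 < \<epsilon>" using d \<delta> by (simp add: \<epsilon>_def)
    from C[OF \<epsilon>] obtain \<eta> :: "'a \<Rightarrow> real" where \<eta>: "\<eta> \<in> C0_inf UNIV" "\<And>x. 0 \<le> \<eta> x" "\<And>x. norm x \<ge> \<epsilon> \<Longrightarrow> \<eta> x = 0"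
        "(LINT x|lborel. \<eta> x) = 1" "\<And>b. b \<in> Basis \<Longrightarrow> \<epsilon> * (LINT x|lborel. \<bar>grad \<eta> x \<bullet> b\<bar>) \<le> C" by blast
    have "(\<integral>\<^sup>+x. ennreal \<bar>1\<bar> * ennreal \<bar>conv \<eta> h x - h x\<bar> \<partial>lborel) \<le> ennreal (1 / real (Suc n))"
    proof (rule conv_close[OF \<eta>(1,2,4,3) ih])
      fix y :: 'a assume "norm y < \<epsilon>"
      then show "(\<integral>\<^sup>+x. ennreal \<bar>1\<bar> * ennreal \<bar>h (x + y) - h x\<bar> \<partial>lborel) \<le> ennreal (1 / real (Suc n))"
        using d(2)[of y] by (simp add: \<epsilon>_def)
    qed (assumption, rule borel_measurable_const)
    then show ?thesis using \<epsilon> \<eta> b by (intro exI[of _ \<epsilon>] exI[of _ \<eta>]) (simp add: P_def \<epsilon>_def)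
  qed
  define \<epsilon> where "\<epsilon> n = (SOME \<epsilon>. \<exists>\<eta>. P n \<epsilon> \<eta>)" for n
  define \<eta> where "\<eta> n = (SOME \<eta>. P n (\<epsilon> n) \<eta>)" for n
  have "\<exists>\<eta>. P n (\<epsilon> n) \<eta>" for n unfolding \<epsilon>_def by (rule someI_ex[OF ex])
  then have "P n (\<epsilon> n) (\<eta> n)" for n unfolding \<eta>_def by (rule someI_ex)
  note Pn = this[unfolded P_def]
  have \<epsilon>: "\<And>n. 0 < \<epsilon> n" "\<And>n. \<epsilon> n \<le> \<delta> / real (Suc n)" using Pn by blast+
  have \<eta>: "\<And>n. \<eta> n \<in> C0_inf UNIV" "\<And>n x. norm x \<ge> \<epsilon> n \<Longrightarrow> \<eta> n x = 0" "\<And>n. (LINT x|lborel. \<eta> n x) = 1"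
      "\<And>n. \<epsilon> n * (LINT x|lborel. \<bar>grad (\<eta> n) x \<bullet> b\<bar>) \<le> C"
      "\<And>n. (\<integral>\<^sup>+x. ennreal \<bar>conv (\<eta> n) h x - h x\<bar> \<partial>lborel) \<le> ennreal (1 / real (Suc n))"
    using Pn by blast+
  have \<epsilon>0: "\<epsilon> \<longlonglongrightarrow> 0"
  proof (rule tendsto_sandwich[OF _ _ tendsto_const])
    show "(\<lambda>n. \<delta> / real (Suc n)) \<longlonglongrightarrow> 0"
      using tendsto_mult_right_zero[OF LIMSEQ_inverse_real_of_nat, of \<delta>] by (simp add: divide_inverse)
  qed (use \<epsilon> in \<open>auto intro!: always_eventually less_imp_le\<close>)
  have cm[measurable]: "conv (\<eta> n) h \<in> borel_measurable borel" for n
    using GDERIV_imp_differentiable[OF conv_GDERIV[OF \<eta>(1) ih]]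
    by (intro borel_measurable_continuous_onI differentiable_imp_continuous_on)
       (auto simp: differentiable_on_def differentiable_at_withinI)
  have ic: "integrable lborel (\<lambda>x. conv (\<eta> n) h x - h x)" for n
    using le_less_trans[OF \<eta>(5)[of n], of \<infinity>] by (intro integrableI_bounded) auto
  have "(\<lambda>n. LINT x|lborel. norm (conv (\<eta> n) h x - h x)) \<longlonglongrightarrow> 0"
  proof (rule tendsto_sandwich[OF _ _ tendsto_const])
    have "ennreal (LINT x|lborel. norm (conv (\<eta> n) h x - h x)) \<le> ennreal (1 / real (Suc n))" for n
      using \<eta>(5)[of n] nn_integral_eq_integral[OF integrable_norm[OF ic[of n]]] by simp
    then show "\<forall>\<^sub>F n in sequentially. (LINT x|lborel. norm (conv (\<eta> n) h x - h x)) \<le> 1 / real (Suc n)"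
      by (intro always_eventually allI) (simp add: ennreal_le_iff)
    show "(\<lambda>n. 1 / real (Suc n)) \<longlonglongrightarrow> 0" using LIMSEQ_inverse_real_of_nat by (simp add: divide_inverse)
  qed (auto intro!: always_eventually)
  then obtain r :: "nat \<Rightarrow> nat" where r: "strict_mono r" "AE x in lborel. (\<lambda>n. conv (\<eta> (r n)) h x - h x) \<longlonglongrightarrow> 0"
    using tendsto_L1_AE_subseq[of lborel "\<lambda>n x. conv (\<eta> n) h x - h x", OF ic] by blast
  show ?thesis
    using r(2) Gh
  proof (eventually_elim, intro impI)
    fix x assume lim: "(\<lambda>n. conv (\<eta> (r n)) h x - h x) \<longlonglongrightarrow> 0" and Gx: "G x \<bullet> b = h x" and x: "x \<in> K"
    have "(\<lambda>n. conv (\<lambda>x. grad (\<eta> n) x \<bullet> b) v x) \<longlonglongrightarrow> grad u x \<bullet> b"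
    proof (rule LIMSEQ_I)
      fix e :: real assume e: "0 < e"
      obtain d where d: "0 < d"
        "\<And>\<epsilon> \<eta>. 0 < \<epsilon> \<Longrightarrow> \<epsilon> < d \<Longrightarrow> \<eta> \<in> C0_inf UNIV \<Longrightarrow> (LINT y|lborel. \<eta> y) = 1 \<Longrightarrow> (\<And>y. norm y \<ge> \<epsilon> \<Longrightarrow> \<eta> y = 0)
           \<Longrightarrow> \<epsilon> * (LINT y|lborel. \<bar>grad \<eta> y \<bullet> b\<bar>) \<le> C \<Longrightarrow> \<bar>conv (\<lambda>x. grad \<eta> x \<bullet> b) v x - grad u x \<bullet> b\<bar> \<le> e / 2"
        using conv_partial_limit[OF iv Dv[OF x] b, of "e / 2" C] e by auto
      obtain N where N: "\<And>n. n \<ge> N \<Longrightarrow> \<epsilon> n < d"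
        using order_tendstoD(2)[OF \<epsilon>0 d(1)] by (auto simp: eventually_sequentially)
      show "\<exists>no. \<forall>n\<ge>no. norm (conv (\<lambda>x. grad (\<eta> n) x \<bullet> b) v x - grad u x \<bullet> b) < e"
      proof (intro exI[of _ N] allI impI)
        fix n assume "N \<le> n"
        then have "\<bar>conv (\<lambda>x. grad (\<eta> n) x \<bullet> b) v x - grad u x \<bullet> b\<bar> \<le> e / 2"
          by (intro d(2)[OF \<epsilon>(1) N \<eta>(1) \<eta>(3) \<eta>(2) \<eta>(4)])
        then show "norm (conv (\<lambda>x. grad (\<eta> n) x \<bullet> b) v x - grad u x \<bullet> b) < e" using e by simp
      qed
    qed
    moreover have "conv (\<lambda>x. grad (\<eta> n) x \<bullet> b) v x = conv (\<eta> n) h x" for n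
    proof (rule weak[OF x \<eta>(1)])
      fix y :: 'a assume "\<delta> \<le> norm y"
      moreover have "\<delta> / real (Suc n) \<le> \<delta>" using \<delta> by (simp add: divide_le_eq mult_le_cancel_left1)
      then have "\<epsilon> n \<le> \<delta>" using \<epsilon>(2)[of n] by linarith
      ultimately show "\<eta> n y = 0" using \<eta>(2)[of n y] by simp
    qed
    ultimately have "(\<lambda>n. conv (\<eta> n) h x) \<longlonglongrightarrow> grad u x \<bullet> b" by simp
    then have "(\<lambda>n. conv (\<eta> (r n)) h x) \<longlonglongrightarrow> grad u x \<bullet> b"
      using LIMSEQ_subseq_LIMSEQ[OF _ r(1), unfolded comp_def] by blast
    moreover have "(\<lambda>n. conv (\<eta> (r n)) h x) \<longlonglongrightarrow> h x" using lim by (rule LIM_zero_cancel)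
    ultimately have "h x = grad u x \<bullet> b" by (rule LIMSEQ_unique[rotated])
    moreover have "x \<in> K'" using K'(3)[OF x, of 0] \<delta> by simp
    ultimately show "g x \<bullet> b = grad u x \<bullet> b" using Gx by (simp add: G_def)
  qed
qed

text \<open>
  The local statement for all coordinates on a compact exhaustion. In particular the classical
  gradient is locally integrable, which pointwise differentiability alone does not give.
\<close>

lemma weak_gradient_eq_grad:
  fixes u :: "'a::euclidean_space \<Rightarrow> real"
  assumes U: "open U" and u: "\<And>x. x \<in> U \<Longrightarrow> u differentiable (at x)" and wg: "weak_gradient U u g"
  shows "AE x in lebesgue. x \<in> U \<longrightarrow> g x = grad u x"
proof -
  have "\<exists>C :: nat \<Rightarrow> 'a set. (\<forall>n. compact (C n) \<and> C n \<subseteq> U) \<and> \<Union>(range C) = U"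
  proof (rule open_Union_compact_subsets[OF U])
    fix C :: "nat \<Rightarrow> 'a set"
    assume "\<And>n. compact (C n)" "\<And>n. C n \<subseteq> U" "\<Union>(range C) = U"
    then show ?thesis by (intro exI[of _ C]) simp
  qed
  then obtain C :: "nat \<Rightarrow> 'a set" where C0: "(\<forall>n. compact (C n) \<and> C n \<subseteq> U) \<and> \<Union>(range C) = U"
    by (rule exE)
  then have C: "\<And>n. compact (C n)" "\<And>n. C n \<subseteq> U" "\<Union>(range C) = U" by simp_all
  have "AE x in lborel. x \<in> C n \<longrightarrow> g x \<bullet> b = grad u x \<bullet> b" if "b \<in> Basis" for n b
    by (rule weak_gradient_eq_grad_local[OF U u wg C(1,2) that])
  then have "AE x in lborel. \<forall>b\<in>Basis. x \<in> C n \<longrightarrow> g x \<bullet> b = grad u x \<bullet> b" for n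
    by (rule AE_finite_allI[OF finite_Basis])
  then have "AE x in lborel. \<forall>n. \<forall>b\<in>Basis. x \<in> C n \<longrightarrow> g x \<bullet> b = grad u x \<bullet> b"
    by (subst AE_all_countable) (rule allI)
  then have "AE x in lebesgue. \<forall>n. \<forall>b\<in>Basis. x \<in> C n \<longrightarrow> g x \<bullet> b = grad u x \<bullet> b" by (rule AE_completion)
  then show ?thesis
  proof eventually_elim
    case (elim x)
    show ?case
    proof
      assume "x \<in> U"
      then obtain n where "x \<in> C n" using C(3) by blast
      with elim have "\<And>b. b \<in> Basis \<Longrightarrow> g x \<bullet> b = grad u x \<bullet> b" by blast
      then show "g x = grad u x" by (rule euclidean_eqI)
    qed
  qed
qed

section \<open>Extending the class of test functions\<close>

lemma integrable_powr_pairing: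
  fixes F f \<alpha> :: "'a::euclidean_space \<Rightarrow> real"
  assumes p: "1 < p" and [measurable]: "F \<in> borel_measurable borel" "f \<in> borel_measurable borel"
    and \<alpha>: "\<And>x. 0 \<le> \<alpha> x" "integrable lborel (\<lambda>x. \<alpha> x powr p)" and F: "\<And>x. \<bar>F x\<bar> \<le> \<alpha> x powr (p - 1)"
    and f: "integrable lborel (\<lambda>x. \<bar>f x\<bar> powr p)"
  shows "integrable lborel (\<lambda>x. F x * f x)"
proof (rule Bochner_Integration.integrable_bound)
  show "integrable lborel (\<lambda>x. \<bar>f x\<bar> powr p + (p - 1) * \<alpha> x powr p)" using \<alpha> f by simp
  show "(\<lambda>x. F x * f x) \<in> borel_measurable lborel" by measurable
  show "AE x in lborel. norm (F x * f x) \<le> norm (\<bar>f x\<bar> powr p + (p - 1) * \<alpha> x powr p)"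
  proof (rule AE_I2)
    fix x
    have "norm (F x * f x) \<le> \<alpha> x powr (p - 1) * \<bar>f x\<bar>" using F by (simp add: abs_mult mult_right_mono)
    also have "\<dots> \<le> p * (\<alpha> x powr (p - 1) * \<bar>f x\<bar>)"
      using p by (simp add: mult_le_cancel_right1 mult_less_0_iff)
    also have "\<dots> \<le> \<bar>f x\<bar> powr p + (p - 1) * \<alpha> x powr p"
      using young_tangent(1)[OF p abs_ge_zero \<alpha>(1), of "f x" x] by (simp add: mult_ac)
    finally show "norm (F x * f x) \<le> norm (\<bar>f x\<bar> powr p + (p - 1) * \<alpha> x powr p)" by simp
  qed
qed

text \<open>
  A mollification of \<open>\<phi>\<close> is an admissible smooth test function. It is uniformly close to \<open>\<phi>\<close>, which
  settles the zeroth order term, and its gradient is the mollified gradient of \<open>\<phi>\<close>, whose pairing with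
  \<open>F\<close> is close to that of the gradient itself.
\<close>

lemma test_function_extension:
  fixes F :: "'a::euclidean_space \<Rightarrow> 'a" and \<alpha> c \<phi> :: "'a \<Rightarrow> real"
  assumes p: "1 < p" and U: "open U" and S: "compact S" "S \<subseteq> U"
    and F[measurable]: "F \<in> borel_measurable borel" and \<alpha>m[measurable]: "\<alpha> \<in> borel_measurable borel"
    and \<alpha>: "\<And>x. 0 \<le> \<alpha> x" "\<And>K. compact K \<Longrightarrow> K \<subseteq> U \<Longrightarrow> integrable lborel (\<lambda>x. indicator K x * \<alpha> x powr p)"
    and F\<alpha>: "\<And>x. norm (F x) \<le> \<alpha> x powr (p - 1)"
    and c: "\<And>K. compact K \<Longrightarrow> K \<subseteq> U \<Longrightarrow> integrable lebesgue (\<lambda>x. indicator K x * c x)"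
    and test: "\<And>\<chi>'. \<chi>' \<in> C0_inf U \<Longrightarrow> (\<And>x. 0 \<le> \<chi>' x) \<Longrightarrow> 0 \<le> (LINT x:U|lebesgue. F x \<bullet> grad \<chi>' x + c x * \<chi>' x)"
    and \<phi>: "\<And>x. \<phi> differentiable (at x)" "\<And>x. 0 \<le> \<phi> x" "\<And>x. x \<notin> S \<Longrightarrow> \<phi> x = 0"
      "integrable lborel (\<lambda>x. norm (grad \<phi> x) powr p)"
  shows "integrable lborel (\<lambda>x. F x \<bullet> grad \<phi> x)" and "integrable lebesgue (\<lambda>x. c x * \<phi> x)"
    and "0 \<le> (LINT x|lborel. F x \<bullet> grad \<phi> x) + (LINT x|lebesgue. c x * \<phi> x)"
proof -
  obtain \<delta> K where \<delta>: "0 < \<delta>" and K: "compact K" "K \<subseteq> U" "\<And>x y. x \<in> S \<Longrightarrow> norm y \<le> \<delta> \<Longrightarrow> x + y \<in> K"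
    using compact_thickening[OF S(1) U S(2)] by metis
  have SK: "x \<in> K" if "x \<in> S" for x using K(3)[OF that, of 0] \<delta> by simp
  have [measurable]: "K \<in> sets borel" "U \<in> sets borel" "S \<in> sets borel" using K U S by (auto intro: borel_compact)
  have \<phi>c: "continuous_on A \<phi>" for A
    using \<phi>(1) by (meson differentiable_imp_continuous_on differentiable_on_def differentiable_at_withinI)
  have i\<phi>: "integrable lborel \<phi>" by (rule integrable_compact_support[OF S(1) \<phi>c \<phi>(3)])
  have \<phi>g: "grad \<phi> x = 0" if "x \<notin> S" for x
    by (rule grad_eqI, rule GDERIV_eq_0_on_open[where S="- S"])
       (use that \<phi>(3) S(1) compact_imp_closed in auto)
  have gm[measurable]: "grad \<phi> \<in> borel_measurable borel"
    using borel_measurable_grad[of UNIV \<phi>] \<phi>(1) by simp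
  define \<beta> where "\<beta> x = indicator K x * \<alpha> x" for x
  have \<beta>[measurable]: "\<beta> \<in> borel_measurable borel" unfolding \<beta>_def by measurable
  have \<beta>0: "0 \<le> \<beta> x" for x using \<alpha>(1) by (simp add: \<beta>_def indicator_def)
  have i\<beta>: "integrable lborel (\<lambda>x. \<beta> x powr p)"
  proof -
    have "(\<lambda>x. \<beta> x powr p) = (\<lambda>x. indicator K x * \<alpha> x powr p)" by (auto simp: \<beta>_def indicator_def)
    then show ?thesis using \<alpha>(2)[OF K(1,2)] by simp
  qed
  define Fb where "Fb b x = indicator K x * (F x \<bullet> b)" for b x
  have Fbm[measurable]: "Fb b \<in> borel_measurable borel" for b unfolding Fb_def by measurable
  have Fb: "\<bar>Fb b x\<bar> \<le> \<beta> x powr (p - 1)" if "b \<in> Basis" for b x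
    using Basis_le_norm[OF that, of "F x"] F\<alpha>[of x] by (auto simp: Fb_def \<beta>_def indicator_def)
  define \<phi>b where "\<phi>b b x = grad \<phi> x \<bullet> b" for b x
  have \<phi>bm[measurable]: "\<phi>b b \<in> borel_measurable borel" for b unfolding \<phi>b_def by measurable
  have i\<phi>bp: "integrable lborel (\<lambda>x. \<bar>\<phi>b b x\<bar> powr p)" if "b \<in> Basis" for b
  proof (rule Bochner_Integration.integrable_bound[OF \<phi>(4)])
    show "AE x in lborel. norm (\<bar>\<phi>b b x\<bar> powr p) \<le> norm (norm (grad \<phi> x) powr p)"
      using p Basis_le_norm[OF that] by (intro AE_I2) (auto simp: \<phi>b_def intro!: powr_mono2)
  qed measurable
  have S_fin: "integrable lborel (indicator S :: 'a \<Rightarrow> real)"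
    using emeasure_compact_finite[OF S(1)] by simp
  have K_fin: "integrable lborel (indicator K :: 'a \<Rightarrow> real)"
    using emeasure_compact_finite[OF K(1)] by simp
  have le_powr: "t \<le> 1 + t powr q" if "0 \<le> t" "1 \<le> q" for t q :: real
  proof (cases "t \<le> 1")
    case False
    then have "t powr 1 \<le> t powr q" using that by (intro powr_mono) auto
    then show ?thesis using False by simp
  qed (simp add: add_increasing2)
  have i\<phi>b: "integrable lborel (\<phi>b b)" if "b \<in> Basis" for b
  proof (rule Bochner_Integration.integrable_bound)
    show "integrable lborel (\<lambda>x. indicator S x + \<bar>\<phi>b b x\<bar> powr p)"
      using S_fin i\<phi>bp[OF that] by (rule Bochner_Integration.integrable_add)
    show "AE x in lborel. norm (\<phi>b b x) \<le> norm (indicator S x + \<bar>\<phi>b b x\<bar> powr p)"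
    proof (rule AE_I2)
      fix x show "norm (\<phi>b b x) \<le> norm (indicator S x + \<bar>\<phi>b b x\<bar> powr p)"
        using le_powr[of "\<bar>\<phi>b b x\<bar>" p] p \<phi>g[of x] by (cases "x \<in> S") (auto simp: \<phi>b_def)
    qed
  qed measurable
  have iFb: "integrable lborel (Fb b)" if "b \<in> Basis" for b
  proof (rule Bochner_Integration.integrable_bound)
    show "integrable lborel (\<lambda>x. indicator K x + (\<beta> x powr p))"
      using K_fin i\<beta> by (rule Bochner_Integration.integrable_add)
    show "AE x in lborel. norm (Fb b x) \<le> norm (indicator K x + (\<beta> x powr p))"
    proof (rule AE_I2)
      fix x
      have "\<beta> x powr (p - 1) \<le> 1 + \<beta> x powr p"
      proof (cases "\<beta> x \<le> 1")
        case True then have "\<beta> x powr (p - 1) \<le> 1 powr (p - 1)" using p \<beta>0 by (intro powr_mono2) auto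
        then show ?thesis using powr_ge_zero[of "\<beta> x" p] by (simp del: powr_ge_zero)
      next
        case False then have "\<beta> x powr (p - 1) \<le> \<beta> x powr p" by (intro powr_mono) auto
        then show ?thesis by simp
      qed
      moreover have "Fb b x = 0" if "x \<notin> K" using that by (simp add: Fb_def)
      ultimately show "norm (Fb b x) \<le> norm (indicator K x + (\<beta> x powr p))"
        using Fb[OF that, of x] by (cases "x \<in> K") auto
    qed
  qed measurable
  have iF\<phi>: "integrable lborel (\<lambda>x. Fb b x * \<phi>b b x)" if "b \<in> Basis" for b
    by (rule integrable_powr_pairing[OF p _ _ \<beta>0 i\<beta> Fb[OF that] i\<phi>bp[OF that]]) measurable
  have split: "F x \<bullet> g = (\<Sum>b\<in>Basis. Fb b x * (g \<bullet> b))" if "x \<notin> K \<Longrightarrow> g = 0" for x g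
    using that by (cases "x \<in> K") (auto simp: Fb_def euclidean_inner[of "F x" g])
  have split\<phi>: "F x \<bullet> grad \<phi> x = (\<Sum>b\<in>Basis. Fb b x * \<phi>b b x)" for x
    unfolding \<phi>b_def using SK \<phi>g by (intro split) auto
  show i1: "integrable lborel (\<lambda>x. F x \<bullet> grad \<phi> x)"
    unfolding split\<phi> using iF\<phi> by (intro Bochner_Integration.integrable_sum)
  define cK where "cK x = indicator K x * c x" for x
  have icK: "integrable lebesgue cK" unfolding cK_def by (rule c[OF K(1,2)])
  have bdd: "integrable lebesgue (\<lambda>x. cK x * f x)" if "f \<in> borel_measurable borel" "\<And>x. \<bar>f x\<bar> \<le> M" for f M
    using integrable_bounded_mult[OF icK, of f M] that by (simp add: measurable_completion mult.commute)
  have cK\<phi>: "(\<lambda>x. c x * \<phi> x) = (\<lambda>x. cK x * \<phi> x)"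
    using SK \<phi>(3) by (fastforce simp: cK_def indicator_def)
  have \<phi>m[measurable]: "\<phi> \<in> borel_measurable borel" using borel_measurable_integrable[OF i\<phi>] by simp
  obtain M\<phi> where M\<phi>: "\<And>x. \<bar>\<phi> x\<bar> \<le> M\<phi>"
  proof -
    have "bounded (\<phi> ` S)" by (intro compact_imp_bounded compact_continuous_image \<phi>c S)
    then obtain M where "\<And>x. x \<in> S \<Longrightarrow> \<bar>\<phi> x\<bar> \<le> M" by (auto simp: bounded_iff)
    then have "\<bar>\<phi> x\<bar> \<le> max 0 M" for x using \<phi>(3)[of x] by (cases "x \<in> S") (auto simp: le_max_iff_disj)
    then show thesis by (rule that)
  qed
  have icK\<phi>: "integrable lebesgue (\<lambda>x. cK x * \<phi> x)" by (rule bdd[OF \<phi>m M\<phi>])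
  then show "integrable lebesgue (\<lambda>x. c x * \<phi> x)" by (simp only: cK\<phi>)
  define N where "N = (LINT x|lebesgue. \<bar>cK x\<bar>)"
  have N: "0 \<le> N" by (simp add: N_def)
  obtain r where r: "\<And>x. norm x \<ge> r \<Longrightarrow> \<phi> x = 0"
  proof -
    obtain r where "\<And>x. x \<in> S \<Longrightarrow> norm x \<le> r" using compact_imp_bounded[OF S(1)] by (auto simp: bounded_iff)
    then have "\<phi> x = 0" if "norm x \<ge> r + 1" for x using that \<phi>(3) by force
    then show thesis by (rule that)
  qed
  let ?T = "(LINT x|lborel. F x \<bullet> grad \<phi> x) + (LINT x|lebesgue. c x * \<phi> x)"
  \<comment> \<open>Each of the partial derivatives costs an error \<open>e\<close>, the zeroth order term an error \<open>N e\<close>.\<close>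
  have approx: "- ((real DIM('a) + N) * e) \<le> ?T" if e: "0 < e" for e
  proof -
    have "\<exists>d>0. \<forall>h. norm h < d \<longrightarrow> (\<integral>\<^sup>+x. ennreal \<bar>Fb b x\<bar> * ennreal \<bar>\<phi>b b (x + h) - \<phi>b b x\<bar> \<partial>lborel) \<le> ennreal e"
      if b: "b \<in> Basis" for b
    proof -
      have "(\<integral>\<^sup>+x. ennreal (\<bar>\<phi>b b x\<bar> powr p) \<partial>lborel) < \<infinity>"
        using i\<phi>bp[OF b] by (simp add: integrable_iff_bounded)
      from pairing_translation_continuous[OF p \<phi>bm this \<beta> \<beta>0 i\<beta> Fb[OF b] e] show ?thesis by metis
    qed
    then obtain d where d: "\<And>b. b \<in> Basis \<Longrightarrow> 0 < d b"
      "\<And>b h. b \<in> Basis \<Longrightarrow> norm h < d b \<Longrightarrow> (\<integral>\<^sup>+x. ennreal \<bar>Fb b x\<bar> * ennreal \<bar>\<phi>b b (x + h) - \<phi>b b x\<bar> \<partial>lborel) \<le> ennreal e"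
      by metis
    obtain d0 where d0: "0 < d0" "\<And>x y. norm (x - y) < d0 \<Longrightarrow> norm (\<phi> x - \<phi> y) < e"
      using compact_support_uniformly_continuous[OF \<phi>c r e] by metis
    define \<epsilon> where "\<epsilon> = Min (insert \<delta> (insert d0 (d ` Basis)))"
    have \<epsilon>: "0 < \<epsilon>" "\<epsilon> \<le> \<delta>" "\<epsilon> \<le> d0" "\<And>b. b \<in> Basis \<Longrightarrow> \<epsilon> \<le> d b"
    proof -
      show "0 < \<epsilon>" using \<delta> d0 d(1) by (simp add: \<epsilon>_def)
      show "\<epsilon> \<le> \<delta>" "\<epsilon> \<le> d0" "\<And>b. b \<in> Basis \<Longrightarrow> \<epsilon> \<le> d b" unfolding \<epsilon>_def by (rule Min_le; simp)+
    qed
    obtain \<eta> :: "'a \<Rightarrow> real" where \<eta>: "\<eta> \<in> C0_inf UNIV" "\<And>x. 0 \<le> \<eta> x" "\<And>x. norm x \<ge> \<epsilon> \<Longrightarrow> \<eta> x = 0" "(LINT x|lborel. \<eta> x) = 1"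
      using mollifiers_exist \<epsilon>(1) by metis
    define \<psi> where "\<psi> = conv \<eta> \<phi>"
    have \<psi>: "\<psi> \<in> C0_inf U" unfolding \<psi>_def
      using \<epsilon>(2) K by (intro conv_C0_inf[OF \<eta>(1,3) i\<phi> S(1) \<phi>(3)]) auto
    have \<psi>K: "\<psi> \<in> C0_inf K" unfolding \<psi>_def
      using \<epsilon>(2) K by (intro conv_C0_inf[OF \<eta>(1,3) i\<phi> S(1) \<phi>(3)]) auto
    have \<psi>off: "\<psi> x = 0" "grad \<psi> x = 0" if "x \<notin> K" for x
      using that C0_inf_subset[OF \<psi>K] closure_subset[of "{x. \<psi> x \<noteq> 0}"] grad_eq_0_off_support[of x \<psi>] by auto
    have \<psi>0: "0 \<le> \<psi> x" for x unfolding \<psi>_def conv_def using \<eta>(2) \<phi>(2) by simp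
    define \<psi>b where "\<psi>b b x = grad \<psi> x \<bullet> b" for b x
    have \<psi>b_eq: "\<psi>b b x = conv \<eta> (\<phi>b b) x" if b: "b \<in> Basis" for b x
      unfolding \<psi>b_def \<psi>_def grad_conv[OF \<eta>(1) i\<phi> b] \<phi>b_def
      by (rule conv_partial[OF \<eta>(1) b \<phi>(1) i\<phi>]) (use i\<phi>b[OF b] in \<open>simp add: \<phi>b_def[abs_def]\<close>)
    have iF\<psi>: "integrable lborel (\<lambda>x. Fb b x * \<psi>b b x)" if b: "b \<in> Basis" for b
    proof -
      have C: "\<psi>b b \<in> C0_inf K" unfolding \<psi>b_def[abs_def] by (rule C0_inf_partial[OF \<psi>K b])
      obtain M where "\<And>x. \<bar>\<psi>b b x\<bar> \<le> M" using C0_inf_bounded[OF C] by metis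
      from integrable_bounded_mult[OF iFb[OF b] _ this] C0_inf_measurable[OF C]
      show ?thesis by (simp add: mult.commute)
    qed
    have split\<psi>: "F x \<bullet> grad \<psi> x = (\<Sum>b\<in>Basis. Fb b x * \<psi>b b x)" for x
      unfolding \<psi>b_def using \<psi>off by (intro split) auto
    have i2: "integrable lborel (\<lambda>x. F x \<bullet> grad \<psi> x)"
      unfolding split\<psi> using iF\<psi> by (intro Bochner_Integration.integrable_sum)
    have grad\<psi>m[measurable]: "grad \<psi> \<in> borel_measurable borel" using \<psi> by (rule C0_inf_grad_measurable)
    have i2': "integrable lebesgue (\<lambda>x. F x \<bullet> grad \<psi> x)"
      using i2 by (subst integrable_completion) measurable
    have cK\<psi>: "(\<lambda>x. c x * \<psi> x) = (\<lambda>x. cK x * \<psi> x)"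
      using \<psi>off(1) by (fastforce simp: cK_def indicator_def)
    have icK\<psi>: "integrable lebesgue (\<lambda>x. cK x * \<psi> x)"
      using bdd[OF C0_inf_measurable[OF \<psi>]] C0_inf_bounded[OF \<psi>] by metis
    have "(LINT x:U|lebesgue. F x \<bullet> grad \<psi> x + c x * \<psi> x) = (LINT x|lebesgue. F x \<bullet> grad \<psi> x + cK x * \<psi> x)"
      unfolding set_lebesgue_integral_def
    proof (rule Bochner_Integration.integral_cong[OF refl])
      fix x show "indicator U x *\<^sub>R (F x \<bullet> grad \<psi> x + c x * \<psi> x) = F x \<bullet> grad \<psi> x + cK x * \<psi> x"
        using \<psi>off[of x] K(2) by (cases "x \<in> K") (auto simp: cK_def)
    qed
    also have "\<dots> = (LINT x|lborel. F x \<bullet> grad \<psi> x) + (LINT x|lebesgue. cK x * \<psi> x)"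
      using i2' icK\<psi> integral_completion[of "\<lambda>x. F x \<bullet> grad \<psi> x" lborel] by simp
    finally have T\<psi>: "0 \<le> (LINT x|lborel. F x \<bullet> grad \<psi> x) + (LINT x|lebesgue. cK x * \<psi> x)"
      using test[OF \<psi> \<psi>0] by simp
    have close_b: "(LINT x|lborel. Fb b x * \<psi>b b x) - (LINT x|lborel. Fb b x * \<phi>b b x) \<le> e" if b: "b \<in> Basis" for b
    proof -
      have "(\<integral>\<^sup>+x. ennreal \<bar>Fb b x\<bar> * ennreal \<bar>conv \<eta> (\<phi>b b) x - \<phi>b b x\<bar> \<partial>lborel) \<le> ennreal e"
        using d(2)[OF b] \<epsilon>(4)[OF b] by (intro conv_close[OF \<eta>(1,2,4,3) i\<phi>b[OF b] Fbm]) auto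
      then have n: "(\<integral>\<^sup>+x. ennreal (norm (Fb b x * \<psi>b b x - Fb b x * \<phi>b b x)) \<partial>lborel) \<le> ennreal e"
        by (simp add: \<psi>b_eq[OF b] right_diff_distrib[symmetric] abs_mult ennreal_mult'')
      have "ennreal (norm (LINT x|lborel. Fb b x * \<psi>b b x - Fb b x * \<phi>b b x)) \<le> ennreal e"
        by (rule order_trans[OF integral_norm_bound_ennreal n]) (use iF\<psi>[OF b] iF\<phi>[OF b] in auto)
      then have "norm (LINT x|lborel. Fb b x * \<psi>b b x - Fb b x * \<phi>b b x) \<le> e"
        using e by (subst (asm) ennreal_le_iff) auto
      then show ?thesis using iF\<psi>[OF b] iF\<phi>[OF b] by simp
    qed
    have "(LINT x|lborel. F x \<bullet> grad \<psi> x) - (LINT x|lborel. F x \<bullet> grad \<phi> x)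
        = (\<Sum>b\<in>Basis. (LINT x|lborel. Fb b x * \<psi>b b x) - (LINT x|lborel. Fb b x * \<phi>b b x))"
      unfolding split\<psi> split\<phi> using iF\<psi> iF\<phi>
      by (simp add: Bochner_Integration.integral_sum sum_subtractf)
    also have "\<dots> \<le> (\<Sum>b\<in>(Basis :: 'a set). e)" by (intro sum_mono close_b)
    finally have A: "(LINT x|lborel. F x \<bullet> grad \<psi> x) - (LINT x|lborel. F x \<bullet> grad \<phi> x) \<le> real DIM('a) * e" by simp
    have unif: "\<bar>\<psi> x - \<phi> x\<bar> \<le> e" for x unfolding \<psi>_def
    proof (rule conv_uniformly_close[OF \<eta>(1,2,4,3) i\<phi>])
      fix x h :: 'a assume "norm h < \<epsilon>"
      then show "\<bar>\<phi> (x + h) - \<phi> x\<bar> \<le> e" using d0(2)[of "x + h" x] \<epsilon>(3) by (simp add: less_imp_le)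
    qed
    have "(LINT x|lebesgue. cK x * \<psi> x) - (LINT x|lebesgue. cK x * \<phi> x) = (LINT x|lebesgue. cK x * \<psi> x - cK x * \<phi> x)"
      using icK\<psi> icK\<phi> by simp
    also have "\<dots> \<le> norm \<dots>" by simp
    also have "\<dots> \<le> (LINT x|lebesgue. \<bar>cK x\<bar> * e)"
    proof (rule lebesgue_integral_norm_le)
      show "integrable lebesgue (\<lambda>x. \<bar>cK x\<bar> * e)" using icK by simp
      show "norm (cK x * \<psi> x - cK x * \<phi> x) \<le> \<bar>cK x\<bar> * e" for x
        using unif[of x] by (simp add: right_diff_distrib[symmetric] abs_mult mult_left_mono)
    qed
    also have "\<dots> = N * e" by (simp add: N_def)
    finally have B: "(LINT x|lebesgue. cK x * \<psi> x) - (LINT x|lebesgue. cK x * \<phi> x) \<le> N * e" .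
    show ?thesis using A B T\<psi> unfolding cK\<phi> by (simp add: algebra_simps)
  qed
  show "0 \<le> ?T"
  proof (rule ccontr)
    assume "\<not> 0 \<le> ?T"
    then have t: "?T < 0" by simp
    have pos: "0 < real DIM('a) + N" using N by (simp add: add_pos_nonneg)
    define D t where "D = real DIM('a) + N" and "t = ?T"
    have D: "0 < D" using pos by (simp add: D_def)
    have "0 < - t / (2 * D)" using \<open>?T < 0\<close> D by (simp add: t_def divide_pos_pos del: divide_minus_left)
    then have "- (D * (- t / (2 * D))) \<le> t" unfolding D_def t_def by (rule approx)
    moreover have "D * (- t / (2 * D)) = - t / 2" using D by simp
    ultimately have "0 \<le> t" by linarith
    then show False using \<open>?T < 0\<close> by (simp add: t_def)
  qed
qed

section \<open>Picone's inequality\<close>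

definition pflux :: "real \<Rightarrow> 'a::euclidean_space \<Rightarrow> 'a" where
  "pflux p x = norm x powr (p - 2) *\<^sub>R x"

text \<open>
  The convexity remainder of \<open>\<bar>y\<bar>\<^sup>p\<close> at \<open>x\<close>: \<open>p L(w,v)\<close> is its value at \<open>x = w \<nabla>v / v\<close> and
  \<open>y = \<nabla>w\<close>.
\<close>

definition picone :: "real \<Rightarrow> 'a::euclidean_space \<Rightarrow> 'a \<Rightarrow> real" where
  "picone p x y = norm y powr p + (p - 1) * norm x powr p - p * (pflux p x \<bullet> y)"

lemma norm_pflux:
  assumes "1 < p" shows "norm (pflux p x) = norm x powr (p - 1)"
proof (cases "x = 0")
  case False
  then have "norm x powr (p - 2) * norm x powr 1 = norm x powr (p - 1)"
    by (simp only: powr_add[symmetric]) simp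
  then show ?thesis using False by (simp add: pflux_def)
qed (simp add: pflux_def)

lemma pflux_self:
  assumes "1 < p" shows "pflux p x \<bullet> x = norm x powr p"
proof (cases "x = 0")
  case False
  then have "norm x powr (p - 2) * norm x powr 2 = norm x powr p"
    by (simp only: powr_add[symmetric]) simp
  then show ?thesis using False by (simp add: pflux_def power2_norm_eq_inner)
qed (simp add: pflux_def)

lemma pflux_scaleR:
  assumes "0 \<le> t" shows "pflux p (t *\<^sub>R x) = t powr (p - 1) *\<^sub>R pflux p x"
proof (cases "t = 0")
  case False
  then have "t powr (p - 2) * t powr 1 = t powr (p - 1)"
    by (simp only: powr_add[symmetric]) simp
  then show ?thesis using False assms by (simp add: pflux_def powr_mult mult_ac)
qed (simp add: pflux_def)

lemma picone_scaleR:
  assumes "0 \<le> t" "1 < p" shows "picone p (t *\<^sub>R x) (t *\<^sub>R y) = t powr p * picone p x y"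
proof (cases "t = 0")
  case False
  then have "t powr (p - 1) * t powr 1 = t powr p"
    by (simp only: powr_add[symmetric]) simp
  then show ?thesis using False assms
    by (simp add: picone_def pflux_scaleR powr_mult algebra_simps)
qed (use assms in \<open>simp add: picone_def pflux_def\<close>)

lemma picone_nonneg:
  assumes p: "1 < p" shows "0 \<le> picone p x y"
proof -
  have "pflux p x \<bullet> y \<le> norm x powr (p - 1) * norm y"
    using norm_cauchy_schwarz[of "pflux p x" y] by (simp add: norm_pflux p)
  then have "p * (pflux p x \<bullet> y) \<le> p * norm y * norm x powr (p - 1)"
    using p by (simp add: mult.commute mult.left_commute)
  also have "\<dots> \<le> norm y powr p + (p - 1) * norm x powr p"
    by (intro young_tangent(1) p) auto
  finally show ?thesis by (simp add: picone_def)
qed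

text \<open>
  Equality in Young's inequality forces equal norms, and equality in the Cauchy-Schwarz inequality
  then equal directions.
\<close>

lemma picone_eq_0:
  assumes p: "1 < p" and 0: "picone p x y = 0" shows "x = y"
proof -
  have cs: "pflux p x \<bullet> y \<le> norm x powr (p - 1) * norm y"
    using norm_cauchy_schwarz[of "pflux p x" y] by (simp add: norm_pflux p)
  then have le: "p * (pflux p x \<bullet> y) \<le> p * norm y * norm x powr (p - 1)"
    using p by (simp add: mult.commute mult.left_commute)
  have y: "p * norm y * norm x powr (p - 1) \<le> norm y powr p + (p - 1) * norm x powr p"
    by (intro young_tangent(1) p) auto
  have eq: "p * norm y * norm x powr (p - 1) = norm y powr p + (p - 1) * norm x powr p"
    using 0 le y by (simp add: picone_def)
  then have n: "norm y = norm x" using young_tangent(2)[OF p norm_ge_zero norm_ge_zero] by blast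
  show ?thesis
  proof (cases "x = 0")
    case False
    have "p * (pflux p x \<bullet> y) = p * norm y * norm x powr (p - 1)"
      using 0 eq unfolding picone_def by linarith
    then have "pflux p x \<bullet> y = norm y * norm x powr (p - 1)" using p by simp
    then have "norm x powr (p - 2) * (x \<bullet> y) = norm x powr (p - 2) * (norm x * norm y)"
      using False powr_add[of "norm x" "p - 2" 1] by (simp add: pflux_def)
    then have "x \<bullet> y = norm x * norm y" using False by simp
    then have "norm x *\<^sub>R y = norm y *\<^sub>R x" by (simp add: norm_cauchy_schwarz_eq)
    then show ?thesis using n False by simp
  qed (use n in simp)
qed

lemma pflux_monotone_eq:
  assumes "1 < p"
  shows "p * ((pflux p x - pflux p y) \<bullet> (x - y)) = picone p x y + picone p y x"
  using pflux_self[OF assms, of x] pflux_self[OF assms, of y]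
  by (simp add: picone_def algebra_simps)

lemma continuous_on_pflux:
  assumes p: "1 < p" shows "continuous_on UNIV (pflux p :: 'a::euclidean_space \<Rightarrow> 'a)"
proof (rule continuous_at_imp_continuous_on, rule ballI)
  fix x :: 'a
  show "isCont (pflux p) x"
  proof (cases "x = 0")
    case False
    then show ?thesis unfolding pflux_def by (intro continuous_intros) auto
  next
    case True
    have "((\<lambda>x::'a. norm x powr (p - 1)) \<longlongrightarrow> norm (0::'a) powr (p - 1)) (at 0)"
      by (rule tendsto_powr2[OF tendsto_norm[OF tendsto_ident_at] tendsto_const]) (use p in auto)
    then have "((pflux p :: 'a \<Rightarrow> 'a) \<longlongrightarrow> 0) (at 0)"
      by (subst tendsto_norm_zero_iff[symmetric]) (simp add: norm_pflux p)
    then show ?thesis using True by (simp add: isCont_def pflux_def)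
  qed
qed

lemma pflux_measurable:
  assumes "1 < p" shows "pflux p \<in> borel_measurable borel"
  using continuous_on_pflux[OF assms] by (rule borel_measurable_continuous_onI)

lemma continuous_on_picone:
  assumes p: "1 < p" and "continuous_on A f" "continuous_on A g"
  shows "continuous_on A (\<lambda>x. picone p (f x) (g x))"
proof -
  have 1: "continuous_on A (\<lambda>x. pflux p (f x))"
    using continuous_on_compose2[OF continuous_on_pflux[OF p] assms(2)] by simp
  have 2: "continuous_on A (\<lambda>x. norm (f x) powr p)" "continuous_on A (\<lambda>x. norm (g x) powr p)"
    using p by (auto intro!: continuous_on_powr'[OF continuous_on_norm continuous_on_const] assms)
  show ?thesis unfolding picone_def
    by (intro continuous_on_diff continuous_on_add continuous_on_mult continuous_on_const continuous_on_inner 1 2 assms(3))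
qed

lemma picone_measurable:
  assumes p: "1 < p" and [measurable]: "f \<in> borel_measurable M" "g \<in> borel_measurable M"
  shows "(\<lambda>x. picone p (f x) (g x)) \<in> borel_measurable M"
proof -
  note [measurable] = measurable_compose[OF _ pflux_measurable[OF p]]
  show ?thesis unfolding picone_def by measurable
qed

text \<open>
  Homogeneity and compactness give, without distinguishing \<open>p < 2\<close> and \<open>p \<ge> 2\<close>, the form of
  coercivity that is needed.
\<close>

lemma picone_coercive:
  assumes p: "1 < p" and \<delta>: "0 < \<delta>"
  obtains C where "0 \<le> C" "\<And>x y :: 'a::euclidean_space. norm (y - x) powr p \<le> \<delta> * norm x powr p + C * picone p x y"
proof -
  \<comment> \<open>Where \<open>norm x > R * norm (y - x)\<close> the first term on the right alone suffices; the rest is compact up to scaling.\<close>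
  define R where "R = (1 / \<delta>) powr (1 / p)"
  have R: "R powr p = 1 / \<delta>" using p \<delta> by (simp add: R_def powr_powr)
  have R0: "0 \<le> R" by (simp add: R_def)
  define f where "f z = picone p (fst z) (fst z + snd z)" for z :: "'a \<times> 'a"
  have "continuous_on (cball 0 R \<times> sphere 0 1) f"
    unfolding f_def by (intro continuous_on_picone p continuous_intros)
  moreover have "compact (cball (0::'a) R \<times> sphere (0::'a) 1)" by (intro compact_Times) auto
  moreover have "cball (0::'a) R \<times> sphere (0::'a) 1 \<noteq> {}"
  proof -
    obtain b :: 'a where "b \<in> Basis" using nonempty_Basis by blast
    then have "(0, b) \<in> cball (0::'a) R \<times> sphere (0::'a) 1" using R0 by simp
    then show ?thesis by blast
  qed
  ultimately obtain z0 where z0: "z0 \<in> cball 0 R \<times> sphere 0 1" "\<And>z. z \<in> cball 0 R \<times> sphere 0 1 \<Longrightarrow> f z0 \<le> f z"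
    using continuous_attains_inf by metis
  define m where "m = f z0"
  have m: "0 < m"
  proof -
    have "f z0 \<noteq> 0"
    proof
      assume "f z0 = 0"
      then have "fst z0 = fst z0 + snd z0" unfolding f_def using picone_eq_0[OF p] by blast
      then show False using z0(1) by (auto simp: mem_Times_iff)
    qed
    moreover have "0 \<le> f z0" unfolding f_def by (rule picone_nonneg[OF p])
    ultimately show ?thesis by (simp add: m_def)
  qed
  show thesis
  proof (rule that[of "1 / m"])
    fix x y :: 'a
    define t where "t = norm (y - x)"
    have pn: "0 \<le> 1 / m * picone p x y" using m picone_nonneg[OF p, of x y] by simp
    show "norm (y - x) powr p \<le> \<delta> * norm x powr p + 1 / m * picone p x y"
    proof (cases "t = 0")
      case True
      then show ?thesis using pn \<delta> by (simp add: t_def add_nonneg_nonneg)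
    next
      case False
      then have t: "0 < t" by (simp add: t_def)
      show ?thesis
      proof (cases "norm x \<le> R * t")
        case True
        let ?x = "(1 / t) *\<^sub>R x" and ?d = "(1 / t) *\<^sub>R (y - x)"
        have "(?x, ?d) \<in> cball 0 R \<times> sphere 0 1" using True t by (auto simp: t_def divide_le_eq)
        then have "m \<le> f (?x, ?d)" unfolding m_def by (rule z0(2))
        also have "f (?x, ?d) = picone p ((1 / t) *\<^sub>R x) ((1 / t) *\<^sub>R y)"
          by (simp add: f_def scaleR_diff_right)
        also have "\<dots> = (1 / t) powr p * picone p x y" using t p by (intro picone_scaleR) auto
        finally have "m * t powr p \<le> picone p x y" using t by (simp add: powr_divide field_simps)
        then have "t powr p \<le> 1 / m * picone p x y" using m by (simp add: field_simps)
        moreover have "0 \<le> \<delta> * norm x powr p" using \<delta> by simp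
        ultimately show ?thesis by (simp add: t_def)
      next
        case False
        then have "(R * t) powr p \<le> norm x powr p" using R0 t p by (intro powr_mono2) auto
        then have "t powr p \<le> \<delta> * norm x powr p"
          using R0 t \<delta> by (simp add: powr_mult R field_simps)
        then show ?thesis using pn by (simp add: t_def)
      qed
    qed
  qed (use m in simp)
qed

lemma L_eq_picone:
  assumes "0 \<le> w x" "0 < v x" "1 < p"
  shows "p * L p w v x = picone p ((w x / v x) *\<^sub>R grad v x) (grad w x)"
  using assms
  by (simp add: L_def picone_def pflux_scaleR powr_divide powr_mult pflux_def[symmetric] inner_commute field_simps)

subsection \<open>Powers of the positive part\<close>

text \<open>
  Truncating at zero makes these powers differentiable on the whole line if \<open>r > 1\<close>, so that
  test functions built from them are differentiable also where they vanish.
\<close>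

definition pospow :: "real \<Rightarrow> real \<Rightarrow> real" where
  "pospow r t = max 0 t powr r"

lemma pospow_nonneg: "0 \<le> pospow r t" by (simp add: pospow_def)

lemma pospow_eq: "0 \<le> t \<Longrightarrow> pospow r t = t powr r" by (simp add: pospow_def)

lemma continuous_on_pospow:
  assumes "0 < r" "continuous_on A f" shows "continuous_on A (\<lambda>x. pospow r (f x))"
  unfolding pospow_def using assms by (intro continuous_on_powr' continuous_intros) auto

lemma DERIV_pospow:
  assumes r: "1 < r" shows "(pospow r has_real_derivative r * pospow (r - 1) t) (at t)"
proof -
  consider "t > 0" | "t < 0" | "t = 0" by linarith
  then show ?thesis
  proof cases
    case 1
    have "((\<lambda>t. t powr r) has_real_derivative r * pospow (r - 1) t) (at t)"
      using 1 by (auto intro!: derivative_eq_intros simp: pospow_eq)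
    then show ?thesis
      by (rule has_field_derivative_transform_within_open[where S="{0<..}"]) (use 1 in \<open>auto simp: pospow_eq\<close>)
  next
    case 2
    have "((\<lambda>t. 0) has_real_derivative r * pospow (r - 1) t) (at t)"
      using 2 r by (auto simp: pospow_def)
    then show ?thesis
      by (rule has_field_derivative_transform_within_open[where S="{..<0}"]) (use 2 r in \<open>auto simp: pospow_def\<close>)
  next
    case 3
    have "((\<lambda>h::real. \<bar>h\<bar> powr (r - 1)) \<longlongrightarrow> \<bar>0\<bar> powr (r - 1)) (at 0)"
      by (rule tendsto_powr2[OF tendsto_rabs[OF tendsto_ident_at] tendsto_const]) (use r in auto)
    then have lim: "((\<lambda>h::real. \<bar>h\<bar> powr (r - 1)) \<longlongrightarrow> 0) (at 0)" by simp
    have "norm (pospow r h / h) \<le> \<bar>h\<bar> powr (r - 1)" for h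
    proof (cases "h > 0")
      case True
      then have "h powr r / h = h powr (r - 1)" by (simp add: powr_diff)
      then show ?thesis using True by (simp add: pospow_eq)
    qed (use r in \<open>simp add: pospow_def\<close>)
    then have "((\<lambda>h. pospow r h / h) \<longlongrightarrow> 0) (at 0)"
      by (intro Lim_null_comparison[OF _ lim] always_eventually allI)
    then show ?thesis using 3 r by (simp add: has_field_derivative_iff pospow_def[of r 0] pospow_def[of _ 0])
  qed
qed

section \<open>Comparing a solution with a supersolution\<close>

lemma Linf_loc_integrable:
  fixes V f :: "'a::euclidean_space \<Rightarrow> real"
  assumes V: "V \<in> Linf_loc \<Omega>" and \<Omega>: "open \<Omega>" and T: "compact T" "T \<subseteq> \<Omega>" and f: "continuous_on T f"
  shows "integrable lebesgue (\<lambda>x. indicator T x * (V x * f x))"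
proof -
  have [measurable]: "\<Omega> \<in> sets borel" "T \<in> sets borel" using \<Omega> T by (auto intro: borel_compact)
  have if': "integrable lborel (\<lambda>x. indicator T x *\<^sub>R f x)" by (rule borel_integrable_compact[OF T(1) f])
  then have ifl: "integrable lebesgue (\<lambda>x. indicator T x *\<^sub>R f x)"
    by (subst integrable_completion) (auto dest: borel_measurable_integrable)
  have Vm: "(\<lambda>x. indicator \<Omega> x *\<^sub>R V x) \<in> borel_measurable lebesgue"
  proof -
    have "V \<in> borel_measurable (lebesgue_on \<Omega>)" using V by (simp add: Linf_loc_def)
    then show ?thesis by (subst (asm) borel_measurable_restrict_space_iff) auto
  qed
  obtain C where C: "AE x in lebesgue. x \<in> T \<longrightarrow> \<bar>V x\<bar> \<le> C" using V T by (auto simp: Linf_loc_def)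
  have eq: "indicator T x * (V x * f x) = (indicator \<Omega> x *\<^sub>R V x) * (indicator T x *\<^sub>R f x)" for x
    using T(2) by (cases "x \<in> T") auto
  show ?thesis unfolding eq
  proof (rule Bochner_Integration.integrable_bound)
    show "integrable lebesgue (\<lambda>x. C * (indicator T x *\<^sub>R f x))" using ifl by (rule integrable_mult_right)
    show "(\<lambda>x. (indicator \<Omega> x *\<^sub>R V x) * (indicator T x *\<^sub>R f x)) \<in> borel_measurable lebesgue"
      using Vm borel_measurable_integrable[OF ifl] by (rule borel_measurable_times)
    show "AE x in lebesgue. norm ((indicator \<Omega> x *\<^sub>R V x) * (indicator T x *\<^sub>R f x)) \<le> norm (C * (indicator T x *\<^sub>R f x))"
      using C
    proof eventually_elim
      case (elim x)
      show ?case
      proof (cases "x \<in> T")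
        case True
        then have "\<bar>V x\<bar> \<le> \<bar>C\<bar>" using elim by auto
        then have "\<bar>V x\<bar> * \<bar>f x\<bar> \<le> \<bar>C\<bar> * \<bar>f x\<bar>" by (rule mult_right_mono) simp
        then show ?thesis using True T(2) by (auto simp: abs_mult)
      qed simp
    qed
  qed
qed

lemma continuous_on_compact_bounded:
  fixes f :: "'a::topological_space \<Rightarrow> 'b::real_normed_vector"
  assumes "compact S" "continuous_on S f"
  obtains M where "0 \<le> M" "\<And>x. x \<in> S \<Longrightarrow> norm (f x) \<le> M"
proof -
  have "bounded (f ` S)" using assms by (intro compact_imp_bounded compact_continuous_image)
  then obtain M where M: "\<And>x. x \<in> S \<Longrightarrow> norm (f x) \<le> M" by (auto simp: bounded_iff)
  show thesis by (rule that[of "\<bar>M\<bar>"]) (simp_all add: order_trans[OF M abs_ge_self])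
qed

lemma integrable_grad_powr:
  fixes \<phi> k :: "'a::euclidean_space \<Rightarrow> real" and X q :: "'a \<Rightarrow> 'a"
  assumes p: "1 < p" and \<phi>: "\<And>x. \<phi> differentiable (at x)" "\<And>x. x \<notin> S \<Longrightarrow> \<phi> x = 0"
    and S: "compact S" and X: "continuous_on S X" and k: "continuous_on S k"
    and gr: "\<And>x. x \<in> S \<Longrightarrow> grad \<phi> x = X x + k x *\<^sub>R q x"
    and q: "integrable lborel (\<lambda>x. indicator S x * norm (q x) powr p)"
  shows "integrable lborel (\<lambda>x. norm (grad \<phi> x) powr p)"
proof -
  have [measurable]: "grad \<phi> \<in> borel_measurable borel"
    using borel_measurable_grad[of UNIV \<phi>] \<phi>(1) by simp
  obtain M where M: "0 \<le> M" "\<And>x. x \<in> S \<Longrightarrow> norm (X x) \<le> M"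
    using continuous_on_compact_bounded[OF S X] by blast
  obtain N where N: "0 \<le> N" "\<And>x. x \<in> S \<Longrightarrow> norm (k x) \<le> N"
    using continuous_on_compact_bounded[OF S k] by blast
  have g0: "grad \<phi> x = 0" if "x \<notin> S" for x
    by (rule grad_eqI, rule GDERIV_eq_0_on_open[where S="- S"])
       (use that \<phi>(2) S compact_imp_closed in auto)
  have iS: "integrable lborel (indicator S :: 'a \<Rightarrow> real)"
    using emeasure_compact_finite[OF S] borel_compact[OF S] by simp
  show ?thesis
  proof (rule Bochner_Integration.integrable_bound)
    show "integrable lborel (\<lambda>x. 2 powr p * (M powr p * indicator S x + N powr p * (indicator S x * norm (q x) powr p)))"
      using iS q by (intro integrable_mult_right Bochner_Integration.integrable_add)
    show "AE x in lborel. norm (norm (grad \<phi> x) powr p)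
        \<le> norm (2 powr p * (M powr p * indicator S x + N powr p * (indicator S x * norm (q x) powr p)))"
    proof (rule AE_I2)
      fix x
      show "norm (norm (grad \<phi> x) powr p)
        \<le> norm (2 powr p * (M powr p * indicator S x + N powr p * (indicator S x * norm (q x) powr p)))"
      proof (cases "x \<in> S")
        case True
        have "norm (grad \<phi> x) \<le> norm (X x) + norm (k x *\<^sub>R q x)" unfolding gr[OF True] by (rule norm_triangle_ineq)
        also have "\<dots> \<le> M + N * norm (q x)" using M(2)[OF True] N(2)[OF True] by (simp add: add_mono mult_right_mono)
        finally have "norm (grad \<phi> x) powr p \<le> (M + N * norm (q x)) powr p" using p by (intro powr_mono2) auto
        also have "\<dots> \<le> 2 powr p * (M powr p + (N * norm (q x)) powr p)"
          using p M N by (intro powr_add_le) auto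
        also have "(N * norm (q x)) powr p = N powr p * norm (q x) powr p" using N by (simp add: powr_mult)
        finally show ?thesis using True by simp
      qed (simp add: g0)
    qed
  qed measurable
qed

text \<open>
  Testing with \<open>w\<^sup>p h u\<^sup>1\<^sup>-\<^sup>p\<close> and \<open>w\<^sup>p h v\<^sup>1\<^sup>-\<^sup>p\<close>, in logarithmic variables \<open>a = \<nabla>u/u\<close>,
  \<open>b = \<nabla>v/v\<close>: the difference consists of two Picone remainders and of a monotone term.
\<close>

lemma picone_identity:
  fixes a b g :: "'a::euclidean_space"
  assumes p: "1 < p" and \<omega>: "0 \<le> \<omega>" and G: "G = (p * \<omega> powr (p - 1) * h) *\<^sub>R g + k *\<^sub>R (a - b)"
  shows "pflux p a \<bullet> (G - ((p - 1) * (\<omega> powr p * h)) *\<^sub>R a) - pflux p b \<bullet> (G - ((p - 1) * (\<omega> powr p * h)) *\<^sub>R b)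
    = h * picone p (\<omega> *\<^sub>R b) g + k * ((pflux p a - pflux p b) \<bullet> (a - b)) - h * picone p (\<omega> *\<^sub>R a) g"
  using pflux_self[OF p, of a] pflux_self[OF p, of b] \<omega>
  by (simp add: G picone_def pflux_scaleR powr_mult algebra_simps)

lemma picone_le:
  assumes p: "1 < p" shows "picone p x y \<le> 2 * (norm y powr p + (p - 1) * norm x powr p)"
proof -
  have "- (norm x powr (p - 1) * norm y) \<le> pflux p x \<bullet> y"
    using Cauchy_Schwarz_ineq2[of "pflux p x" y] by (simp add: norm_pflux p abs_le_iff)
  then have "- (p * norm y * norm x powr (p - 1)) \<le> p * (pflux p x \<bullet> y)"
    using p mult_left_mono[of "- (norm x powr (p - 1) * norm y)" "pflux p x \<bullet> y" p] by (simp add: mult_ac)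
  then show ?thesis
    using young_tangent(1)[OF p norm_ge_zero norm_ge_zero, of y x] unfolding picone_def by argo
qed

text \<open>
  The open set \<open>W\<close>, on which \<open>u\<close> solves the equation, is a neighbourhood of \<open>\<Omega> - interior K\<close>, so \<open>u\<close> is under
  control up to the boundary of \<open>K\<close>. The constant \<open>c\<close> makes \<open>u < c v\<close> strict on that boundary.
\<close>

locale comparison_pair =
  fixes p c :: real and V u v :: "'a::euclidean_space \<Rightarrow> real" and \<Omega> W K :: "'a set"
  assumes p: "1 < p" and open_\<Omega>: "open \<Omega>" and open_W: "open W" and sub_W: "\<Omega> - interior K \<subseteq> W" and W_sub: "W \<subseteq> \<Omega>"
    and compact_K: "compact K" and V: "V \<in> Linf_loc \<Omega>"
    and u_cont: "continuous_on W u" and u_pos: "\<And>x. x \<in> W \<Longrightarrow> 0 < u x"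
    and u_diff: "\<And>x. x \<in> W \<Longrightarrow> u differentiable (at x)" and u_sol: "weak_solution p V W u"
    and v_cont: "continuous_on (\<Omega> - interior K) v" and v_pos: "\<And>x. x \<in> \<Omega> - interior K \<Longrightarrow> 0 < v x"
    and v_super: "supersolution p V (\<Omega> - K) v"
    and boundary: "\<And>x. x \<in> frontier K \<Longrightarrow> x \<in> \<Omega> \<Longrightarrow> u x \<le> v x" and c: "1 < c"
begin

abbreviation "U \<equiv> \<Omega> - K"

definition "a x = (1 / u x) *\<^sub>R grad u x"
definition "b x = (1 / v x) *\<^sub>R grad v x"
definition "s x = c * v x / u x"

lemma open_U: "open U"
  using open_\<Omega> compact_K compact_imp_closed by (auto intro: open_Diff)

lemma U_W: "x \<in> U \<Longrightarrow> x \<in> W" and U_int: "x \<in> U \<Longrightarrow> x \<in> \<Omega> - interior K"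
  using sub_W interior_subset by blast+

lemma v_diff: "x \<in> U \<Longrightarrow> v differentiable (at x)"
  using v_super by (auto simp: supersolution_def)

lemma v_grad_cont: "continuous_on U (grad v)"
proof -
  have "continuous_on U (\<lambda>x. grad v x \<bullet> b)" if "b \<in> Basis" for b
    using v_super that by (simp add: supersolution_def)
  then show ?thesis by (subst continuous_on_componentwise) blast
qed

lemma u_cont_U: "continuous_on U u" and v_cont_U: "continuous_on U v"
  using u_cont v_cont U_W U_int by (auto intro: continuous_on_subset)

lemma u_pos_U: "x \<in> U \<Longrightarrow> 0 < u x" and v_pos_U: "x \<in> U \<Longrightarrow> 0 < v x"
  using u_pos[OF U_W] v_pos[OF U_int] by auto

lemma grad_u_measurable: "(\<lambda>x. indicator W x *\<^sub>R grad u x) \<in> borel_measurable borel"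
  by (rule borel_measurable_grad[OF open_W u_diff])

lemma grad_v_measurable: "(\<lambda>x. indicator U x *\<^sub>R grad v x) \<in> borel_measurable borel"
  by (rule borel_measurable_grad[OF open_U v_diff])

text \<open>
  The integrability of the weak gradient passes to the classical one, as both agree almost everywhere.
\<close>

lemma grad_u_Lp:
  assumes T: "compact T" "T \<subseteq> W"
  shows "integrable lborel (\<lambda>x. indicator T x * norm (grad u x) powr p)"
proof -
  have [measurable]: "T \<in> sets borel" using T by (intro borel_compact)
  obtain g where g: "g \<in> Lp_loc p W" "weak_gradient W u g"
    using u_sol by (auto simp: weak_solution_def W1p_loc_def)
  have eq: "AE x in lebesgue. x \<in> W \<longrightarrow> g x = grad u x"
    by (rule weak_gradient_eq_grad[OF open_W u_diff g(2)])
  note [measurable] = grad_u_measurable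
  have "(\<lambda>x. indicator T x * norm (indicator W x *\<^sub>R grad u x) powr p) \<in> borel_measurable borel" by measurable
  also have "(\<lambda>x. indicator T x * norm (indicator W x *\<^sub>R grad u x) powr p) = (\<lambda>x. indicator T x * norm (grad u x) powr p)"
    using T(2) by (auto simp: indicator_def fun_eq_iff)
  finally have m: "(\<lambda>x. indicator T x * norm (grad u x) powr p) \<in> borel_measurable lborel" by simp
  have "integrable lebesgue (\<lambda>x. indicator T x * norm (g x) powr p)"
    using g(1) T by (auto simp: Lp_loc_def set_integrable_def)
  then have "integrable lebesgue (\<lambda>x. indicator T x * norm (grad u x) powr p)"
  proof (rule integrable_cong_AE_imp)
    show "(\<lambda>x. indicator T x * norm (grad u x) powr p) \<in> borel_measurable lebesgue"
      using m by (rule measurable_completion)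
    show "AE x in lebesgue. indicator T x * norm (g x) powr p = indicator T x * norm (grad u x) powr p"
      using eq by eventually_elim (use T(2) in \<open>auto simp: indicator_def\<close>)
  qed
  then show ?thesis using m by (simp add: integrable_completion)
qed

lemma u_weak:
  assumes "\<chi>' \<in> C0_inf W"
  shows "(LINT x:W|lebesgue. pflux p (grad u x) \<bullet> grad \<chi>' x + (V x * u x powr (p - 1)) * \<chi>' x) = 0"
proof -
  obtain g where g: "weak_gradient W u g" "\<And>\<phi>. \<phi> \<in> C0_inf W \<Longrightarrow> weak_form p V W u g \<phi> = 0"
    using u_sol by (auto simp: weak_solution_def)
  have eq: "AE x in lebesgue. x \<in> W \<longrightarrow> g x = grad u x"
    by (rule weak_gradient_eq_grad[OF open_W u_diff g(1)])
  have Wl: "W \<in> sets lebesgue" using open_W by simp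
  have pw: "\<bar>u x\<bar> powr (p - 2) * u x = u x powr (p - 1)" if "x \<in> W" for x
    using u_pos[OF that] powr_add[of "u x" "p - 2" 1] by simp
  define I where "I G x = indicator W x *\<^sub>R (pflux p (G x) \<bullet> grad \<chi>' x + (V x * u x powr (p - 1)) * \<chi>' x)"
    for G :: "'a \<Rightarrow> 'a" and x
  have I_measurable: "I G \<in> borel_measurable lebesgue"
    if G: "(\<lambda>x. indicator W x *\<^sub>R G x) \<in> borel_measurable lebesgue" for G
  proof -
    have "grad \<chi>' \<in> borel_measurable lebesgue"
      using C0_inf_grad_measurable[OF assms] by (simp add: measurable_completion)
    then have A: "(\<lambda>x. pflux p (indicator W x *\<^sub>R G x) \<bullet> grad \<chi>' x) \<in> borel_measurable lebesgue"
      using measurable_compose[OF G pflux_measurable[OF p]] by (intro borel_measurable_inner)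
    have "continuous_on W (\<lambda>x. u x powr (p - 1) * \<chi>' x)"
      using u_pos by (intro continuous_on_mult continuous_on_powr u_cont continuous_on_const C0_inf_continuous[OF assms])
        (auto dest: u_pos)
    then have "(\<lambda>x. indicator W x *\<^sub>R (u x powr (p - 1) * \<chi>' x)) \<in> borel_measurable borel"
      using open_W by (intro borel_measurable_continuous_on_indicator) auto
    then have B: "(\<lambda>x. indicator W x *\<^sub>R (u x powr (p - 1) * \<chi>' x)) \<in> borel_measurable lebesgue"
      by (simp add: measurable_completion)
    have "V \<in> borel_measurable (lebesgue_on \<Omega>)" using V by (simp add: Linf_loc_def)
    then have C: "(\<lambda>x. indicator \<Omega> x *\<^sub>R V x) \<in> borel_measurable lebesgue"
      using open_\<Omega> by (subst (asm) borel_measurable_restrict_space_iff) auto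
    have "I G = (\<lambda>x. pflux p (indicator W x *\<^sub>R G x) \<bullet> grad \<chi>' x + (indicator \<Omega> x *\<^sub>R V x) * (indicator W x *\<^sub>R (u x powr (p - 1) * \<chi>' x)))"
    proof
      fix x show "I G x = pflux p (indicator W x *\<^sub>R G x) \<bullet> grad \<chi>' x + (indicator \<Omega> x *\<^sub>R V x) * (indicator W x *\<^sub>R (u x powr (p - 1) * \<chi>' x))"
        using W_sub by (cases "x \<in> W") (auto simp: I_def pflux_def)
    qed
    then show ?thesis using borel_measurable_add[OF A borel_measurable_times[OF C B]] by simp
  qed
  have "integral\<^sup>L lebesgue (I (grad u)) = integral\<^sup>L lebesgue (I g)"
  proof (rule integral_cong_AE)
    show "I (grad u) \<in> borel_measurable lebesgue"
      by (rule I_measurable) (use grad_u_measurable in \<open>simp add: measurable_completion\<close>)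
    show "I g \<in> borel_measurable lebesgue"
    proof (rule I_measurable)
      have "g \<in> borel_measurable (lebesgue_on W)" using g(1) by (simp add: weak_gradient_def Lp_loc_def)
      then show "(\<lambda>x. indicator W x *\<^sub>R g x) \<in> borel_measurable lebesgue"
        using open_W by (subst (asm) borel_measurable_restrict_space_iff) auto
    qed
    show "AE x in lebesgue. I (grad u) x = I g x"
      using eq by eventually_elim (simp add: I_def indicator_def)
  qed
  also have "integral\<^sup>L lebesgue (I g) = weak_form p V W u g \<chi>'"
    unfolding weak_form_def set_lebesgue_integral_def
  proof (rule Bochner_Integration.integral_cong[OF refl])
    fix x show "I g x = indicator W x *\<^sub>R ((norm (g x) powr (p - 2) *\<^sub>R g x) \<bullet> grad \<chi>' x + V x * \<bar>u x\<bar> powr (p - 2) * u x * \<chi>' x)"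
    proof (cases "x \<in> W")
      case True
      have "V x * \<bar>u x\<bar> powr (p - 2) * u x = V x * u x powr (p - 1)" using pw[OF True] by (simp add: mult.assoc)
      then show ?thesis by (simp only: I_def pflux_def)
    qed (simp add: I_def)
  qed
  also have "\<dots> = 0" by (rule g(2)[OF assms])
  finally show ?thesis by (simp add: I_def[abs_def] set_lebesgue_integral_def)
qed

lemma v_weak:
  assumes "\<chi>' \<in> C0_inf U" "\<And>x. 0 \<le> \<chi>' x"
  shows "0 \<le> (LINT x:U|lebesgue. pflux p (grad v x) \<bullet> grad \<chi>' x + (V x * v x powr (p - 1)) * \<chi>' x)"
proof -
  have "0 \<le> weak_form p V U v (grad v) \<chi>'" using v_super assms by (simp add: supersolution_def)
  also have "weak_form p V U v (grad v) \<chi>' = (LINT x:U|lebesgue. pflux p (grad v x) \<bullet> grad \<chi>' x + (V x * v x powr (p - 1)) * \<chi>' x)"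
    unfolding weak_form_def set_lebesgue_integral_def
  proof (rule Bochner_Integration.integral_cong[OF refl])
    fix x show "indicator U x *\<^sub>R ((norm (grad v x) powr (p - 2) *\<^sub>R grad v x) \<bullet> grad \<chi>' x + V x * \<bar>v x\<bar> powr (p - 2) * v x * \<chi>' x)
      = indicator U x *\<^sub>R (pflux p (grad v x) \<bullet> grad \<chi>' x + (V x * v x powr (p - 1)) * \<chi>' x)"
    proof (cases "x \<in> U")
      case True
      have "V x * \<bar>v x\<bar> powr (p - 2) * v x = V x * v x powr (p - 1)"
        using v_pos_U[OF True] powr_add[of "v x" "p - 2" 1] by simp
      then show ?thesis by (simp add: pflux_def)
    qed simp
  qed
  finally show ?thesis .
qed

text \<open>
  On a compact set avoiding the interior of \<open>K\<close> the points with \<open>u \<ge> c v\<close> keep away from \<open>K\<close>,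
  because \<open>u \<le> v < c v\<close> on the boundary of \<open>K\<close>.
\<close>

lemma compact_superlevel:
  assumes T: "compact T" "T \<subseteq> \<Omega>"
  defines "S \<equiv> {x \<in> T - interior K. c * v x \<le> u x}"
  shows "compact S" "S \<subseteq> U"
proof -
  have TK: "compact (T - interior K)" using T by (intro compact_diff) auto
  have cu: "continuous_on (T - interior K) u" "continuous_on (T - interior K) v"
    using T sub_W by (auto intro: continuous_on_subset[OF u_cont] continuous_on_subset[OF v_cont])
  have "closedin (top_of_set (T - interior K)) ((T - interior K) \<inter> (\<lambda>x. u x - c * v x) -` {0..})"
    by (intro continuous_closedin_preimage continuous_intros cu)
  then have "compact ((T - interior K) \<inter> (\<lambda>x. u x - c * v x) -` {0..})"
    by (rule closedin_compact[OF TK])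
  also have "(T - interior K) \<inter> (\<lambda>x. u x - c * v x) -` {0..} = S" by (auto simp: S_def)
  finally show "compact S" .
  show "S \<subseteq> U"
  proof
    fix x assume x: "x \<in> S"
    then have x': "x \<in> \<Omega> - interior K" "c * v x \<le> u x" using T by (auto simp: S_def)
    have "x \<notin> K"
    proof
      assume "x \<in> K"
      then have "x \<in> frontier K" using x' closure_subset by (auto simp: frontier_def)
      then have "u x \<le> v x" using boundary x' by auto
      then have "c * v x \<le> 1 * v x" using x' by simp
      then show False using v_pos[OF x'(1)] c by simp
    qed
    then show "x \<in> U" using x' by auto
  qed
qed

text \<open>
  The weight \<open>m = ((1 - s)\<^sup>+)\<^sup>2\<close> vanishes unless \<open>u > c v\<close>. Since \<open>grad s = s (b - a)\<close>, the gradient of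
  \<open>w\<^sup>p m\<close> contains the term \<open>k w (a - b)\<close>, whose coefficient has the sign required for monotonicity.
\<close>

definition m where "m x = pospow 2 (1 - s x)"

definition k where "k w x = pospow p (w x) * (2 * pospow 1 (1 - s x) * s x)" for w :: "'a \<Rightarrow> real"

definition \<psi> where "\<psi> w x = pospow p (w x) * m x" for w :: "'a \<Rightarrow> real"

definition G where
  "G w x = (p * pospow (p - 1) (w x) * m x) *\<^sub>R grad w x + k w x *\<^sub>R (a x - b x)" for w :: "'a \<Rightarrow> real"

lemma GDERIV_s:
  assumes "x \<in> U" shows "GDERIV s x :> s x *\<^sub>R (b x - a x)"
proof -
  have 1: "GDERIV (\<lambda>x. inverse (u x)) x :> - (inverse (u x))\<^sup>2 *\<^sub>R grad u x"
    using u_pos_U[OF assms] u_diff[OF U_W[OF assms]] by (intro GDERIV_inverse GDERIV_grad) auto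
  have "GDERIV (\<lambda>x. c * (v x * inverse (u x))) x :>
     c *\<^sub>R (v x *\<^sub>R (- (inverse (u x))\<^sup>2 *\<^sub>R grad u x) + inverse (u x) *\<^sub>R grad v x) + (v x * inverse (u x)) *\<^sub>R 0"
    by (intro GDERIV_mult[OF GDERIV_const GDERIV_mult[OF GDERIV_grad 1]] v_diff assms)
  also have "(\<lambda>x. c * (v x * inverse (u x))) = s" by (auto simp: s_def divide_inverse)
  also have "c *\<^sub>R (v x *\<^sub>R (- (inverse (u x))\<^sup>2 *\<^sub>R grad u x) + inverse (u x) *\<^sub>R grad v x) + (v x * inverse (u x)) *\<^sub>R 0
      = s x *\<^sub>R (b x - a x)"
    using u_pos_U[OF assms] v_pos_U[OF assms]
    by (simp add: s_def a_def b_def scaleR_diff_right divide_inverse power2_eq_square mult_ac)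
  finally show ?thesis .
qed

lemma GDERIV_\<psi>:
  assumes x: "x \<in> U" and w: "w differentiable (at x)"
  shows "GDERIV (\<psi> w) x :> G w x"
proof -
  have 1: "GDERIV (\<lambda>x. pospow p (w x)) x :> (p * pospow (p - 1) (w x)) *\<^sub>R grad w x"
    by (rule GDERIV_DERIV_compose[OF GDERIV_grad[OF w] DERIV_pospow[OF p]])
  have "GDERIV (\<lambda>x. 1 - s x) x :> 0 - s x *\<^sub>R (b x - a x)"
    by (rule GDERIV_diff[OF GDERIV_const GDERIV_s[OF x]])
  then have "GDERIV m x :> (2 * pospow (2 - 1) (1 - s x)) *\<^sub>R (0 - s x *\<^sub>R (b x - a x))"
    unfolding m_def[abs_def] by (rule GDERIV_DERIV_compose[OF _ DERIV_pospow]) simp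
  from GDERIV_mult[OF 1 this]
  have "GDERIV (\<psi> w) x :> pospow p (w x) *\<^sub>R ((2 * pospow (2 - 1) (1 - s x)) *\<^sub>R (0 - s x *\<^sub>R (b x - a x)))
      + m x *\<^sub>R ((p * pospow (p - 1) (w x)) *\<^sub>R grad w x)"
    by (simp only: \<psi>_def[abs_def])
  also have "pospow p (w x) *\<^sub>R ((2 * pospow (2 - 1) (1 - s x)) *\<^sub>R (0 - s x *\<^sub>R (b x - a x)))
      + m x *\<^sub>R ((p * pospow (p - 1) (w x)) *\<^sub>R grad w x) = G w x"
    by (simp add: G_def k_def scaleR_diff_right algebra_simps)
  finally show ?thesis .
qed

lemma cont_s: "continuous_on U s"
proof -
  have "\<forall>x\<in>U. u x \<noteq> 0" using u_pos_U by (metis less_irrefl)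
  then show ?thesis unfolding s_def[abs_def]
    by (intro continuous_on_divide continuous_on_mult continuous_on_const u_cont_U v_cont_U)
qed

lemma cont_m: "continuous_on U m" and cont_pos1: "continuous_on U (\<lambda>x. pospow 1 (1 - s x))"
  unfolding m_def[abs_def] by (intro continuous_on_pospow continuous_intros cont_s; simp)+

lemma m_nonneg: "0 \<le> m x" and m_le_1: "x \<in> U \<Longrightarrow> m x \<le> 1"
proof -
  show "0 \<le> m x" by (simp add: m_def pospow_nonneg)
  assume "x \<in> U"
  then have "0 \<le> s x" using u_pos_U[of x] v_pos_U[of x] c by (simp add: s_def)
  then have "max 0 (1 - s x) powr 2 \<le> 1 powr 2" by (intro powr_mono2) auto
  then show "m x \<le> 1" by (simp add: m_def pospow_def)
qed

lemma k_nonneg: "x \<in> U \<Longrightarrow> 0 \<le> k w x"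
  using u_pos_U[of x] v_pos_U[of x] c by (simp add: k_def pospow_nonneg s_def)

text \<open>
  Used with \<open>f = u\<close> and \<open>f = v\<close>. The support stays in \<open>U\<close> because of the weight \<open>m\<close>, and the factor
  \<open>f\<^sup>1\<^sup>-\<^sup>p\<close> turns the potential term into \<open>V \<psi>\<close> for both choices, so that it cancels.
\<close>

definition test_fn where
  "test_fn f w x = (if x \<in> U then \<psi> w x * f x powr (1 - p) else 0)" for f w :: "'a \<Rightarrow> real"

lemma test_fn_facts:
  assumes w: "w \<in> C0_inf \<Omega>" and f: "\<And>x. x \<in> U \<Longrightarrow> 0 < f x" "\<And>x. x \<in> U \<Longrightarrow> f differentiable (at x)"
  defines "S \<equiv> {x \<in> closure {x. w x \<noteq> 0} - interior K. c * v x \<le> u x}"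
  shows "x \<notin> S \<Longrightarrow> test_fn f w x = 0"
    and "x \<in> U \<Longrightarrow> GDERIV (test_fn f w) x :> f x powr (1 - p) *\<^sub>R (G w x - ((p - 1) * \<psi> w x) *\<^sub>R ((1 / f x) *\<^sub>R grad f x))"
    and "test_fn f w differentiable (at x)"
    and "0 \<le> test_fn f w x"
proof -
  show off: "test_fn f w x = 0" if "x \<notin> S" for x
  proof (cases "x \<in> U \<and> w x \<noteq> 0")
    case True
    then have "x \<in> closure {x. w x \<noteq> 0}" using closure_subset[of "{x. w x \<noteq> 0}"] by auto
    then have "u x < c * v x" using that True U_int[of x] by (auto simp: S_def)
    then have "1 \<le> s x" using u_pos_U[of x] True by (simp add: s_def)
    then have "m x = 0" by (simp add: m_def pospow_def)
    then show ?thesis by (simp add: test_fn_def \<psi>_def)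
  next
    case False
    then show ?thesis using p by (auto simp: test_fn_def \<psi>_def pospow_def)
  qed
  show GU: "GDERIV (test_fn f w) x :> f x powr (1 - p) *\<^sub>R (G w x - ((p - 1) * \<psi> w x) *\<^sub>R ((1 / f x) *\<^sub>R grad f x))"
    if x: "x \<in> U" for x
  proof -
    have "((\<lambda>t. t powr (1 - p)) has_real_derivative (1 - p) * f x powr (1 - p - 1)) (at (f x))"
      using f(1)[OF x] by (rule has_real_derivative_powr)
    from GDERIV_DERIV_compose[OF GDERIV_grad[OF f(2)[OF x]] this]
    have 1: "GDERIV (\<lambda>x. f x powr (1 - p)) x :> ((1 - p) * f x powr (1 - p - 1)) *\<^sub>R grad f x" .
    have "GDERIV (\<lambda>x. \<psi> w x * f x powr (1 - p)) x :>
       \<psi> w x *\<^sub>R (((1 - p) * f x powr (1 - p - 1)) *\<^sub>R grad f x) + f x powr (1 - p) *\<^sub>R G w x"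
      by (rule GDERIV_mult[OF GDERIV_\<psi>[OF x C0_inf_differentiable[OF w]] 1])
    also have "f x powr (1 - p - 1) = f x powr (1 - p) * (1 / f x)"
      using powr_diff[of "f x" "1 - p" 1] f(1)[OF x] by simp
    also have "\<psi> w x *\<^sub>R (((1 - p) * (f x powr (1 - p) * (1 / f x))) *\<^sub>R grad f x) + f x powr (1 - p) *\<^sub>R G w x
      = f x powr (1 - p) *\<^sub>R (G w x - ((p - 1) * \<psi> w x) *\<^sub>R ((1 / f x) *\<^sub>R grad f x))"
    proof -
      have "\<psi> w x * ((1 - p) * (q * (1 / f x))) = - (q * ((p - 1) * \<psi> w x * (1 / f x)))" for q
        by (simp add: left_diff_distrib right_diff_distrib mult_ac diff_divide_distrib)
      then show ?thesis by (simp only: scaleR_scaleR scaleR_diff_right scaleR_minus_left) simp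
    qed
    finally show ?thesis
      by (rule GDERIV_transform_open[OF _ open_U x]) (simp add: test_fn_def)
  qed
  show "test_fn f w differentiable (at x)"
  proof (cases "x \<in> U")
    case True
    then show ?thesis using GU by (blast intro: GDERIV_imp_differentiable)
  next
    case False
    have S: "compact S" "S \<subseteq> U"
      unfolding S_def using compact_superlevel C0_inf_compact[OF w] C0_inf_subset[OF w] by blast+
    have "GDERIV (test_fn f w) x :> 0"
      by (rule GDERIV_eq_0_on_open[where S="- S"]) (use False S off compact_imp_closed in auto)
    then show ?thesis by (rule GDERIV_imp_differentiable)
  qed
  show "0 \<le> test_fn f w x" by (simp add: test_fn_def \<psi>_def pospow_nonneg m_nonneg)
qed

text \<open>
  Subtract the inequality for \<open>v\<close> from the equation for \<open>u\<close>, each with its own test function. The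
  integrand \<open>E\<close> is a sum of two nonnegative terms: the Picone remainder with respect to \<open>v\<close>, and the
  monotone term that the weight \<open>m\<close> contributes. What remains on the other side is at most the remainder with
  respect to \<open>u\<close>, that is \<open>p L(w,u)\<close>.
\<close>

lemma key_inequality:
  assumes w: "w \<in> C0_inf \<Omega>" "\<And>x. 0 \<le> w x"
  defines "P \<equiv> \<lambda>x. indicator U x * picone p (w x *\<^sub>R a x) (grad w x)"
    and "E \<equiv> \<lambda>x. indicator U x * (m x * picone p (w x *\<^sub>R b x) (grad w x)
                  + k w x * ((pflux p (a x) - pflux p (b x)) \<bullet> (a x - b x)))"
  shows "integrable lborel P" and "integrable lborel E" and "(LINT x|lborel. E x) \<le> (LINT x|lborel. P x)"
proof -
  have UW: "U \<subseteq> W" using U_W by blast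
  have Ub[measurable]: "U \<in> sets borel" using open_U by simp
  let ?Sw = "closure {x. w x \<noteq> 0}"
  define T where "T = ?Sw - interior K"
  define S where "S = {x \<in> ?Sw - interior K. c * v x \<le> u x}"
  have Sw: "compact ?Sw" "?Sw \<subseteq> \<Omega>" using C0_inf_compact[OF w(1)] C0_inf_subset[OF w(1)] .
  have T: "compact T" "T \<subseteq> W" using Sw sub_W by (auto simp: T_def intro!: compact_diff)
  have S: "compact S" "S \<subseteq> U" unfolding S_def by (rule compact_superlevel[OF Sw])+
  have off_w: "w x = 0" "grad w x = 0" if "x \<in> U" "x \<notin> T" for x
    using that closure_subset[of "{x. w x \<noteq> 0}"] grad_eq_0_off_support[of x w] U_int[OF that(1)] by (auto simp: T_def)
  have T_m[measurable]: "T \<in> sets borel" using T by (intro borel_compact)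
  have wm[measurable]: "w \<in> borel_measurable borel" "grad w \<in> borel_measurable borel"
    using C0_inf_measurable[OF w(1)] C0_inf_grad_measurable[OF w(1)] .
  have unz: "\<And>A. A \<subseteq> W \<Longrightarrow> \<forall>x\<in>A. u x \<noteq> 0" using u_pos by (metis less_irrefl subsetD)
  have vnz: "\<And>A. A \<subseteq> U \<Longrightarrow> \<forall>x\<in>A. v x \<noteq> 0" using v_pos_U by (metis less_irrefl subsetD)
  have Pm: "P \<in> borel_measurable borel"
  proof -
    have "(\<lambda>x. indicator U x *\<^sub>R (1 / u x)) \<in> borel_measurable borel"
      by (rule borel_measurable_continuous_on_indicator[OF Ub])
         (intro continuous_on_divide continuous_on_const u_cont_U unz UW)
    note [measurable] = this grad_u_measurable
    have "(\<lambda>x. indicator U x * picone p (w x *\<^sub>R ((indicator U x *\<^sub>R (1 / u x)) *\<^sub>R (indicator W x *\<^sub>R grad u x))) (grad w x)) \<in> borel_measurable borel"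
      by (intro borel_measurable_times picone_measurable p) measurable
    also have "(\<lambda>x. indicator U x * picone p (w x *\<^sub>R ((indicator U x *\<^sub>R (1 / u x)) *\<^sub>R (indicator W x *\<^sub>R grad u x))) (grad w x)) = P"
    proof
      fix x show "indicator U x * picone p (w x *\<^sub>R ((indicator U x *\<^sub>R (1 / u x)) *\<^sub>R (indicator W x *\<^sub>R grad u x))) (grad w x) = P x"
        using UW by (cases "x \<in> U") (auto simp: P_def a_def)
    qed
    finally show ?thesis .
  qed
  have "continuous_on T (\<lambda>x. w x / u x)"
    using T by (intro continuous_on_divide C0_inf_continuous[OF w(1)] unz continuous_on_subset[OF u_cont])
  then obtain M where M: "0 \<le> M" "\<And>x. x \<in> T \<Longrightarrow> norm (w x / u x) \<le> M"
    using continuous_on_compact_bounded[OF T(1)] by blast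
  show iP: "integrable lborel P"
  proof (rule Bochner_Integration.integrable_bound)
    have "integrable lborel (\<lambda>x. norm (grad w x) powr p)"
    proof (rule integrable_compact_support[OF Sw(1)])
      show "continuous_on ?Sw (\<lambda>x. norm (grad w x) powr p)"
        using p by (intro continuous_on_powr' continuous_on_norm C0_inf_continuous_grad[OF w(1)] continuous_on_const) auto
      show "norm (grad w x) powr p = 0" if "x \<notin> ?Sw" for x
        using grad_eq_0_off_support[OF that] by simp
    qed
    then show "integrable lborel (\<lambda>x. 2 * (norm (grad w x) powr p + (p - 1) * (M powr p * (indicator T x * norm (grad u x) powr p))))"
      using grad_u_Lp[OF T] by (intro integrable_mult_right Bochner_Integration.integrable_add)
    show "P \<in> borel_measurable lborel" using Pm by simp
    show "AE x in lborel. norm (P x) \<le> norm (2 * (norm (grad w x) powr p + (p - 1) * (M powr p * (indicator T x * norm (grad u x) powr p))))"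
    proof (rule AE_I2)
      fix x
      show "norm (P x) \<le> norm (2 * (norm (grad w x) powr p + (p - 1) * (M powr p * (indicator T x * norm (grad u x) powr p))))"
      proof (cases "x \<in> U \<and> x \<in> T")
        case True
        have "norm (w x *\<^sub>R a x) = norm (w x / u x) * norm (grad u x)" by (simp add: a_def)
        also have "\<dots> \<le> M * norm (grad u x)" using M(2)[of x] True by (intro mult_right_mono) auto
        finally have "norm (w x *\<^sub>R a x) powr p \<le> (M * norm (grad u x)) powr p" using p by (intro powr_mono2) auto
        also have "\<dots> = M powr p * norm (grad u x) powr p" using M by (simp add: powr_mult)
        finally have le: "norm (w x *\<^sub>R a x) powr p \<le> M powr p * norm (grad u x) powr p" .
        have "norm (P x) = picone p (w x *\<^sub>R a x) (grad w x)" using True picone_nonneg[OF p, of "w x *\<^sub>R a x" "grad w x"] by (simp add: P_def)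
        also have "\<dots> \<le> 2 * (norm (grad w x) powr p + (p - 1) * norm (w x *\<^sub>R a x) powr p)" by (rule picone_le[OF p])
        also have "\<dots> \<le> 2 * (norm (grad w x) powr p + (p - 1) * (M powr p * norm (grad u x) powr p))"
          using le p by (intro mult_left_mono add_left_mono) auto
        finally show ?thesis using True p by simp
      next
        case False
        have "P x = 0"
        proof (cases "x \<in> U")
          case True
          then have "x \<notin> T" using False by simp
          then show ?thesis using off_w[OF True] p by (simp add: P_def picone_def pflux_def)
        qed (simp add: P_def)
        then show ?thesis by simp
      qed
    qed
  qed
  let ?\<phi>u = "test_fn u w" and ?\<phi>v = "test_fn v w"
  have ud: "u differentiable (at x)" if "x \<in> U" for x using u_diff U_W that by blast
  have tu: "\<And>x. x \<notin> S \<Longrightarrow> test_fn u w x = 0"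
    "\<And>x. x \<in> U \<Longrightarrow> GDERIV (test_fn u w) x :> u x powr (1 - p) *\<^sub>R (G w x - ((p - 1) * \<psi> w x) *\<^sub>R ((1 / u x) *\<^sub>R grad u x))"
    "\<And>x. test_fn u w differentiable (at x)" "\<And>x. 0 \<le> test_fn u w x"
    unfolding S_def by (rule test_fn_facts[OF w(1) u_pos_U ud]; assumption?)+
  have tv: "\<And>x. x \<notin> S \<Longrightarrow> test_fn v w x = 0"
    "\<And>x. x \<in> U \<Longrightarrow> GDERIV (test_fn v w) x :> v x powr (1 - p) *\<^sub>R (G w x - ((p - 1) * \<psi> w x) *\<^sub>R ((1 / v x) *\<^sub>R grad v x))"
    "\<And>x. test_fn v w differentiable (at x)" "\<And>x. 0 \<le> test_fn v w x"
    unfolding S_def by (rule test_fn_facts[OF w(1) v_pos_U v_diff]; assumption?)+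
  have cU: "continuous_on S u" "continuous_on S v" "continuous_on S (grad v)" "continuous_on S m"
    "continuous_on S s" "continuous_on S (\<lambda>x. pospow 1 (1 - s x))"
    using S by (auto intro: continuous_on_subset[OF u_cont_U] continuous_on_subset[OF v_cont_U]
        continuous_on_subset[OF v_grad_cont] continuous_on_subset[OF cont_m] continuous_on_subset[OF cont_s]
        continuous_on_subset[OF cont_pos1])
  have SW: "S \<subseteq> W" using S UW by blast
  have cont_b: "continuous_on S b" unfolding b_def[abs_def]
    using S by (intro continuous_on_scaleR continuous_on_divide continuous_on_const cU vnz)
  have cont_ww: "continuous_on S (\<lambda>x. pospow p (w x))" "continuous_on S (\<lambda>x. pospow (p - 1) (w x))"
    using p by (intro continuous_on_pospow C0_inf_continuous[OF w(1)]; simp)+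
  have cont_k: "continuous_on S (k w)" unfolding k_def[abs_def]
    by (intro continuous_on_mult continuous_on_const cU cont_ww)
  have cont_\<psi>: "continuous_on S (\<psi> w)" unfolding \<psi>_def[abs_def]
    by (intro continuous_on_mult cU cont_ww)
  have cont_pu: "continuous_on S (\<lambda>x. u x powr (1 - p))" "continuous_on S (\<lambda>x. v x powr (1 - p))"
    by (intro continuous_on_powr cU continuous_on_const unz[OF SW] vnz[OF S(2)])+
  have q: "integrable lborel (\<lambda>x. indicator S x * norm (grad u x) powr p)" by (rule grad_u_Lp[OF S(1) SW])
  have g\<phi>u: "integrable lborel (\<lambda>x. norm (grad ?\<phi>u x) powr p)"
  proof (rule integrable_grad_powr[OF p tu(3) tu(1) S(1) _ _ _ q])
    let ?X = "\<lambda>x. u x powr (1 - p) *\<^sub>R ((p * pospow (p - 1) (w x) * m x) *\<^sub>R grad w x - k w x *\<^sub>R b x)"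
    let ?k = "\<lambda>x. u x powr (1 - p) * ((k w x - (p - 1) * \<psi> w x) / u x)"
    show "continuous_on S ?X"
      by (intro continuous_on_scaleR continuous_on_diff continuous_on_mult continuous_on_const cU cont_b cont_ww cont_k cont_pu
          C0_inf_continuous_grad[OF w(1)])
    show "continuous_on S ?k"
      using SW by (intro continuous_on_mult continuous_on_divide continuous_on_diff continuous_on_const cU cont_k cont_\<psi> cont_pu unz)
    show "grad ?\<phi>u x = ?X x + ?k x *\<^sub>R grad u x" if "x \<in> S" for x
    proof -
      have x: "x \<in> U" using that S by blast
      show ?thesis unfolding grad_eqI[OF tu(2)[OF x]]
        by (simp add: G_def a_def algebra_simps diff_divide_distrib add_divide_distrib)
    qed
  qed
  have g\<phi>v: "integrable lborel (\<lambda>x. norm (grad ?\<phi>v x) powr p)"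
  proof (rule integrable_grad_powr[OF p tv(3) tv(1) S(1) _ _ _ q])
    let ?X = "\<lambda>x. v x powr (1 - p) *\<^sub>R ((p * pospow (p - 1) (w x) * m x) *\<^sub>R grad w x - (k w x + (p - 1) * \<psi> w x) *\<^sub>R b x)"
    let ?k = "\<lambda>x. v x powr (1 - p) * (k w x / u x)"
    show "continuous_on S ?X"
      by (intro continuous_on_scaleR continuous_on_diff continuous_on_add continuous_on_mult continuous_on_const cU cont_b cont_ww cont_k cont_pu
          C0_inf_continuous_grad[OF w(1)] cont_\<psi>)
    show "continuous_on S ?k"
      using SW by (intro continuous_on_mult continuous_on_divide cU cont_k cont_pu unz)
    show "grad ?\<phi>v x = ?X x + ?k x *\<^sub>R grad u x" if "x \<in> S" for x
    proof -
      have x: "x \<in> U" using that S by blast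
      show ?thesis unfolding grad_eqI[OF tv(2)[OF x]] b_def[symmetric]
        by (simp add: G_def a_def algebra_simps)
    qed
  qed
  define Fu where "Fu x = pflux p (indicator W x *\<^sub>R grad u x)" for x
  define Fv where "Fv x = pflux p (indicator U x *\<^sub>R grad v x)" for x
  have Fm: "Fu \<in> borel_measurable borel" "Fv \<in> borel_measurable borel"
    unfolding Fu_def[abs_def] Fv_def[abs_def]
    by (rule measurable_compose[OF _ pflux_measurable[OF p]], rule grad_u_measurable grad_v_measurable)+
  have \<alpha>m: "(\<lambda>x. norm (indicator W x *\<^sub>R grad u x)) \<in> borel_measurable borel"
    "(\<lambda>x. norm (indicator U x *\<^sub>R grad v x)) \<in> borel_measurable borel"
    using measurable_compose[OF grad_u_measurable borel_measurable_norm]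
      measurable_compose[OF grad_v_measurable borel_measurable_norm] .
  have \<alpha>u: "integrable lborel (\<lambda>x. indicator T' x * norm (indicator W x *\<^sub>R grad u x) powr p)" if "compact T'" "T' \<subseteq> W" for T'
  proof -
    have "(\<lambda>x. indicator T' x * norm (indicator W x *\<^sub>R grad u x) powr p) = (\<lambda>x. indicator T' x * norm (grad u x) powr p)"
      using that by (auto simp: indicator_def fun_eq_iff)
    then show ?thesis using grad_u_Lp[OF that] by simp
  qed
  have \<alpha>v: "integrable lborel (\<lambda>x. indicator T' x * norm (indicator U x *\<^sub>R grad v x) powr p)" if T': "compact T'" "T' \<subseteq> U" for T'
  proof -
    have "continuous_on T' (\<lambda>x. norm (grad v x) powr p)"
      using p T' by (intro continuous_on_powr' continuous_on_norm continuous_on_subset[OF v_grad_cont] continuous_on_const) auto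
    from borel_integrable_compact[OF T'(1) this]
    have "integrable lborel (\<lambda>x. indicator T' x * norm (grad v x) powr p)" by simp
    also have "(\<lambda>x. indicator T' x * norm (grad v x) powr p) = (\<lambda>x. indicator T' x * norm (indicator U x *\<^sub>R grad v x) powr p)"
      using that by (auto simp: indicator_def fun_eq_iff)
    finally show ?thesis .
  qed
  have cu: "integrable lebesgue (\<lambda>x. indicator T' x * (V x * u x powr (p - 1)))" if T': "compact T'" "T' \<subseteq> W" for T'
  proof (rule Linf_loc_integrable[OF V open_\<Omega> T'(1)])
    show "T' \<subseteq> \<Omega>" using T' W_sub by blast
    show "continuous_on T' (\<lambda>x. u x powr (p - 1))"
      using T' by (intro continuous_on_powr continuous_on_subset[OF u_cont] continuous_on_const unz)
  qed
  have cv: "integrable lebesgue (\<lambda>x. indicator T' x * (V x * v x powr (p - 1)))" if T': "compact T'" "T' \<subseteq> U" for T'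
  proof (rule Linf_loc_integrable[OF V open_\<Omega> T'(1)])
    show "T' \<subseteq> \<Omega>" using T' by blast
    show "continuous_on T' (\<lambda>x. v x powr (p - 1))"
      using T' by (intro continuous_on_powr continuous_on_subset[OF v_cont_U] continuous_on_const vnz)
  qed
  have weak_u: "(LINT x:W|lebesgue. Fu x \<bullet> grad \<chi>' x + (V x * u x powr (p - 1)) * \<chi>' x) = 0" if "\<chi>' \<in> C0_inf W" for \<chi>'
  proof -
    have "(LINT x:W|lebesgue. Fu x \<bullet> grad \<chi>' x + (V x * u x powr (p - 1)) * \<chi>' x)
      = (LINT x:W|lebesgue. pflux p (grad u x) \<bullet> grad \<chi>' x + (V x * u x powr (p - 1)) * \<chi>' x)"
      unfolding set_lebesgue_integral_def
      by (rule Bochner_Integration.integral_cong[OF refl]) (simp add: Fu_def indicator_def)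
    then show ?thesis using u_weak[OF that] by simp
  qed
  have weak_v: "0 \<le> (LINT x:U|lebesgue. Fv x \<bullet> grad \<chi>' x + (V x * v x powr (p - 1)) * \<chi>' x)"
    if "\<chi>' \<in> C0_inf U" "\<And>x. 0 \<le> \<chi>' x" for \<chi>'
  proof -
    have "(LINT x:U|lebesgue. Fv x \<bullet> grad \<chi>' x + (V x * v x powr (p - 1)) * \<chi>' x)
      = (LINT x:U|lebesgue. pflux p (grad v x) \<bullet> grad \<chi>' x + (V x * v x powr (p - 1)) * \<chi>' x)"
      unfolding set_lebesgue_integral_def
      by (rule Bochner_Integration.integral_cong[OF refl]) (simp add: Fv_def indicator_def)
    then show ?thesis using v_weak[OF that] by simp
  qed
  have nFu: "norm (Fu x) \<le> norm (indicator W x *\<^sub>R grad u x) powr (p - 1)" for x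
    by (simp only: Fu_def norm_pflux[OF p] order_refl)
  have nFv: "norm (Fv x) \<le> norm (indicator U x *\<^sub>R grad v x) powr (p - 1)" for x
    by (simp only: Fv_def norm_pflux[OF p] order_refl)
  have weak_u1: "0 \<le> (LINT x:W|lebesgue. Fu x \<bullet> grad \<chi>' x + (V x * u x powr (p - 1)) * \<chi>' x)" if "\<chi>' \<in> C0_inf W" for \<chi>'
    using weak_u[OF that] by simp
  have ext_v1: "integrable lborel (\<lambda>x. Fv x \<bullet> grad ?\<phi>v x)"
    by (rule test_function_extension(1)[OF p open_U S Fm(2) \<alpha>m(2) norm_ge_zero \<alpha>v nFv cv weak_v tv(3) tv(4) tv(1) g\<phi>v])
  have ext_v2: "0 \<le> (LINT x|lborel. Fv x \<bullet> grad ?\<phi>v x) + (LINT x|lebesgue. (V x * v x powr (p - 1)) * ?\<phi>v x)"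
    by (rule test_function_extension(3)[OF p open_U S Fm(2) \<alpha>m(2) norm_ge_zero \<alpha>v nFv cv weak_v tv(3) tv(4) tv(1) g\<phi>v])
  have ext_u: "integrable lborel (\<lambda>x. Fu x \<bullet> grad ?\<phi>u x)"
    by (rule test_function_extension(1)[OF p open_W S(1) SW Fm(1) \<alpha>m(1) norm_ge_zero \<alpha>u nFu cu weak_u1 tu(3) tu(4) tu(1) g\<phi>u])
  \<comment> \<open>The equation for \<open>u\<close> provides the inequality with the opposite sign as well.\<close>
  have neg: "0 \<le> (LINT x|lborel. (- Fu x) \<bullet> grad ?\<phi>u x) + (LINT x|lebesgue. (- (V x * u x powr (p - 1))) * ?\<phi>u x)"
  proof (rule test_function_extension(3)[OF p open_W S(1) SW _ \<alpha>m(1) norm_ge_zero \<alpha>u _ _ _ tu(3) tu(4) tu(1) g\<phi>u])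
    show "(\<lambda>x. - Fu x) \<in> borel_measurable borel" using Fm(1) by simp
    show "norm (- Fu x) \<le> norm (indicator W x *\<^sub>R grad u x) powr (p - 1)" for x using nFu[of x] by simp
    show "integrable lebesgue (\<lambda>x. indicator T' x * (- (V x * u x powr (p - 1))))" if "compact T'" "T' \<subseteq> W" for T'
      using integrable_minus[OF cu[OF that]] by simp
    show "0 \<le> (LINT x:W|lebesgue. (- Fu x) \<bullet> grad \<chi>' x + (- (V x * u x powr (p - 1))) * \<chi>' x)" if "\<chi>' \<in> C0_inf W" for \<chi>'
    proof -
      have "(LINT x:W|lebesgue. (- Fu x) \<bullet> grad \<chi>' x + (- (V x * u x powr (p - 1))) * \<chi>' x)
        = (LINT x|lebesgue. - (indicator W x *\<^sub>R (Fu x \<bullet> grad \<chi>' x + (V x * u x powr (p - 1)) * \<chi>' x)))"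
        unfolding set_lebesgue_integral_def
        by (rule Bochner_Integration.integral_cong[OF refl]) (simp add: indicator_def)
      also have "\<dots> = - (LINT x:W|lebesgue. Fu x \<bullet> grad \<chi>' x + (V x * u x powr (p - 1)) * \<chi>' x)"
        by (simp only: Bochner_Integration.integral_minus set_lebesgue_integral_def)
      finally show ?thesis using weak_u[OF that] by simp
    qed
  qed
  have Vterm: "(V x * u x powr (p - 1)) * ?\<phi>u x = (V x * v x powr (p - 1)) * ?\<phi>v x" for x
  proof (cases "x \<in> U")
    case True
    have "u x powr (p - 1) * u x powr (1 - p) = 1" "v x powr (p - 1) * v x powr (1 - p) = 1"
      using u_pos_U[OF True] v_pos_U[OF True] by (simp_all add: powr_add[symmetric])
    then have "u x powr (p - 1) * (\<psi> w x * u x powr (1 - p)) = v x powr (p - 1) * (\<psi> w x * v x powr (1 - p))"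
      by (metis mult.left_commute)
    then have "u x powr (p - 1) * ?\<phi>u x = v x powr (p - 1) * ?\<phi>v x"
      using True by (simp only: test_fn_def if_True)
    then show ?thesis by (simp only: mult.assoc)
  next
    case False
    then show ?thesis by (simp only: test_fn_def if_False mult_zero_right)
  qed
  define D where "D x = Fu x \<bullet> grad ?\<phi>u x - Fv x \<bullet> grad ?\<phi>v x" for x
  have iD: "integrable lborel D" unfolding D_def[abs_def]
    using ext_u ext_v1 by (rule Bochner_Integration.integrable_diff)
  have D0: "(LINT x|lborel. D x) \<le> 0"
  proof -
    have "(LINT x|lborel. D x) = (LINT x|lborel. Fu x \<bullet> grad ?\<phi>u x) - (LINT x|lborel. Fv x \<bullet> grad ?\<phi>v x)"
      unfolding D_def by (rule Bochner_Integration.integral_diff[OF ext_u ext_v1])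
    moreover have "(LINT x|lborel. (- Fu x) \<bullet> grad ?\<phi>u x) = - (LINT x|lborel. Fu x \<bullet> grad ?\<phi>u x)"
      by (simp only: inner_minus_left Bochner_Integration.integral_minus)
    moreover have "(LINT x|lebesgue. (- (V x * u x powr (p - 1))) * ?\<phi>u x) = - (LINT x|lebesgue. (V x * v x powr (p - 1)) * ?\<phi>v x)"
      by (simp only: mult_minus_left Vterm Bochner_Integration.integral_minus)
    ultimately show ?thesis using neg ext_v2 by linarith
  qed
  have scale: "pflux p g \<bullet> (f powr (1 - p) *\<^sub>R Y) = pflux p ((1 / f) *\<^sub>R g) \<bullet> Y" if "0 < f" for f :: real and g Y :: 'a
  proof -
    have "(1 / f) powr (p - 1) = f powr (1 - p)"
      using that powr_minus[of f "p - 1"] powr_divide[of 1 f "p - 1"] by (simp add: inverse_eq_divide)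
    then show ?thesis using that by (simp add: pflux_scaleR)
  qed
  have ED: "E x = D x + (indicator U x * m x) * P x" for x
  proof (cases "x \<in> U")
    case True
    then have xW: "x \<in> W" using UW by blast
    have \<psi>x: "\<psi> w x = w x powr p * m x" using w(2)[of x] by (simp add: \<psi>_def pospow_eq)
    have Fux: "Fu x = pflux p (grad u x)" using xW by (simp add: Fu_def)
    have "Fu x \<bullet> grad ?\<phi>u x = pflux p ((1 / u x) *\<^sub>R grad u x) \<bullet> (G w x - ((p - 1) * \<psi> w x) *\<^sub>R ((1 / u x) *\<^sub>R grad u x))"
      unfolding Fux grad_eqI[OF tu(2)[OF True]] by (rule scale[OF u_pos_U[OF True]])
    then have Fu_eq: "Fu x \<bullet> grad ?\<phi>u x = pflux p (a x) \<bullet> (G w x - ((p - 1) * (w x powr p * m x)) *\<^sub>R a x)"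
      by (simp only: a_def[symmetric] \<psi>x)
    have Fvx: "Fv x = pflux p (grad v x)" using True by (simp add: Fv_def)
    have "Fv x \<bullet> grad ?\<phi>v x = pflux p ((1 / v x) *\<^sub>R grad v x) \<bullet> (G w x - ((p - 1) * \<psi> w x) *\<^sub>R ((1 / v x) *\<^sub>R grad v x))"
      unfolding Fvx grad_eqI[OF tv(2)[OF True]] by (rule scale[OF v_pos_U[OF True]])
    then have Fv_eq: "Fv x \<bullet> grad ?\<phi>v x = pflux p (b x) \<bullet> (G w x - ((p - 1) * (w x powr p * m x)) *\<^sub>R b x)"
      by (simp only: b_def[symmetric] \<psi>x)
    have Gx: "G w x = (p * w x powr (p - 1) * m x) *\<^sub>R grad w x + k w x *\<^sub>R (a x - b x)"
      using w(2)[of x] by (simp add: G_def pospow_eq)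
    have "D x = m x * picone p (w x *\<^sub>R b x) (grad w x) + k w x * ((pflux p (a x) - pflux p (b x)) \<bullet> (a x - b x))
        - m x * picone p (w x *\<^sub>R a x) (grad w x)"
      unfolding D_def Fu_eq Fv_eq by (rule picone_identity[OF p w(2) Gx])
    then show ?thesis using True by (simp add: E_def P_def)
  next
    case False
    have op: "open (- S)" "x \<in> - S" using False S compact_imp_closed[OF S(1)] by auto
    have "GDERIV ?\<phi>u x :> 0" "GDERIV ?\<phi>v x :> 0"
      by (rule GDERIV_eq_0_on_open[OF op], use tu(1) in blast, rule GDERIV_eq_0_on_open[OF op], use tv(1) in blast)
    then have "grad ?\<phi>u x = 0" "grad ?\<phi>v x = 0" by (simp_all add: grad_eqI)
    then show ?thesis using False by (simp add: E_def P_def D_def)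
  qed
  have imP: "integrable lborel (\<lambda>x. (indicator U x * m x) * P x)"
  proof (rule integrable_bounded_mult[OF iP])
    have "(\<lambda>x. indicator U x *\<^sub>R m x) \<in> borel_measurable borel"
      by (rule borel_measurable_continuous_on_indicator[OF Ub cont_m])
    then show "(\<lambda>x. indicator U x * m x) \<in> borel_measurable lborel" by simp
    show "\<bar>indicator U x * m x\<bar> \<le> 1" for x
      using m_nonneg[of x] m_le_1[of x] by (cases "x \<in> U") auto
  qed
  have E_eq: "E = (\<lambda>x. D x + (indicator U x * m x) * P x)" using ED by (rule ext)
  show "integrable lborel E" unfolding E_eq using iD imP by (rule Bochner_Integration.integrable_add)
  have "(LINT x|lborel. E x) = (LINT x|lborel. D x) + (LINT x|lborel. (indicator U x * m x) * P x)"
    unfolding E_eq by (rule Bochner_Integration.integral_add[OF iD imP])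
  also have "\<dots> \<le> 0 + (LINT x|lborel. P x)"
  proof (intro add_mono D0 integral_mono imP iP)
    fix x show "(indicator U x * m x) * P x \<le> P x"
      using m_nonneg[of x] m_le_1[of x] picone_nonneg[OF p, of "w x *\<^sub>R a x" "grad w x"]
      by (cases "x \<in> U") (auto simp: P_def mult_left_le_one_le)
  qed
  finally show "(LINT x|lborel. E x) \<le> (LINT x|lborel. P x)" by simp
qed

end

lemma continuous_on_compact_pos_bound:
  fixes f :: "'a::topological_space \<Rightarrow> real"
  assumes "compact S" "continuous_on S f" "\<And>x. x \<in> S \<Longrightarrow> 0 < f x"
  obtains c where "0 < c" "\<And>x. x \<in> S \<Longrightarrow> c \<le> f x"
proof (cases "S = {}")
  case True then show thesis using that[of 1] by simp
next
  case False
  then obtain x0 where "x0 \<in> S" "\<And>x. x \<in> S \<Longrightarrow> f x0 \<le> f x"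
    using continuous_attains_inf[OF assms(1) _ assms(2)] by metis
  then show thesis using that[of "f x0"] assms(3) by blast
qed

context comparison_pair
begin

lemma a_measurable: "(\<lambda>x. indicator U x *\<^sub>R a x) \<in> borel_measurable borel"
proof -
  have UW: "U \<subseteq> W" using U_W by blast
  have Ub: "U \<in> sets borel" using open_U by simp
  have "(\<lambda>x. indicator U x *\<^sub>R (1 / u x)) \<in> borel_measurable borel"
    by (rule borel_measurable_continuous_on_indicator[OF Ub])
       (use u_pos_U in \<open>intro continuous_on_divide continuous_on_const u_cont_U; metis less_irrefl\<close>)
  from borel_measurable_scaleR[OF this grad_u_measurable]
  have "(\<lambda>x. (indicator U x *\<^sub>R (1 / u x)) *\<^sub>R (indicator W x *\<^sub>R grad u x)) \<in> borel_measurable borel" .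
  also have "(\<lambda>x. (indicator U x *\<^sub>R (1 / u x)) *\<^sub>R (indicator W x *\<^sub>R grad u x)) = (\<lambda>x. indicator U x *\<^sub>R a x)"
  proof
    fix x show "(indicator U x *\<^sub>R (1 / u x)) *\<^sub>R (indicator W x *\<^sub>R grad u x) = indicator U x *\<^sub>R a x"
      using UW by (cases "x \<in> U") (auto simp: a_def)
  qed
  finally show ?thesis .
qed

lemma b_continuous: "continuous_on U b"
  unfolding b_def[abs_def]
  using v_pos_U by (intro continuous_on_scaleR continuous_on_divide continuous_on_const v_cont_U v_grad_cont) (metis less_irrefl)

lemma b_measurable: "(\<lambda>x. indicator U x *\<^sub>R b x) \<in> borel_measurable borel"
  using open_U by (intro borel_measurable_continuous_on_indicator b_continuous) auto

text \<open>
  By \<open>key_inequality\<close> the integrals of the Picone remainders with respect to \<open>v\<close> and of the monotone terms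
  over the ball tend to zero. The former make \<open>w\<^sub>j / v\<close> nearly constant on the ball, so that its mass cannot
  concentrate where the monotone term vanishes, and the latter then force this term to vanish almost everywhere.
\<close>

lemma log_gradients_agree_AE:
  fixes w :: "nat \<Rightarrow> 'a \<Rightarrow> real"
  assumes r: "0 < r" and BU: "cball x0 r \<subseteq> U" and above: "\<And>x. x \<in> cball x0 r \<Longrightarrow> c * v x < u x"
    and w: "\<And>j. w j \<in> C0_inf \<Omega>" "\<And>j x. 0 \<le> w j x" "\<And>j. (LINT x:ball x0 r|lebesgue. \<bar>w j x\<bar> powr p) = 1"
    and lim: "(\<lambda>j. LINT x|lborel. indicator U x * picone p (w j x *\<^sub>R a x) (grad (w j) x)) \<longlonglongrightarrow> 0"
  shows "AE x in lborel. x \<in> ball x0 r \<longrightarrow> a x = b x"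
proof -
  define B where "B = ball x0 r"
  have BC: "B \<subseteq> cball x0 r" by (auto simp: B_def)
  have BU': "x \<in> U" if "x \<in> B" for x using that BC BU by blast
  have Bm[measurable]: "B \<in> sets borel" by (simp add: B_def)
  have cpt: "compact (cball x0 r)" by simp
  have s01: "0 < s x" "s x < 1" if "x \<in> cball x0 r" for x
  proof -
    have x: "x \<in> U" using that BU by blast
    show "0 < s x" using u_pos_U[OF x] v_pos_U[OF x] c by (simp add: s_def)
    show "s x < 1" using u_pos_U[OF x] above[OF that] by (simp add: s_def)
  qed
  obtain m0 where m0: "0 < m0" "\<And>x. x \<in> cball x0 r \<Longrightarrow> m0 \<le> m x"
  proof (rule continuous_on_compact_pos_bound[OF cpt continuous_on_subset[OF cont_m BU]])
    show "0 < m x" if "x \<in> cball x0 r" for x using s01[OF that] by (simp add: m_def pospow_def)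
  qed (use that in blast)
  obtain \<kappa> where \<kappa>: "0 < \<kappa>" "\<And>x. x \<in> cball x0 r \<Longrightarrow> \<kappa> \<le> 2 * pospow 1 (1 - s x) * s x"
  proof (rule continuous_on_compact_pos_bound[OF cpt])
    show "continuous_on (cball x0 r) (\<lambda>x. 2 * pospow 1 (1 - s x) * s x)"
      by (intro continuous_on_mult continuous_on_const continuous_on_subset[OF cont_pos1 BU] continuous_on_subset[OF cont_s BU])
    show "0 < 2 * pospow 1 (1 - s x) * s x" if "x \<in> cball x0 r" for x using s01[OF that] by (simp add: pospow_def)
  qed (use that in blast)
  obtain v0 where v0: "0 < v0" "\<And>x. x \<in> cball x0 r \<Longrightarrow> v0 \<le> v x"
    by (rule continuous_on_compact_pos_bound[OF cpt continuous_on_subset[OF v_cont_U BU]]) (use v_pos_U BU in blast)+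
  obtain v1 where v1: "0 \<le> v1" "\<And>x. x \<in> cball x0 r \<Longrightarrow> norm (v x) \<le> v1"
    using continuous_on_compact_bounded[OF cpt continuous_on_subset[OF v_cont_U BU]] by blast
  have "x0 \<in> cball x0 r" using r by simp
  from v1(2)[OF this] v0(2)[OF this] v0(1) have v1pos: "0 < v1" by simp
  obtain M where M: "0 \<le> M" "\<And>x. x \<in> cball x0 r \<Longrightarrow> norm (b x) \<le> M"
    using continuous_on_compact_bounded[OF cpt continuous_on_subset[OF b_continuous BU]] by blast
  define G where "G x = (pflux p (a x) - pflux p (b x)) \<bullet> (a x - b x)" for x
  have G0: "0 \<le> G x" for x
  proof -
    have "0 \<le> p * G x" unfolding G_def pflux_monotone_eq[OF p] by (intro add_nonneg_nonneg picone_nonneg[OF p])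
    then show ?thesis using p by (simp add: zero_le_mult_iff)
  qed
  \<comment> \<open>The truncated function \<open>g\<close> is bounded, and it is integrated against \<open>z\<^sup>p\<close> in a variable of its own.\<close>
  define g where "g x = indicator B x * min 1 (G x)" for x
  define H where "H x = indicator B x * G x" for x
  have Hm[measurable]: "H \<in> borel_measurable borel"
  proof -
    note [measurable] = a_measurable b_measurable measurable_compose[OF _ pflux_measurable[OF p]]
    have "(\<lambda>x. indicator B x * ((pflux p (indicator U x *\<^sub>R a x) - pflux p (indicator U x *\<^sub>R b x)) \<bullet> (indicator U x *\<^sub>R a x - indicator U x *\<^sub>R b x))) \<in> borel_measurable borel"
      by measurable
    also have "(\<lambda>x. indicator B x * ((pflux p (indicator U x *\<^sub>R a x) - pflux p (indicator U x *\<^sub>R b x)) \<bullet> (indicator U x *\<^sub>R a x - indicator U x *\<^sub>R b x))) = H"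
    proof
      fix x show "indicator B x * ((pflux p (indicator U x *\<^sub>R a x) - pflux p (indicator U x *\<^sub>R b x)) \<bullet> (indicator U x *\<^sub>R a x - indicator U x *\<^sub>R b x)) = H x"
        using BU'[of x] by (cases "x \<in> B") (auto simp: H_def G_def)
    qed
    finally show ?thesis .
  qed
  have g_eq: "g x = min (indicator B x) (H x)" for x by (simp add: g_def H_def indicator_def)
  have gm[measurable]: "g \<in> borel_measurable borel" unfolding g_eq[abs_def] by measurable
  have g0: "0 \<le> g x" "g x \<le> 1" "g x \<le> H x" for x using G0[of x] by (auto simp: g_def H_def indicator_def)
  define I where "I = (\<integral>\<^sup>+x. ennreal (g x) \<partial>lborel)"
  define \<epsilon> where "\<epsilon> j = (LINT x|lborel. indicator U x * picone p (w j x *\<^sub>R a x) (grad (w j) x))" for j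
  define vol where "vol = measure lborel B"
  have vol: "0 \<le> vol" "emeasure lborel B = ennreal vol"
  proof -
    show "emeasure lborel B = ennreal vol" unfolding vol_def
      by (intro emeasure_eq_ennreal_measure) (use emeasure_bounded_finite[of B] in \<open>auto simp: B_def\<close>)
  qed (simp add: vol_def)
  define cp where "cp = (2 * r) powr p * measure lborel (cball 0 (2 * r) :: 'a set)"
  have cp: "0 \<le> cp" "ennreal ((2 * r) powr p) * emeasure lborel (cball 0 (2 * r) :: 'a set) = ennreal cp"
  proof -
    have "emeasure lborel (cball 0 (2 * r) :: 'a set) = ennreal (measure lborel (cball 0 (2 * r) :: 'a set))"
      by (intro emeasure_eq_ennreal_measure) (use emeasure_bounded_finite[of "cball 0 (2 * r) :: 'a set"] in auto)
    then show "ennreal ((2 * r) powr p) * emeasure lborel (cball 0 (2 * r) :: 'a set) = ennreal cp"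
      by (simp only: cp_def ennreal_mult''[OF measure_nonneg])
  qed (simp add: cp_def)
  have main: "ennreal (1 / v1 powr p) * I \<le> ennreal (2 powr p * (cp * (1 / v0 powr p * (\<delta> * M powr p + C * (\<epsilon> j / m0))) + vol * (1 / v0 powr p * (\<epsilon> j / \<kappa>))))"
    if \<delta>: "0 < \<delta>" and C: "0 \<le> C" "\<And>x y :: 'a. norm (y - x) powr p \<le> \<delta> * norm x powr p + C * picone p x y" for \<delta> C j
  proof -
    define \<omega> where "\<omega> = w j"
    have \<omega>: "\<omega> \<in> C0_inf \<Omega>" "\<And>x. 0 \<le> \<omega> x" using w by (auto simp: \<omega>_def)
    have \<omega>m[measurable]: "\<omega> \<in> borel_measurable borel" "grad \<omega> \<in> borel_measurable borel"
      using C0_inf_measurable[OF \<omega>(1)] C0_inf_grad_measurable[OF \<omega>(1)] .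
    have i\<omega>: "integrable lborel (\<lambda>x. indicator B x * \<omega> x powr p)"
    proof -
      have "continuous_on (cball x0 r) (\<lambda>x. \<omega> x powr p)"
        using p \<omega> by (intro continuous_on_powr' C0_inf_continuous[OF \<omega>(1)] continuous_on_const) auto
      from borel_integrable_compact[OF cpt this] have i: "integrable lborel (\<lambda>x. indicator (cball x0 r) x * \<omega> x powr p)" by simp
      show ?thesis
        by (rule Bochner_Integration.integrable_bound[OF i]) (use BC in \<open>auto simp: indicator_def intro!: AE_I2\<close>)
    qed
    have \<omega>1: "(\<integral>\<^sup>+x. ennreal (indicator B x * \<omega> x powr p) \<partial>lborel) = 1"
    proof -
      have "(LINT x|lborel. indicator B x * \<omega> x powr p) = (LINT x|lebesgue. indicator B x * \<omega> x powr p)"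
        by (rule integral_completion[symmetric]) measurable
      also have "\<dots> = 1" using w(3)[of j] \<omega>(2) by (simp add: set_lebesgue_integral_def B_def \<omega>_def)
      finally show ?thesis by (subst nn_integral_eq_integral[OF i\<omega>]) auto
    qed
    define E where "E x = indicator U x * (m x * picone p (\<omega> x *\<^sub>R b x) (grad \<omega> x)
                  + k \<omega> x * ((pflux p (a x) - pflux p (b x)) \<bullet> (a x - b x)))" for x
    have E: "integrable lborel E" "(LINT x|lborel. E x) \<le> \<epsilon> j"
      using key_inequality(2,3)[OF \<omega>] unfolding E_def[abs_def] \<epsilon>_def \<omega>_def by auto
    have E0: "0 \<le> E x" for x
    proof (cases "x \<in> U")
      case True
      then show ?thesis unfolding E_def G_def[symmetric]
        by (intro mult_nonneg_nonneg add_nonneg_nonneg m_nonneg k_nonneg picone_nonneg[OF p] G0) auto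
    qed (simp add: E_def)
    have nnE: "(\<integral>\<^sup>+x. ennreal (E x) \<partial>lborel) \<le> ennreal (\<epsilon> j)"
      using E E0 by (subst nn_integral_eq_integral) (auto intro: ennreal_leI)
    have \<epsilon>0: "0 \<le> \<epsilon> j" by (rule order_trans[OF Bochner_Integration.integral_nonneg E(2)]) (rule E0)
    have EB: "m0 * picone p (\<omega> x *\<^sub>R b x) (grad \<omega> x) \<le> E x" "\<kappa> * (\<omega> x powr p * G x) \<le> E x" if x: "x \<in> B" for x
    proof -
      have xC: "x \<in> cball x0 r" and xU: "x \<in> U" using x BC BU' by auto
      have 1: "m0 * picone p (\<omega> x *\<^sub>R b x) (grad \<omega> x) \<le> m x * picone p (\<omega> x *\<^sub>R b x) (grad \<omega> x)"
        by (intro mult_right_mono m0(2)[OF xC] picone_nonneg[OF p])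
      have "\<kappa> * (\<omega> x powr p * G x) \<le> (2 * pospow 1 (1 - s x) * s x) * (\<omega> x powr p * G x)"
        by (intro mult_right_mono \<kappa>(2)[OF xC] mult_nonneg_nonneg G0) auto
      also have "\<dots> = k \<omega> x * G x" using \<omega>(2)[of x] by (simp add: k_def pospow_eq[of "\<omega> x"])
      finally have 2: "\<kappa> * (\<omega> x powr p * G x) \<le> k \<omega> x * G x" .
      have 3: "0 \<le> m0 * picone p (\<omega> x *\<^sub>R b x) (grad \<omega> x)" "0 \<le> \<kappa> * (\<omega> x powr p * G x)"
        using m0(1) \<kappa>(1) by (intro mult_nonneg_nonneg picone_nonneg[OF p] G0 powr_ge_zero; simp)+
      have "E x = m x * picone p (\<omega> x *\<^sub>R b x) (grad \<omega> x) + k \<omega> x * G x" using xU by (simp add: E_def G_def)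
      with 1 2 3 show "m0 * picone p (\<omega> x *\<^sub>R b x) (grad \<omega> x) \<le> E x" "\<kappa> * (\<omega> x powr p * G x) \<le> E x" by linarith+
    qed
    have Em: "E \<in> borel_measurable borel" using borel_measurable_integrable[OF E(1)] by simp
    have scaleE: "(\<integral>\<^sup>+x. ennreal (q * E x) \<partial>lborel) \<le> ennreal (q * \<epsilon> j)" if "0 \<le> q" for q
    proof -
      have "(\<integral>\<^sup>+x. ennreal (q * E x) \<partial>lborel) = ennreal q * (\<integral>\<^sup>+x. ennreal (E x) \<partial>lborel)"
        using that Em by (simp add: ennreal_mult'[OF that] nn_integral_cmult)
      also have "\<dots> \<le> ennreal q * ennreal (\<epsilon> j)" by (intro mult_left_mono nnE) auto
      also have "\<dots> = ennreal (q * \<epsilon> j)" by (rule ennreal_mult'[OF that, symmetric])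
      finally show ?thesis .
    qed
    define z where "z x = \<omega> x / v x" for x
    have zG: "GDERIV z x :> (1 / v x) *\<^sub>R (grad \<omega> x - \<omega> x *\<^sub>R b x)" if x: "x \<in> B" for x
    proof -
      have vx: "0 < v x" using v_pos_U[OF BU'[OF x]] .
      have "GDERIV (\<lambda>x. \<omega> x * inverse (v x)) x :> \<omega> x *\<^sub>R (- (inverse (v x))\<^sup>2 *\<^sub>R grad v x) + inverse (v x) *\<^sub>R grad \<omega> x"
        using vx by (intro GDERIV_mult GDERIV_inverse GDERIV_grad v_diff BU' x C0_inf_differentiable[OF \<omega>(1)]) auto
      also have "(\<lambda>x. \<omega> x * inverse (v x)) = z" by (auto simp: z_def divide_inverse)
      also have "\<omega> x *\<^sub>R (- (inverse (v x))\<^sup>2 *\<^sub>R grad v x) + inverse (v x) *\<^sub>R grad \<omega> x = (1 / v x) *\<^sub>R (grad \<omega> x - \<omega> x *\<^sub>R b x)"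
        using vx by (simp add: b_def scaleR_diff_right power2_eq_square divide_inverse mult_ac)
      finally show ?thesis .
    qed
    have zp: "z x powr p \<le> 1 / v0 powr p * \<omega> x powr p" "1 / v1 powr p * \<omega> x powr p \<le> z x powr p" "0 \<le> z x" if x: "x \<in> B" for x
    proof -
      have xC: "x \<in> cball x0 r" using x BC by auto
      have vx: "0 < v x" "v0 \<le> v x" "v x \<le> v1" using v_pos_U[OF BU'[OF x]] v0(2)[OF xC] v1(2)[OF xC] by auto
      show "0 \<le> z x" using vx \<omega>(2) by (simp add: z_def)
      have e: "z x powr p = \<omega> x powr p / v x powr p" using vx \<omega>(2) by (simp add: z_def powr_divide)
      have "v0 powr p \<le> v x powr p" "v x powr p \<le> v1 powr p" using vx v0(1) p by (auto intro!: powr_mono2)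
      then show "z x powr p \<le> 1 / v0 powr p * \<omega> x powr p" "1 / v1 powr p * \<omega> x powr p \<le> z x powr p"
        unfolding e using vx v0(1) v1pos by (auto intro!: divide_left_mono)
    qed
    have grad_z: "(\<integral>\<^sup>+x. indicator B x * ennreal (norm (grad z x) powr p) \<partial>lborel) \<le> ennreal (1 / v0 powr p * (\<delta> * M powr p + C * (\<epsilon> j / m0)))"
    proof -
      have "(\<integral>\<^sup>+x. indicator B x * ennreal (norm (grad z x) powr p) \<partial>lborel)
         \<le> (\<integral>\<^sup>+x. ennreal ((1 / v0 powr p * (\<delta> * M powr p)) * (indicator B x * \<omega> x powr p)) + ennreal ((1 / v0 powr p * (C / m0)) * E x) \<partial>lborel)"
      proof (rule nn_integral_mono)
        fix x
        show "indicator B x * ennreal (norm (grad z x) powr p)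
          \<le> ennreal ((1 / v0 powr p * (\<delta> * M powr p)) * (indicator B x * \<omega> x powr p)) + ennreal ((1 / v0 powr p * (C / m0)) * E x)"
        proof (cases "x \<in> B")
          case True
          have xC: "x \<in> cball x0 r" using True BC by auto
          have vx: "0 < v x" "v0 \<le> v x" using v_pos_U[OF BU'[OF True]] v0(2)[OF xC] by auto
          have "norm (grad z x) powr p = 1 / v x powr p * norm (grad \<omega> x - \<omega> x *\<^sub>R b x) powr p"
            unfolding grad_eqI[OF zG[OF True]] using vx by (simp add: powr_divide)
          also have "\<dots> \<le> 1 / v0 powr p * norm (grad \<omega> x - \<omega> x *\<^sub>R b x) powr p"
            using vx v0(1) p by (intro mult_right_mono divide_left_mono powr_mono2) auto
          also have "\<dots> \<le> 1 / v0 powr p * (\<delta> * norm (\<omega> x *\<^sub>R b x) powr p + C * picone p (\<omega> x *\<^sub>R b x) (grad \<omega> x))"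
            by (intro mult_left_mono C(2)) auto
          also have "\<dots> \<le> 1 / v0 powr p * (\<delta> * (M powr p * \<omega> x powr p) + C * (E x / m0))"
          proof (intro mult_left_mono add_mono)
            have "norm (\<omega> x *\<^sub>R b x) \<le> M * \<omega> x" using mult_right_mono[OF M(2)[OF xC] \<omega>(2)[of x]] \<omega>(2)[of x] by (simp add: mult.commute)
            then have "norm (\<omega> x *\<^sub>R b x) powr p \<le> (M * \<omega> x) powr p" using p by (intro powr_mono2) auto
            also have "\<dots> = M powr p * \<omega> x powr p" using M(1) \<omega>(2)[of x] by (simp add: powr_mult)
            finally show "norm (\<omega> x *\<^sub>R b x) powr p \<le> M powr p * \<omega> x powr p" .
            show "picone p (\<omega> x *\<^sub>R b x) (grad \<omega> x) \<le> E x / m0"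
              using EB(1)[OF True] m0(1) by (simp add: field_simps)
          qed (use \<delta> C(1) in auto)
          also have "\<dots> = (1 / v0 powr p * (\<delta> * M powr p)) * (indicator B x * \<omega> x powr p) + (1 / v0 powr p * (C / m0)) * E x"
            using True by (simp add: distrib_left mult_ac)
          finally show ?thesis
            using True E0[of x] \<delta> C(1) m0(1)
            by (simp only: indicator_simps mult_1 ennreal_plus[symmetric] mult_nonneg_nonneg divide_nonneg_nonneg powr_ge_zero zero_le_one less_imp_le ennreal_leI)
        qed simp
      qed
      also have "\<dots> = (\<integral>\<^sup>+x. ennreal ((1 / v0 powr p * (\<delta> * M powr p)) * (indicator B x * \<omega> x powr p)) \<partial>lborel)
          + (\<integral>\<^sup>+x. ennreal ((1 / v0 powr p * (C / m0)) * E x) \<partial>lborel)"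
        using Em by (intro nn_integral_add) auto
      also have "(\<integral>\<^sup>+x. ennreal ((1 / v0 powr p * (\<delta> * M powr p)) * (indicator B x * \<omega> x powr p)) \<partial>lborel) = ennreal (1 / v0 powr p * (\<delta> * M powr p))"
      proof -
        have q: "0 \<le> 1 / v0 powr p * (\<delta> * M powr p)" using \<delta> by simp
        have "(\<integral>\<^sup>+x. ennreal ((1 / v0 powr p * (\<delta> * M powr p)) * (indicator B x * \<omega> x powr p)) \<partial>lborel)
           = ennreal (1 / v0 powr p * (\<delta> * M powr p)) * (\<integral>\<^sup>+x. ennreal (indicator B x * \<omega> x powr p) \<partial>lborel)"
          unfolding ennreal_mult'[OF q] by (rule nn_integral_cmult) measurable
        then show ?thesis by (simp only: \<omega>1 mult_1_right)
      qed
      also have "ennreal (1 / v0 powr p * (\<delta> * M powr p)) + (\<integral>\<^sup>+x. ennreal ((1 / v0 powr p * (C / m0)) * E x) \<partial>lborel)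
          \<le> ennreal (1 / v0 powr p * (\<delta> * M powr p)) + ennreal ((1 / v0 powr p * (C / m0)) * \<epsilon> j)"
        using C(1) m0(1) by (intro add_left_mono scaleE) auto
      also have "\<dots> = ennreal (1 / v0 powr p * (\<delta> * M powr p) + (1 / v0 powr p * (C / m0)) * \<epsilon> j)"
        using \<delta> C(1) m0(1) \<epsilon>0 by (intro ennreal_plus[symmetric]) auto
      also have "1 / v0 powr p * (\<delta> * M powr p) + (1 / v0 powr p * (C / m0)) * \<epsilon> j = 1 / v0 powr p * (\<delta> * M powr p + C * (\<epsilon> j / m0))"
        by (simp add: distrib_left)
      finally show ?thesis .
    qed
    let ?PP = "\<integral>\<^sup>+x. indicator B x * (\<integral>\<^sup>+y. indicator B y * ennreal (\<bar>z y - z x\<bar> powr p) \<partial>lborel) \<partial>lborel"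
    have poincare: "?PP \<le> ennreal (cp * (1 / v0 powr p * (\<delta> * M powr p + C * (\<epsilon> j / m0))))"
    proof -
      have "?PP \<le> ennreal ((2 * r) powr p) * emeasure lborel (cball 0 (2 * r) :: 'a set)
          * (\<integral>\<^sup>+x. indicator B x * ennreal (norm (grad z x) powr p) \<partial>lborel)"
      proof (rule poincare_double_integral[OF p])
        show "norm (y - x) \<le> 2 * r" if "x \<in> B" "y \<in> B" for x y
        proof -
          have "dist x y \<le> dist x x0 + dist x0 y" by (rule dist_triangle)
          then show ?thesis using that by (simp add: B_def dist_commute dist_norm norm_minus_commute)
        qed
        show "z differentiable (at x)" if "x \<in> B" for x using zG[OF that] by (rule GDERIV_imp_differentiable)
      qed (auto simp: B_def)
      also have "\<dots> \<le> ennreal cp * ennreal (1 / v0 powr p * (\<delta> * M powr p + C * (\<epsilon> j / m0)))"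
        unfolding cp(2) by (intro mult_left_mono grad_z) auto
      also have "\<dots> = ennreal (cp * (1 / v0 powr p * (\<delta> * M powr p + C * (\<epsilon> j / m0))))"
        by (rule ennreal_mult'[OF cp(1), symmetric])
      finally show ?thesis .
    qed
    have mono: "(\<integral>\<^sup>+x. ennreal (indicator B x * (z x powr p * H x)) \<partial>lborel) \<le> ennreal (1 / v0 powr p * (\<epsilon> j / \<kappa>))"
    proof -
      have "(\<integral>\<^sup>+x. ennreal (indicator B x * (z x powr p * H x)) \<partial>lborel) \<le> (\<integral>\<^sup>+x. ennreal ((1 / v0 powr p / \<kappa>) * E x) \<partial>lborel)"
      proof (rule nn_integral_mono)
        fix x
        show "ennreal (indicator B x * (z x powr p * H x)) \<le> ennreal ((1 / v0 powr p / \<kappa>) * E x)"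
        proof (cases "x \<in> B")
          case True
          have "z x powr p * G x \<le> (1 / v0 powr p * \<omega> x powr p) * G x" by (intro mult_right_mono zp(1)[OF True] G0)
          also have "\<dots> = 1 / v0 powr p * (\<omega> x powr p * G x)" by simp
          also have "\<dots> \<le> 1 / v0 powr p * (E x / \<kappa>)"
            using EB(2)[OF True] \<kappa>(1) by (intro mult_left_mono) (auto simp: field_simps)
          finally show ?thesis using True by (intro ennreal_leI) (simp add: H_def mult_ac)
        next
          case False
          then have "indicator B x * (z x powr p * H x) = 0" by simp
          then show ?thesis by (simp only: ennreal_0 zero_le)
        qed
      qed
      also have "\<dots> \<le> ennreal ((1 / v0 powr p / \<kappa>) * \<epsilon> j)" using \<kappa>(1) by (intro scaleE) auto
      finally show ?thesis by simp
    qed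
    have zm: "(\<lambda>x. indicator B x *\<^sub>R z x) \<in> borel_measurable borel"
    proof (rule borel_measurable_continuous_on_indicator)
      show "continuous_on B z"
        using GDERIV_imp_differentiable[OF zG] by (rule continuous_on_if_differentiable)
    qed simp
    define Z where "Z x = indicator B x *\<^sub>R z x" for x
    have Zm[measurable]: "Z \<in> borel_measurable borel" using zm unfolding Z_def[abs_def] .
    have ZB: "Z x = z x" if "x \<in> B" for x using that by (simp add: Z_def)
    have Z0: "Z x = 0" if "x \<notin> B" for x using that by (simp add: Z_def)
    have Z_nonneg: "0 \<le> Z x" for x using zp(3)[of x] ZB Z0 by (cases "x \<in> B") auto
    have gB: "g x = 0" "H x = 0" if "x \<notin> B" for x using that by (auto simp: g_def H_def)
    have lower: "ennreal (1 / v1 powr p) \<le> (\<integral>\<^sup>+x. ennreal (Z x powr p) \<partial>lborel)"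
    proof -
      have "ennreal (1 / v1 powr p) = ennreal (1 / v1 powr p) * (\<integral>\<^sup>+x. ennreal (indicator B x * \<omega> x powr p) \<partial>lborel)"
        by (simp only: \<omega>1 mult_1_right)
      also have "\<dots> = (\<integral>\<^sup>+x. ennreal (1 / v1 powr p) * ennreal (indicator B x * \<omega> x powr p) \<partial>lborel)"
        by (rule nn_integral_cmult[symmetric]) measurable
      also have "\<dots> \<le> (\<integral>\<^sup>+x. ennreal (Z x powr p) \<partial>lborel)"
      proof (rule nn_integral_mono)
        fix x
        show "ennreal (1 / v1 powr p) * ennreal (indicator B x * \<omega> x powr p) \<le> ennreal (Z x powr p)"
        proof (cases "x \<in> B")
          case True
          have "ennreal (1 / v1 powr p) * ennreal (\<omega> x powr p) = ennreal (1 / v1 powr p * \<omega> x powr p)"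
            by (rule ennreal_mult''[symmetric]) simp
          also have "\<dots> \<le> ennreal (z x powr p)" by (intro ennreal_leI zp(2)[OF True])
          finally show ?thesis using True by (simp add: ZB)
        qed simp
      qed
      finally show ?thesis .
    qed
    let ?J = "\<lambda>x y. indicator B x * (indicator B y * ennreal (\<bar>Z y - Z x\<bar> powr p))"
    \<comment> \<open>Compare the mass at \<open>x\<close> with the mass at \<open>y\<close>; the former is bounded below, the latter is multiplied by \<open>H y\<close>.\<close>
    have point: "ennreal (Z x powr p) * ennreal (g y) \<le> ennreal (2 powr p) * (?J x y + indicator B x * ennreal (indicator B y * (Z y powr p * H y)))" for x y
    proof (cases "x \<in> B \<and> y \<in> B")
      case True
      have "Z x powr p \<le> (\<bar>Z y - Z x\<bar> + Z y) powr p" using p Z_nonneg by (intro powr_mono2) auto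
      also have "\<dots> \<le> 2 powr p * (\<bar>Z y - Z x\<bar> powr p + Z y powr p)" using p Z_nonneg by (intro powr_add_le) auto
      finally have "Z x powr p * g y \<le> (2 powr p * (\<bar>Z y - Z x\<bar> powr p + Z y powr p)) * g y" using g0 by (intro mult_right_mono)
      also have "\<dots> = 2 powr p * (\<bar>Z y - Z x\<bar> powr p * g y + Z y powr p * g y)" by (simp add: algebra_simps)
      also have "\<dots> \<le> 2 powr p * (\<bar>Z y - Z x\<bar> powr p * 1 + Z y powr p * H y)"
        using g0 by (intro mult_left_mono add_mono) auto
      finally have "ennreal (Z x powr p * g y) \<le> ennreal (2 powr p * (\<bar>Z y - Z x\<bar> powr p + Z y powr p * H y))" by (intro ennreal_leI) simp
      also have "\<dots> = ennreal (2 powr p) * (ennreal (\<bar>Z y - Z x\<bar> powr p) + ennreal (Z y powr p * H y))"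
        using G0[of y] by (subst ennreal_mult', simp, subst ennreal_plus) (auto simp: H_def)
      finally show ?thesis using True g0 by (simp add: ennreal_mult'')
    next
      case False
      then have "ennreal (Z x powr p) * ennreal (g y) = 0" using p by (auto simp: Z0 gB)
      then show ?thesis by (simp only: zero_le)
    qed
    have Jm: "(\<lambda>y. ?J x y) \<in> borel_measurable borel" for x by measurable
    have Jmm: "(\<lambda>x. \<integral>\<^sup>+y. ?J x y \<partial>lborel) \<in> borel_measurable borel" by measurable
    let ?h = "\<integral>\<^sup>+y. ennreal (indicator B y * (Z y powr p * H y)) \<partial>lborel"
    have inner: "(\<integral>\<^sup>+y. ennreal (2 powr p) * (?J x y + indicator B x * ennreal (indicator B y * (Z y powr p * H y))) \<partial>lborel)
      = ennreal (2 powr p) * ((\<integral>\<^sup>+y. ?J x y \<partial>lborel) + indicator B x * ?h)" for x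
      by (subst nn_integral_cmult, measurable, subst nn_integral_add, measurable, subst (2) nn_integral_cmult) auto
    have "ennreal (1 / v1 powr p) * I \<le> (\<integral>\<^sup>+x. ennreal (Z x powr p) \<partial>lborel) * I"
      by (intro mult_right_mono lower) simp
    also have "\<dots> = (\<integral>\<^sup>+x. (\<integral>\<^sup>+y. ennreal (Z x powr p) * ennreal (g y) \<partial>lborel) \<partial>lborel)"
      unfolding I_def by (simp add: nn_integral_cmult nn_integral_multc)
    also have "\<dots> \<le> (\<integral>\<^sup>+x. (\<integral>\<^sup>+y. ennreal (2 powr p) * (?J x y + indicator B x * ennreal (indicator B y * (Z y powr p * H y))) \<partial>lborel) \<partial>lborel)"
      by (intro nn_integral_mono point)
    also have "\<dots> = ennreal (2 powr p) * ((\<integral>\<^sup>+x. (\<integral>\<^sup>+y. ?J x y \<partial>lborel) \<partial>lborel) + emeasure lborel B * ?h)"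
      unfolding inner using Jmm
      by (simp add: nn_integral_cmult nn_integral_add nn_integral_multc)
    also have "(\<integral>\<^sup>+x. (\<integral>\<^sup>+y. ?J x y \<partial>lborel) \<partial>lborel) = ?PP"
    proof (rule nn_integral_cong)
      fix x
      show "(\<integral>\<^sup>+y. ?J x y \<partial>lborel) = indicator B x * (\<integral>\<^sup>+y. indicator B y * ennreal (\<bar>z y - z x\<bar> powr p) \<partial>lborel)"
      proof (cases "x \<in> B")
        case True
        then show ?thesis by (auto intro!: nn_integral_cong simp: indicator_def ZB)
      qed simp
    qed
    also have "?h = (\<integral>\<^sup>+y. ennreal (indicator B y * (z y powr p * H y)) \<partial>lborel)"
      by (intro nn_integral_cong) (auto simp: indicator_def ZB)
    also have "ennreal (2 powr p) * (?PP + emeasure lborel B * (\<integral>\<^sup>+y. ennreal (indicator B y * (z y powr p * H y)) \<partial>lborel))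
        \<le> ennreal (2 powr p) * (ennreal (cp * (1 / v0 powr p * (\<delta> * M powr p + C * (\<epsilon> j / m0)))) + ennreal vol * ennreal (1 / v0 powr p * (\<epsilon> j / \<kappa>)))"
      unfolding vol(2) by (intro mult_left_mono add_mono poincare mono) auto
    also have "\<dots> = ennreal (2 powr p * (cp * (1 / v0 powr p * (\<delta> * M powr p + C * (\<epsilon> j / m0))) + vol * (1 / v0 powr p * (\<epsilon> j / \<kappa>))))"
    proof -
      have n1: "0 \<le> cp * (1 / v0 powr p * (\<delta> * M powr p + C * (\<epsilon> j / m0)))"
        using cp(1) \<delta> C(1) \<epsilon>0 m0(1) by (intro mult_nonneg_nonneg add_nonneg_nonneg divide_nonneg_nonneg) auto
      have n2: "0 \<le> vol * (1 / v0 powr p * (\<epsilon> j / \<kappa>))"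
        using vol(1) \<epsilon>0 \<kappa>(1) by (intro mult_nonneg_nonneg divide_nonneg_nonneg) auto
      show ?thesis
        by (simp only: ennreal_mult'[OF vol(1), symmetric] ennreal_plus[OF n1 n2, symmetric] ennreal_mult'[OF powr_ge_zero, symmetric])
    qed
    finally show ?thesis .
  qed
  have small: "ennreal (1 / v1 powr p) * I \<le> ennreal e" if e: "0 < e" for e
  proof -
    \<comment> \<open>First \<open>\<delta>\<close>, then the constant \<open>C\<close> of the coercivity, then the index \<open>j\<close>.\<close>
    define \<delta> where "\<delta> = e / (2 * (2 powr p * cp * (1 / v0 powr p) * M powr p + 1))"
    have q0: "0 \<le> 2 powr p * cp * (1 / v0 powr p) * M powr p" using cp(1) by simp
    then have \<delta>: "0 < \<delta>" using e by (simp add: \<delta>_def add_nonneg_pos)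
    have \<delta>e: "(2 powr p * cp * (1 / v0 powr p) * M powr p) * \<delta> \<le> e / 2"
    proof -
      have *: "q * (e / (2 * (q + 1))) \<le> e / 2" if "0 \<le> q" for q using that e by (simp add: field_simps)
      show ?thesis unfolding \<delta>_def by (rule *[OF q0])
    qed
    obtain C where C: "0 \<le> C" "\<And>x y :: 'a. norm (y - x) powr p \<le> \<delta> * norm x powr p + C * picone p x y"
      using picone_coercive[OF p \<delta>] by blast
    define Q where "Q = 2 powr p * (cp * (1 / v0 powr p * (C / m0)) + vol * (1 / v0 powr p / \<kappa>))"
    have "(\<lambda>j. Q * \<epsilon> j) \<longlonglongrightarrow> Q * 0" using lim unfolding \<epsilon>_def by (intro tendsto_intros)
    then have "\<forall>\<^sub>F j in sequentially. Q * \<epsilon> j < e / 2" using e by (intro order_tendstoD(2)) auto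
    then obtain j where j: "Q * \<epsilon> j < e / 2" by (auto simp: eventually_sequentially)
    have "2 powr p * (cp * (1 / v0 powr p * (\<delta> * M powr p + C * (\<epsilon> j / m0))) + vol * (1 / v0 powr p * (\<epsilon> j / \<kappa>)))
      = (2 powr p * cp * (1 / v0 powr p) * M powr p) * \<delta> + Q * \<epsilon> j"
      unfolding Q_def by (simp add: algebra_simps)
    also have "\<dots> \<le> e" using \<delta>e j by linarith
    finally show ?thesis by (rule order_trans[OF main[OF \<delta> C, of j] ennreal_leI])
  qed
  have "ennreal (1 / v1 powr p) * I \<le> 0"
  proof (rule ennreal_le_epsilon)
    fix e :: real assume "0 < e"
    then show "ennreal (1 / v1 powr p) * I \<le> 0 + ennreal e" unfolding add_0 by (rule small)
  qed
  then have "I = 0" using v1pos by simp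
  then have "AE x in lborel. ennreal (g x) = 0" unfolding I_def by (subst (asm) nn_integral_0_iff_AE) auto
  then show ?thesis
  proof eventually_elim
    case (elim x)
    show ?case
    proof
      assume "x \<in> ball x0 r"
      then have "min 1 (G x) \<le> 0" using elim by (simp add: g_def B_def ennreal_eq_0_iff)
      then have "G x = 0" using G0[of x] by linarith
      then have "picone p (a x) (b x) + picone p (b x) (a x) = 0"
        using pflux_monotone_eq[OF p, of "a x" "b x"] by (simp add: G_def)
      then have "picone p (a x) (b x) = 0"
        using picone_nonneg[OF p, of "a x" "b x"] picone_nonneg[OF p, of "b x" "a x"] by linarith
      then show "a x = b x" by (rule picone_eq_0[OF p])
    qed
  qed
qed

end

section \<open>The comparison principle\<close>

text \<open>
  Moving from a boundary point against the gradient of the defining function leads into the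
  interior, so every boundary point is a limit of interior points.
\<close>

lemma smooth_boundary_closure_interior:
  fixes K :: "'a::euclidean_space set"
  assumes K: "closed K" and sb: "smooth_boundary K"
  shows "closure (interior K) = K"
proof
  show "closure (interior K) \<subseteq> K" using K interior_subset by (metis closure_minimal)
  show "K \<subseteq> closure (interior K)"
  proof
    fix x assume x: "x \<in> K"
    show "x \<in> closure (interior K)"
    proof (cases "x \<in> interior K")
      case True then show ?thesis using closure_subset by blast
    next
      case False
      then have xF: "x \<in> frontier K" using x K by (simp add: frontier_def)
      from sb[unfolded smooth_boundary_def, rule_format, OF this]
      obtain W \<rho> where W: "open W" "x \<in> W" "smooth_on W \<rho>" "\<forall>y\<in>W. grad \<rho> y \<noteq> 0"
        "interior K \<inter> W = {y\<in>W. \<rho> y < 0}" "frontier K \<inter> W = {y\<in>W. \<rho> y = 0}" by blast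
      have "Ck_on (Suc 0) W \<rho>" using W(3) unfolding smooth_on_def by blast
      then have "\<rho> differentiable (at x)" using W(2) by simp
      then have G: "GDERIV \<rho> x :> grad \<rho> x" by (rule GDERIV_grad)
      have \<rho>0: "\<rho> x = 0" using W(2,6) xF by blast
      define n where "n = - grad \<rho> x"
      have "((\<lambda>t. \<rho> (x + t *\<^sub>R n)) has_real_derivative n \<bullet> grad \<rho> x) (at 0)"
        using GDERIV_along_line[of \<rho> x 0 n "grad \<rho> x"] G by simp
      moreover have "n \<bullet> grad \<rho> x < 0" using W(2,4) by (auto simp: n_def)
      ultimately obtain d where d: "0 < d" "\<And>h. 0 < h \<Longrightarrow> h < d \<Longrightarrow> \<rho> (x + h *\<^sub>R n) < \<rho> (x + 0 *\<^sub>R n)"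
        using DERIV_neg_dec_right[of "\<lambda>t. \<rho> (x + t *\<^sub>R n)" "n \<bullet> grad \<rho> x" 0] by auto
      show ?thesis unfolding closure_approachable
      proof (intro allI impI)
        fix e :: real assume e: "0 < e"
        obtain e' where e': "0 < e'" "ball x e' \<subseteq> W" using W(1,2) open_contains_ball by blast
        define h where "h = min (d / 2) (min e e' / (2 * (norm n + 1)))"
        have h: "0 < h" "h < d" using d e e' by (auto simp: h_def add_nonneg_pos)
        have "h * norm n \<le> min e e' / (2 * (norm n + 1)) * norm n" unfolding h_def by (intro mult_right_mono) auto
        also have "\<dots> < min e e'"
        proof -
          have *: "q / (2 * (t + 1)) * t < q" if "0 < q" "0 \<le> t" for q t :: real
            using that by (simp add: field_simps add_nonneg_pos)
          show ?thesis by (rule *) (use e e' in auto)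
        qed
        finally have hn: "h * norm n < min e e'" .
        have dxy: "dist (x + h *\<^sub>R n) x = h * norm n" using h by (simp add: dist_norm)
        have "x + h *\<^sub>R n \<in> W" using e'(2) hn dxy by (auto simp: dist_commute)
        then have "x + h *\<^sub>R n \<in> interior K" using d(2)[OF h] \<rho>0 W(5) by auto
        then show "\<exists>y\<in>interior K. dist y x < e" using dxy hn by (intro bexI[of _ "x + h *\<^sub>R n"]) auto
      qed
    qed
  qed
qed

lemma smooth_boundary_interior:
  fixes K :: "'a::euclidean_space set"
  assumes K: "closed K" and sb: "smooth_boundary K"
  shows "smooth_boundary (interior K)"
proof -
  have "frontier (interior K) = frontier K"
    using smooth_boundary_closure_interior[OF K sb] K by (simp add: frontier_def)
  then show ?thesis using sb by (simp add: smooth_boundary_def)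
qed

context comparison_pair
begin

text \<open>
  Where \<open>u > c v\<close>, the quotient \<open>s = c v / u\<close> is locally constant. Its level set at a value
  below \<open>1\<close> keeps away from \<open>K\<close>, so it is open and closed in \<open>\<Omega>\<close>.
\<close>

lemma superlevel_empty:
  assumes connected: "connected \<Omega>" and K: "K \<noteq> {}" "K \<subseteq> \<Omega>"
    and loc: "\<And>x r. 0 < r \<Longrightarrow> cball x r \<subseteq> U \<Longrightarrow> (\<And>y. y \<in> cball x r \<Longrightarrow> c * v y < u y) \<Longrightarrow> AE y in lborel. y \<in> ball x r \<longrightarrow> a y = b y"
    and x0: "x0 \<in> U"
  shows "u x0 \<le> c * v x0"
proof (rule ccontr)
  assume "\<not> u x0 \<le> c * v x0"
  then have gt0: "c * v x0 < u x0" by simp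
  define \<sigma> where "\<sigma> = s x0"
  have \<sigma>: "\<sigma> < 1" using gt0 u_pos_U[OF x0] by (simp add: \<sigma>_def s_def)
  define E where "E = {x \<in> U. s x = \<sigma>}"
  have s_less: "s x < 1 \<longleftrightarrow> c * v x < u x" if "x \<in> U" for x using u_pos_U[OF that] by (simp add: s_def)
  have openE: "open E" unfolding open_contains_ball
  proof
    fix x assume x: "x \<in> E"
    then have xU: "x \<in> U" by (simp add: E_def)
    have "open (U \<inter> s -` {..<1})"
      by (rule continuous_open_preimage[OF cont_s open_U]) simp
    moreover have "x \<in> U \<inter> s -` {..<1}" using x \<sigma> by (simp add: E_def)
    ultimately obtain r where r: "0 < r" "cball x r \<subseteq> U \<inter> s -` {..<1}" using open_contains_cball by blast
    have "AE y in lborel. y \<in> ball x r \<longrightarrow> a y = b y"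
    proof (rule loc[OF r(1)])
      show "cball x r \<subseteq> U" using r(2) by blast
      show "c * v y < u y" if "y \<in> cball x r" for y
      proof -
        have "y \<in> U" "s y < 1" using r(2) that by auto
        then show ?thesis using s_less by blast
      qed
    qed
    then have "AE y in lborel. y \<in> ball x r \<longrightarrow> grad s y = 0"
    proof eventually_elim
      case (elim y)
      show ?case
      proof
        assume y: "y \<in> ball x r"
        then have "y \<in> U" using r(2) ball_subset_cball by blast
        from grad_eqI[OF GDERIV_s[OF this]] show "grad s y = 0" using elim y by simp
      qed
    qed
    moreover have "s differentiable (at y)" if "y \<in> ball x r" for y
    proof -
      have "y \<in> U" using that r(2) ball_subset_cball by blast
      then show ?thesis by (rule GDERIV_imp_differentiable[OF GDERIV_s])
    qed
    ultimately have const: "s y = s x" if "y \<in> ball x r" for y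
      using that r(1) by (intro eq_const_if_grad_AE_0[of "ball x r" s y x]) auto
    have "ball x r \<subseteq> E"
    proof
      fix y assume y: "y \<in> ball x r"
      then have "y \<in> U" using r(2) ball_subset_cball by blast
      then show "y \<in> E" using const[OF y] x by (simp add: E_def)
    qed
    then show "\<exists>e>0. ball x e \<subseteq> E" using r(1) by blast
  qed
  have closedE: "closedin (top_of_set \<Omega>) E"
  proof -
    define F where "F = \<Omega> - interior K"
    have cu: "continuous_on F u" "continuous_on F v"
      using continuous_on_subset[OF u_cont sub_W] v_cont by (simp_all add: F_def)
    have "openin (top_of_set \<Omega>) (interior K)" using K(2) interior_subset by (intro open_subset) auto
    then have "closedin (top_of_set \<Omega>) F" unfolding F_def by (intro closedin_diff) auto
    moreover have "closedin (top_of_set F) (F \<inter> (\<lambda>x. c * v x - \<sigma> * u x) -` {0})"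
      by (intro continuous_closedin_preimage continuous_on_diff continuous_on_mult continuous_on_const cu) simp
    ultimately have "closedin (top_of_set \<Omega>) (F \<inter> (\<lambda>x. c * v x - \<sigma> * u x) -` {0})"
      by (rule closedin_trans[rotated])
    also have "F \<inter> (\<lambda>x. c * v x - \<sigma> * u x) -` {0} = E"
    proof (intro equalityI subsetI)
      fix x assume "x \<in> F \<inter> (\<lambda>x. c * v x - \<sigma> * u x) -` {0}"
      then have x: "x \<in> \<Omega> - interior K" "c * v x = \<sigma> * u x" by (auto simp: F_def)
      have ux: "0 < u x" using u_pos sub_W x(1) by blast
      have "\<sigma> * u x < 1 * u x" using ux \<sigma> by (intro mult_strict_right_mono)
      then have lt: "c * v x \<le> u x" using x(2) by simp
      have "x \<in> U" using compact_superlevel(2)[of "{x}"] x(1) lt by auto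
      then show "x \<in> E" using x(2) ux by (simp add: E_def s_def)
    next
      fix x assume x: "x \<in> E"
      then have xU: "x \<in> U" by (simp add: E_def)
      then show "x \<in> F \<inter> (\<lambda>x. c * v x - \<sigma> * u x) -` {0}"
        using x u_pos_U[OF xU] U_int[OF xU] by (auto simp: E_def F_def s_def)
    qed
    finally show ?thesis .
  qed
  have "openin (top_of_set \<Omega>) E" using openE by (auto simp: E_def openin_open)
  then have "E = {} \<or> E = \<Omega>" using connected closedE by (auto simp: connected_clopen)
  moreover have "x0 \<in> E" using x0 by (simp add: E_def \<sigma>_def)
  moreover have "E \<inter> K = {}" by (auto simp: E_def)
  ultimately show False using K by blast
qed

end

theorem theorem7p1:
  fixes \<Omega> \<Omega>1 :: "'a::euclidean_space set" and V u :: "'a \<Rightarrow> real" and p :: real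
  assumes "DIM('a) \<ge> 2" and "1 < p"
    and "open \<Omega>" and "connected \<Omega>" and "\<Omega> \<noteq> {}"
    and "V \<in> Linf_loc \<Omega>"
    and "\<forall>\<phi>\<in>C0_inf \<Omega>. 0 \<le> Q_V p V \<Omega> \<phi>"
    and "open \<Omega>1" and "compactly_in \<Omega>1 \<Omega>"
    and "continuous_on (\<Omega> - \<Omega>1) u"
    and "positive_solution p V (\<Omega> - closure \<Omega>1) u"
    and "\<forall>x\<in>\<Omega> - closure \<Omega>1. u differentiable (at x) \<and> norm (grad u x) \<noteq> 0"
    and "\<forall>\<Omega>2 B. open \<Omega>2 \<and> smooth_boundary \<Omega>2 \<and> compactly_in \<Omega>1 \<Omega>2 \<and> compactly_in \<Omega>2 \<Omega> \<and>
           open B \<and> B \<noteq> {} \<and> compactly_in B (\<Omega> - closure \<Omega>2) \<longrightarrow>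
           (\<exists>U :: nat \<Rightarrow> 'a \<Rightarrow> real.
              (\<forall>k. U k \<in> C0_inf \<Omega> \<and> (\<forall>x. 0 \<le> U k x) \<and>
                   (LINT x:B|lebesgue. \<bar>U k x\<bar> powr p) = 1) \<and>
              (\<lambda>k. LINT x:(\<Omega> - closure \<Omega>2)|lebesgue. L p (U k) u x) \<longlonglongrightarrow> 0)"
  shows "u \<in> minimal_growth p V \<Omega> (closure \<Omega>1)"
proof -
  have pos: "positive_solution p V (\<Omega> - closure \<Omega>1) u" by fact
  have "u x0 \<le> v x0"
    if K: "compact K" "K \<noteq> {}" "K \<subseteq> \<Omega>" "smooth_boundary K" "compactly_in (closure \<Omega>1) (interior K)"
      and v: "continuous_on ((\<Omega> - K) \<union> frontier K) v" "supersolution p V (\<Omega> - K) v" "\<forall>x\<in>\<Omega> - K. 0 < v x"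
        "\<forall>x\<in>frontier K. u x \<le> v x" and x0: "x0 \<in> \<Omega> - K" for K v x0
  proof (rule ccontr)
    assume "\<not> u x0 \<le> v x0"
    then have gt: "v x0 < u x0" by simp
    have clK: "closed K" using K(1) by (rule compact_imp_closed)
    have sub: "closure \<Omega>1 \<subseteq> interior K" using K(5) by (simp add: compactly_in_def)
    \<comment> \<open>The midpoint of \<open>1\<close> and \<open>u x0 / v x0\<close>.\<close>
    define c where "c = (1 + u x0 / v x0) / 2"
    have vx0: "0 < v x0" using v(3) x0 by blast
    have c_gt: "1 < c" "c * v x0 < u x0" using vx0 gt by (auto simp: c_def field_simps)
    define W where "W = \<Omega> - closure \<Omega>1"
    have front: "frontier K = K - interior K" using clK by (simp add: frontier_def)
    have int: "\<Omega> - interior K = (\<Omega> - K) \<union> frontier K"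
      using K(3) interior_subset[of K] unfolding front by blast
    have upos: "0 < u x" if "x \<in> W" for x using pos that by (auto simp: positive_solution_def W_def)
    interpret comparison_pair p c V u v \<Omega> W K
    proof
      show "1 < p" "open \<Omega>" "compact K" "V \<in> Linf_loc \<Omega>" "1 < c" by fact+
      show "open W" unfolding W_def using \<open>open \<Omega>\<close> by (intro open_Diff) auto
      show subW: "\<Omega> - interior K \<subseteq> W" using sub by (auto simp: W_def)
      show "W \<subseteq> \<Omega>" by (auto simp: W_def)
      show "continuous_on W u" "weak_solution p V W u" using pos by (auto simp: positive_solution_def W_def)
      show "\<And>x. x \<in> W \<Longrightarrow> 0 < u x" by (rule upos)
      show "\<And>x. x \<in> W \<Longrightarrow> u differentiable (at x)" using assms(12) by (simp add: W_def)
      show "continuous_on (\<Omega> - interior K) v" using v(1) by (simp only: int)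
      show "0 < v x" if "x \<in> \<Omega> - interior K" for x
      proof (cases "x \<in> frontier K")
        case True
        have "0 < u x" using upos subW that by blast
        also have "u x \<le> v x" using v(4) True by blast
        finally show ?thesis .
      next
        case False
        then show ?thesis using v(3) that unfolding int by blast
      qed
      show "supersolution p V (\<Omega> - K) v" by (rule v(2))
      show "u x \<le> v x" if "x \<in> frontier K" for x using v(4) that by blast
    qed
    have cli: "closure (interior K) = K" by (rule smooth_boundary_closure_interior[OF clK K(4)])
    \<comment> \<open>The hypothesis is applied with \<open>\<Omega>2 = interior K\<close>, whose closure is \<open>K\<close>, and with the ball as \<open>B\<close>.\<close>
    have "AE y in lborel. y \<in> ball x r \<longrightarrow> a y = b y"
      if r: "0 < r" and ball: "cball x r \<subseteq> \<Omega> - K" and above: "\<And>y. y \<in> cball x r \<Longrightarrow> c * v y < u y" for x r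
    proof -
      have "compactly_in \<Omega>1 (interior K)" using sub \<open>compactly_in \<Omega>1 \<Omega>\<close> by (simp add: compactly_in_def)
      moreover have "compactly_in (interior K) \<Omega>" using K by (simp add: compactly_in_def cli)
      moreover have "compactly_in (ball x r) (\<Omega> - closure (interior K))"
        using r ball by (simp add: compactly_in_def cli)
      moreover have "ball x r \<noteq> {}" using r by simp
      ultimately have "\<exists>U :: nat \<Rightarrow> 'a \<Rightarrow> real.
          (\<forall>k. U k \<in> C0_inf \<Omega> \<and> (\<forall>x. 0 \<le> U k x) \<and> (LINT y:ball x r|lebesgue. \<bar>U k y\<bar> powr p) = 1) \<and>
          (\<lambda>k. LINT y:(\<Omega> - closure (interior K))|lebesgue. L p (U k) u y) \<longlonglongrightarrow> 0"
        using assms(13)[rule_format, of "interior K" "ball x r"] smooth_boundary_interior[OF clK K(4)]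
        by (simp only: open_interior open_ball simp_thms)
      then obtain w where w0: "\<forall>k. w k \<in> C0_inf \<Omega> \<and> (\<forall>x. 0 \<le> w k x) \<and> (LINT y:ball x r|lebesgue. \<bar>w k y\<bar> powr p) = 1"
        and lim: "(\<lambda>j. LINT y:(\<Omega> - closure (interior K))|lebesgue. L p (w j) u y) \<longlonglongrightarrow> 0"
        by (elim exE conjE)
      have w: "\<And>j. w j \<in> C0_inf \<Omega>" "\<And>j x. 0 \<le> w j x" "\<And>j. (LINT y:ball x r|lebesgue. \<bar>w j y\<bar> powr p) = 1"
        using w0 by blast+
      have eq: "(LINT y|lborel. indicator (\<Omega> - K) y * picone p (w j y *\<^sub>R a y) (grad (w j) y))
          = p * (LINT y:(\<Omega> - closure (interior K))|lebesgue. L p (w j) u y)" for j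
      proof -
        have "(LINT y|lborel. indicator (\<Omega> - K) y * picone p (w j y *\<^sub>R a y) (grad (w j) y))
            = (LINT y|lebesgue. indicator (\<Omega> - K) y * picone p (w j y *\<^sub>R a y) (grad (w j) y))"
          using borel_measurable_integrable[OF key_inequality(1)[OF w(1,2)]] by (intro integral_completion[symmetric])
        also have "\<dots> = (LINT y|lebesgue. p * (indicator (\<Omega> - closure (interior K)) y *\<^sub>R L p (w j) u y))"
        proof (rule Bochner_Integration.integral_cong[OF refl])
          fix y
          show "indicator (\<Omega> - K) y * picone p (w j y *\<^sub>R a y) (grad (w j) y) = p * (indicator (\<Omega> - closure (interior K)) y *\<^sub>R L p (w j) u y)"
          proof (cases "y \<in> \<Omega> - K")
            case True
            have "p * L p (w j) u y = picone p ((w j y / u y) *\<^sub>R grad u y) (grad (w j) y)"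
              using w(2) u_pos_U[OF True] p by (rule L_eq_picone)
            then show ?thesis using True by (simp add: cli a_def)
          qed (simp add: cli)
        qed
        also have "\<dots> = p * (LINT y:(\<Omega> - closure (interior K))|lebesgue. L p (w j) u y)"
          by (simp add: set_lebesgue_integral_def)
        finally show ?thesis .
      qed
      have "(\<lambda>j. p * (LINT y:(\<Omega> - closure (interior K))|lebesgue. L p (w j) u y)) \<longlonglongrightarrow> p * 0"
        using lim by (rule tendsto_mult_left)
      then have "(\<lambda>j. LINT y|lborel. indicator (\<Omega> - K) y * picone p (w j y *\<^sub>R a y) (grad (w j) y)) \<longlonglongrightarrow> 0"
        unfolding eq by simp
      from log_gradients_agree_AE[OF r ball above w this] show ?thesis .
    qed
    from superlevel_empty[OF \<open>connected \<Omega>\<close> K(2,3) this x0] c_gt(2) show False by simp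
  qed
  then show ?thesis unfolding minimal_growth_def using pos by blast
qed

end
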